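(* Let $N\ge 1$ and let $\mathcal{H}$ be either the Hardy space $H^2(B_N)$ or a weighted Bergman space $A^2_s(B_N)$ with $s>-1$. Let $\varphi$ and $\psi$ be analytic self-maps of $B_N$ that induce bounded composition operators $C_\varphi$ and $C_\psi$ on $\mathcal{H}$, and suppose that $\varphi$ has finite angular derivative at a point $\zeta\in\partial B_N$. Then, unless $\psi(\zeta)=\varphi(\zeta)$ (as radial limits) and $d_\psi(\zeta)=d_\varphi(\zeta)$, we have $$\|C_\varphi-C_\psi\|_e^2\ \ge\ d_\varphi(\zeta)^{-\beta},$$ where $\beta=N$ if $\mathcal{H}=H^2(B_N)$ and $\beta=N+s+1$ if $\mathcal{H}=A^2_s(B_N)$.
   Context: $B_N$ is the open unit ball of $\mathbb{C}^N$, $\partial B_N$ the unit sphere, $\langle\cdot,\cdot\rangle$ the standard Hermitian inner product, $\sigma$ normalized Lebesgue measure on $\partial B_N$, $\nu$ normalized Lebesgue volume measure on $B_N$. $H^2(B_N)$ is the Hilbert space of holomorphic $f$ on $B_N$ with $\|f\|_2^2=\sup_{0<r<1}\int_{\partial B_N}|f(r\zeta)|^2\,d\sigma(\zeta)<\infty$. For $s>-1$, $A^2_s(B_N)$ is the Hilbert space of holomorphic $f$ on $B_N$ with $\|f\|_{2,s}^2=\int_{B_N}|f(z)|^2 w_s(z)\,d\nu(z)<\infty$, where $w_s(z)=\frac{\Gamma(N+s+1)}{\Gamma(N+1)\Gamma(s+1)}(1-|z|^2)^s$. For an analytic map $\varphi:B_N\to B_N$, $C_\varphi f=f\circ\varphi$.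 The essential norm of a bounded operator $T$ on $\mathcal{H}$ is $\|T\|_e=\inf\{\|T-K\|: K \text{ compact on }\mathcal{H}\}$. For $\zeta\in\partial B_N$, $\varphi(\zeta):=\lim_{r\to1^-}\varphi(r\zeta)$ denotes the radial limit when it exists (the condition $\psi(\zeta)=\varphi(\zeta)$ means that the radial limit of $\psi$ at $\zeta$ exists and equals that of $\varphi$), and $$d_\varphi(\zeta)=\liminf_{z\to\zeta}\frac{1-|\varphi(z)|}{1-|z|}\in(0,\infty],$$ where $z$ tends to $\zeta$ unrestrictedly in $B_N$. Finite angular derivative: a function $f:B_N\to\mathbb{C}$ has restricted limit $L$ at $\zeta\in\partial B_N$ if $\lim_{t\to1}f(\Gamma(t))=L$ for every curve $\Gamma:[0,1)\to B_N$ with $\Gamma(t)\to\zeta$ such that, writing $\gamma(t)=\langle\Gamma(t),\zeta\rangle\zeta$, one has $\lim_{t\to1}\frac{|\Gamma(t)-\gamma(t)|^2}{1-|\gamma(t)|^2}=0$ and $\frac{|\gamma(t)-\zeta|}{1-|\gamma(t)|}\le M<\infty$ for all $0\le t<1$ and some $M$. The map $\varphi$ has finite angular derivative at $\zeta$ if there is $\eta\in\partial B_N$ such that $\frac{\langle\eta-\varphi(z),\eta\rangle}{\langle\zeta-z,\zeta\rangle}$ has a (finite) restricted limit at $\zeta$. By the Julia–Carathéodory theorem in $B_N$ this is equivalent to $d_\varphi(\zeta)<\infty$, and in that case $\varphi$ has restricted limit (in particular radial limit) $\eta$ at $\zeta$. *)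

theory Defs
  imports "HOL-Analysis.Analysis"
begin

definition herm :: "complex^'n \<Rightarrow> complex^'n \<Rightarrow> complex"
  where "herm z w = (\<Sum>i\<in>UNIV. z $ i * cnj (w $ i))"

lemma herm_self: "herm z z = of_real ((norm z)\<^sup>2)"
  by (simp add: herm_def complex_norm_square[symmetric] norm_vec_def L2_set_def sum_nonneg)

section \<open>Measures\<close>

definition ball_measure :: "(complex^'n) measure"
  where "ball_measure = uniform_measure lborel (ball 0 1)"

text \<open>Normalized surface measure on the unit sphere, as the cone measure: a Borel set \<open>E\<close> of the
  sphere gets the normalized volume of the cone of all \<open>r \<zeta>\<close> with \<open>0 < r < 1\<close> and
  \<open>\<zeta> \<in> E\<close>. It is a measure on the whole space, concentrated on the sphere.\<close>

definition sphere_measure :: "(complex^'n) measure"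
  where "sphere_measure = distr ball_measure borel (\<lambda>z. z /\<^sub>R norm z)"

lemma emeasure_ball_measure: "emeasure (ball_measure :: (complex^'n) measure) (ball 0 1) = 1"
proof -
  have "emeasure lborel (ball (0::complex^'n) 1) \<noteq> 0"
    using content_ball_pos[of 1 "0::complex^'n"] by (auto simp: measure_def)
  moreover have "emeasure lborel (ball (0::complex^'n) 1) < \<infinity>"
    by (intro emeasure_bounded_finite bounded_ball)
  ultimately show ?thesis
    unfolding ball_measure_def by (intro emeasure_uniform_measure_1) auto
qed

lemma AE_ball_measure: "AE z in (ball_measure :: (complex^'n) measure). z \<in> ball 0 1 \<and> z \<noteq> 0"
proof -
  have "AE z in (lborel :: (complex^'n) measure). z \<noteq> 0"
    by (rule AE_lborel_singleton)
  then show ?thesis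
    unfolding ball_measure_def by (intro AE_uniform_measureI) auto
qed

lemma emeasure_sphere_measure: "emeasure (sphere_measure :: (complex^'n) measure) (sphere 0 1) = 1"
proof -
  have sets: "sets (ball_measure :: (complex^'n) measure) = sets borel"
    by (simp add: ball_measure_def)
  then have meas: "(\<lambda>z::complex^'n. z /\<^sub>R norm z) \<in> ball_measure \<rightarrow>\<^sub>M borel"
    by (simp cong: measurable_cong_sets)
  have "emeasure (sphere_measure :: (complex^'n) measure) (sphere 0 1)
      = emeasure ball_measure ((\<lambda>z::complex^'n. z /\<^sub>R norm z) -` sphere 0 1 \<inter> space ball_measure)"
    unfolding sphere_measure_def by (rule emeasure_distr[OF meas]) simp
  also have "\<dots> = emeasure ball_measure (ball (0::complex^'n) 1)"
  proof (rule emeasure_eq_AE)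
    show "AE z in ball_measure. z \<in> (\<lambda>z::complex^'n. z /\<^sub>R norm z) -` sphere 0 1 \<inter> space ball_measure
        \<longleftrightarrow> z \<in> ball 0 1"
      using AE_ball_measure by eventually_elim (simp add: ball_measure_def)
    show "(\<lambda>z::complex^'n. z /\<^sub>R norm z) -` sphere 0 1 \<inter> space ball_measure \<in> sets ball_measure"
      by (rule measurable_sets[OF meas]) simp
  qed (simp add: sets)
  finally show ?thesis
    by (simp add: emeasure_ball_measure)
qed

section \<open>Holomorphic functions and the two scales of spaces\<close>

definition holomorphic_vec_on :: "(complex^'n \<Rightarrow> complex) \<Rightarrow> (complex^'n) set \<Rightarrow> bool"
  where "holomorphic_vec_on f S \<longleftrightarrow>
    (\<forall>z\<in>S. \<exists>D. (f has_derivative D) (at z within S) \<and> (\<forall>c v. D (c *s v) = c * D v))"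

definition analytic_self_map :: "(complex^'n \<Rightarrow> complex^'n) \<Rightarrow> bool"
  where "analytic_self_map \<phi> \<longleftrightarrow>
    (\<forall>i. holomorphic_vec_on (\<lambda>z. \<phi> z $ i) (ball 0 1)) \<and> \<phi> ` ball 0 1 \<subseteq> ball 0 1"

text \<open>A function on the ball is represented by its extension by \<open>0\<close> to the whole space, so that
  equality of elements of the function spaces is equality of functions on the ball.\<close>

definition holomorphic_ball :: "(complex^'n \<Rightarrow> complex) set"
  where "holomorphic_ball = {f. holomorphic_vec_on f (ball 0 1) \<and> (\<forall>z. z \<notin> ball 0 1 \<longrightarrow> f z = 0)}"

definition hardy_mean :: "(complex^'n \<Rightarrow> complex) \<Rightarrow> real \<Rightarrow> real"
  where "hardy_mean f r = (LINT \<zeta>|sphere_measure. (cmod (f (r *\<^sub>R \<zeta>)))\<^sup>2)"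

definition hardy_space :: "(complex^'n \<Rightarrow> complex) set"
  where "hardy_space = {f \<in> holomorphic_ball. bdd_above (hardy_mean f ` {0<..<1})}"

definition hardy_norm :: "(complex^'n \<Rightarrow> complex) \<Rightarrow> real"
  where "hardy_norm f = sqrt (SUP r\<in>{0<..<1}. hardy_mean f r)"

definition bergman_weight :: "real \<Rightarrow> complex^'n \<Rightarrow> real"
  where "bergman_weight s z =
    Gamma (real CARD('n) + s + 1) / (Gamma (real CARD('n) + 1) * Gamma (s + 1))
      * (1 - (norm z)\<^sup>2) powr s"

definition bergman_space :: "real \<Rightarrow> (complex^'n \<Rightarrow> complex) set"
  where "bergman_space s =
    {f \<in> holomorphic_ball. integrable ball_measure (\<lambda>z. (cmod (f z))\<^sup>2 * bergman_weight s z)}"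

definition bergman_norm :: "real \<Rightarrow> (complex^'n \<Rightarrow> complex) \<Rightarrow> real"
  where "bergman_norm s f = sqrt (LINT z|ball_measure. (cmod (f z))\<^sup>2 * bergman_weight s z)"

section \<open>Operators on a normed space of complex-valued functions\<close>

text \<open>\<open>H\<close> is the underlying set of the function space and \<open>nrm\<close> its norm; only the
  values of an operator on \<open>H\<close> matter.\<close>

definition bounded_op ::
    "('a \<Rightarrow> complex) set \<Rightarrow> (('a \<Rightarrow> complex) \<Rightarrow> real) \<Rightarrow> (('a \<Rightarrow> complex) \<Rightarrow> 'a \<Rightarrow> complex) \<Rightarrow> bool"
  where "bounded_op H nrm T \<longleftrightarrow>
    (\<forall>f\<in>H. T f \<in> H) \<and>
    (\<forall>f\<in>H. \<forall>g\<in>H. T (\<lambda>z. f z + g z) = (\<lambda>z. T f z + T g z)) \<and>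
    (\<forall>c. \<forall>f\<in>H. T (\<lambda>z. c * f z) = (\<lambda>z. c * T f z)) \<and>
    (\<exists>C. \<forall>f\<in>H. nrm (T f) \<le> C * nrm f)"

definition compact_op ::
    "('a \<Rightarrow> complex) set \<Rightarrow> (('a \<Rightarrow> complex) \<Rightarrow> real) \<Rightarrow> (('a \<Rightarrow> complex) \<Rightarrow> 'a \<Rightarrow> complex) \<Rightarrow> bool"
  where "compact_op H nrm K \<longleftrightarrow>
    bounded_op H nrm K \<and>
    (\<forall>f :: nat \<Rightarrow> 'a \<Rightarrow> complex. (\<forall>n. f n \<in> H) \<and> (\<exists>C. \<forall>n. nrm (f n) \<le> C) \<longrightarrow>
      (\<exists>g\<in>H. \<exists>k. strict_mono (k :: nat \<Rightarrow> nat) \<and>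
        (\<lambda>n. nrm (\<lambda>z. K (f (k n)) z - g z)) \<longlonglongrightarrow> 0))"

definition op_norm ::
    "('a \<Rightarrow> complex) set \<Rightarrow> (('a \<Rightarrow> complex) \<Rightarrow> real) \<Rightarrow> (('a \<Rightarrow> complex) \<Rightarrow> 'a \<Rightarrow> complex) \<Rightarrow> real"
  where "op_norm H nrm T = (SUP f\<in>{f\<in>H. nrm f \<le> 1}. nrm (T f))"

definition op_diff ::
    "(('a \<Rightarrow> complex) \<Rightarrow> 'a \<Rightarrow> complex) \<Rightarrow> (('a \<Rightarrow> complex) \<Rightarrow> 'a \<Rightarrow> complex)
      \<Rightarrow> ('a \<Rightarrow> complex) \<Rightarrow> 'a \<Rightarrow> complex"
  where "op_diff S T = (\<lambda>f z. S f z - T f z)"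

definition ess_norm ::
    "('a \<Rightarrow> complex) set \<Rightarrow> (('a \<Rightarrow> complex) \<Rightarrow> real) \<Rightarrow> (('a \<Rightarrow> complex) \<Rightarrow> 'a \<Rightarrow> complex) \<Rightarrow> real"
  where "ess_norm H nrm T = (INF K\<in>{K. compact_op H nrm K}. op_norm H nrm (op_diff T K))"

definition comp_op :: "(complex^'n \<Rightarrow> complex^'n) \<Rightarrow> (complex^'n \<Rightarrow> complex) \<Rightarrow> complex^'n \<Rightarrow> complex"
  where "comp_op \<phi> f = (\<lambda>z. if z \<in> ball 0 1 then f (\<phi> z) else 0)"

section \<open>Boundary behaviour\<close>

definition has_radial_limit :: "(complex^'n \<Rightarrow> complex^'n) \<Rightarrow> complex^'n \<Rightarrow> complex^'n \<Rightarrow> bool"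
  where "has_radial_limit \<phi> \<zeta> w \<longleftrightarrow> ((\<lambda>r. \<phi> (r *\<^sub>R \<zeta>)) \<longlongrightarrow> w) (at_left 1)"

definition dilation_coeff :: "(complex^'n \<Rightarrow> complex^'n) \<Rightarrow> complex^'n \<Rightarrow> ereal"
  where "dilation_coeff \<phi> \<zeta> =
    Liminf (at \<zeta> within ball 0 1) (\<lambda>z. ereal ((1 - norm (\<phi> z)) / (1 - norm z)))"

definition restricted_curve :: "complex^'n \<Rightarrow> (real \<Rightarrow> complex^'n) \<Rightarrow> bool"
  where "restricted_curve \<zeta> \<Gamma> \<longleftrightarrow>
    continuous_on {0..<1} \<Gamma> \<and> \<Gamma> ` {0..<1} \<subseteq> ball 0 1 \<and> (\<Gamma> \<longlongrightarrow> \<zeta>) (at_left 1) \<and>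
    (let \<gamma> = (\<lambda>t. herm (\<Gamma> t) \<zeta> *s \<zeta>) in
      ((\<lambda>t. (norm (\<Gamma> t - \<gamma> t))\<^sup>2 / (1 - (norm (\<gamma> t))\<^sup>2)) \<longlongrightarrow> 0) (at_left 1) \<and>
      (\<exists>M. \<forall>t\<in>{0..<1}. norm (\<gamma> t - \<zeta>) / (1 - norm (\<gamma> t)) \<le> M))"

definition has_restricted_limit :: "(complex^'n \<Rightarrow> complex) \<Rightarrow> complex^'n \<Rightarrow> complex \<Rightarrow> bool"
  where "has_restricted_limit f \<zeta> L \<longleftrightarrow>
    (\<forall>\<Gamma>. restricted_curve \<zeta> \<Gamma> \<longrightarrow> ((\<lambda>t. f (\<Gamma> t)) \<longlongrightarrow> L) (at_left 1))"

definition finite_angular_derivative :: "(complex^'n \<Rightarrow> complex^'n) \<Rightarrow> complex^'n \<Rightarrow> bool"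
  where "finite_angular_derivative \<phi> \<zeta> \<longleftrightarrow>
    (\<exists>\<eta>\<in>sphere 0 1. \<exists>L. has_restricted_limit
      (\<lambda>z. herm (\<eta> - \<phi> z) \<eta> / herm (\<zeta> - z) \<zeta>) \<zeta> L)"

end

theory Submission
  imports Defs "HOL-Complex_Analysis.Riemann_Mapping"
begin

text \<open>Both spaces have reproducing kernel \<open>K\<^sub>a(z) = (1 - \<langle>z, a\<rangle>)\<^sup>-\<^sup>\<beta>\<close>. For a compact \<open>K\<close>, apply
  \<open>C\<^sub>\<phi> - C\<^sub>\<psi> - K\<close> to the normalized kernel at \<open>\<phi>(w)\<close> and evaluate at \<open>w\<close>. As \<open>w \<rightarrow> \<zeta>\<close> the compact part
  is negligible, the term of \<open>\<phi>\<close> tends to \<open>d\<^sub>\<phi>(\<zeta>)\<^sup>-\<^sup>\<beta>\<^sup>/\<^sup>2\<close>, and the term of \<open>\<psi>\<close> is governed by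
  \<open>(1 - \<bar>w\<bar>\<^sup>2) / \<bar>1 - \<langle>\<psi>(w), \<phi>(w)\<rangle>\<bar>\<close>. This ratio is made small by a radial approach if
  \<open>d\<^sub>\<psi>(\<zeta>) = \<infinity>\<close> or if the radial limits differ. If they agree but \<open>d\<^sub>\<psi>(\<zeta>) \<noteq> d\<^sub>\<phi>(\<zeta>)\<close>, take
  \<open>w = (1 - t(1 + iM)) \<zeta>\<close> with \<open>M\<close> large: by Julia--Caratheodory,
  \<open>1 - \<langle>\<psi>(w), \<phi>(w)\<rangle> = t ((d\<^sub>\<psi> + d\<^sub>\<phi>) + iM (d\<^sub>\<psi> - d\<^sub>\<phi>)) + o(t)\<close>.

  Only two facts about the spaces are needed, both on complex lines through the origin:
  \<open>\<Sum>\<^sub>k \<bar>F\<^sub>k\<bar>\<^sup>2 k! / (\<beta>)\<^sub>k \<le> \<parallel>f\<parallel>\<^sup>2\<close> for the Taylor coefficients \<open>F\<^sub>k\<close> of a slice of \<open>f\<close>, and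
  \<open>\<parallel>K\<^sub>a\<parallel>\<^sup>2 \<le> (1 - \<bar>a\<bar>\<^sup>2)\<^sup>-\<^sup>\<beta>\<close>. They follow from unitary invariance and from the moments
  \<open>\<integral> \<bar>\<langle>z, u\<rangle>\<bar>\<^sup>2\<^sup>k = k! / (\<beta>)\<^sub>k\<close>.\<close>

section \<open>The Hermitian form and slices of holomorphic functions\<close>

text \<open>The obstacle is the term of \<psi>. When \<phi> and \<psi> share the radial limit and
  both dilations are finite, a radial approach leaves the ratio at 2 / (d_\<psi> + d_\<phi>), which
  need not be small. Tilting the approach by M helps because \<open>herm\<close> is conjugate-linear
  in its second argument: the two imaginary contributions enter with opposite signs, so their
  difference grows with M. Every fixed M still leaves a positive ratio, so no single sequence
  suffices. A tolerance \<open>e\<close> is fixed before the sequence is chosen, the resulting bound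
  is d^(-\<beta>/2) - e^\<beta> d^(\<beta>/2), and \<open>e\<close> tends to 0 only at the very end.

  The compact operator is controlled by norm limits: along a subsequence the images of the test
  functions approach one fixed \<open>g\<close> of the space, and a fixed function grows slower than
  the general point-evaluation bound (1 - |w|^2)^(-\<beta>/2) allows. This explains the two facts on
  slices: the coefficient bound yields point evaluation and its little-o refinement, the kernel
  bound yields test functions of norm at most 1.\<close>

lemma herm_linear:
  "herm (x + y) z = herm x z + herm y z" "herm (x - y) z = herm x z - herm y z"
  "herm z (x + y) = herm z x + herm z y" "herm z (x - y) = herm z x - herm z y"
  "herm (c *s x) z = c * herm x z" "herm z (c *s x) = cnj c * herm z x"
  "herm (a *\<^sub>R x) z = of_real a * herm x z" "herm z (a *\<^sub>R x) = of_real a * herm z x"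
  "herm 0 z = 0" "herm z 0 = 0"
  by (simp_all add: herm_def algebra_simps sum.distrib sum_subtractf sum_distrib_left scaleR_conv_of_real[where 'a=complex])

lemma cnj_herm: "cnj (herm x y) = herm y x"
  by (simp add: herm_def mult.commute)

lemma norm_eq_herm: "(norm x)\<^sup>2 = Re (herm x x)"
  by (simp add: herm_self)

lemma norm_vector_smult: "norm (c *s (x::complex^'n)) = cmod c * norm x"
  by (simp add: norm_vec_def L2_set_def norm_mult power_mult_distrib sum_distrib_left[symmetric] real_sqrt_mult)

lemma smult_of_real: "of_real a *s (x::complex^'n) = a *\<^sub>R x"
  unfolding vec_eq_iff by (simp add: scaleR_conv_of_real[where 'a=complex])

text \<open>Pythagoras along a unit vector. Besides Cauchy-Schwarz it supplies the tangential parts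
  at the boundary and the geometry of complex lines in the ball.\<close>

lemma norm_herm_decomp:
  assumes "norm u = 1"
  shows "herm (z - herm z u *s u) u = 0"
    and "(norm z)\<^sup>2 = (cmod (herm z u))\<^sup>2 + (norm (z - herm z u *s u))\<^sup>2"
proof -
  show *: "herm (z - herm z u *s u) u = 0"
    using assms by (simp add: herm_linear herm_self)
  define q where "q = z - herm z u *s u"
  have q: "herm q u = 0" "herm u q = 0"
    using * arg_cong[OF *, of cnj] unfolding cnj_herm by (simp_all add: q_def)
  have z: "z = herm z u *s u + q" by (simp add: q_def)
  have "herm z z = herm (herm z u *s u + q) (herm z u *s u + q)"
    by (rule arg_cong2[OF z z])
  also have "\<dots> = herm (herm z u *s u) (herm z u *s u) + herm q q"
    unfolding herm_linear(1,3) herm_linear(5)[of _ _ q] herm_linear(6)[of q] q by simp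
  finally have "(norm z)\<^sup>2 = (norm (herm z u *s u))\<^sup>2 + (norm q)\<^sup>2"
    by (simp add: norm_eq_herm)
  then show "(norm z)\<^sup>2 = (cmod (herm z u))\<^sup>2 + (norm (z - herm z u *s u))\<^sup>2"
    by (simp add: norm_vector_smult assms q_def)
qed

lemma herm_cauchy_schwarz: "cmod (herm x y) \<le> norm x * norm y"
proof (cases "y = 0")
  case False
  define u where "u = (1 / norm y) *\<^sub>R y"
  have u: "norm u = 1" using False by (simp add: u_def)
  have "(cmod (herm x u))\<^sup>2 \<le> (norm x)\<^sup>2" using norm_herm_decomp(2)[OF u, of x] by simp
  then have "cmod (herm x u) \<le> norm x" by (rule power2_le_imp_le) simp
  then show ?thesis using False by (simp add: u_def herm_linear norm_mult norm_divide field_simps)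
qed (simp add: herm_linear)

lemma tendsto_herm [tendsto_intros]:
  assumes "(f \<longlongrightarrow> a) F" "(g \<longlongrightarrow> b) F"
  shows "((\<lambda>x. herm (f x) (g x)) \<longlongrightarrow> herm a b) F"
  unfolding herm_def by (intro tendsto_intros assms)

lemma continuous_on_herm [continuous_intros]:
  assumes "continuous_on S f" "continuous_on S g"
  shows "continuous_on S (\<lambda>x. herm (f x) (g x))"
  unfolding herm_def by (intro continuous_intros assms)

lemma continuous_on_vector_smult [continuous_intros]:
  assumes "continuous_on S f" "continuous_on S g"
  shows "continuous_on S (\<lambda>x. f x *s (g x :: complex^'n))"
  unfolding vector_scalar_mult_def by (intro continuous_intros assms)

text \<open>Complex homogeneity of the real derivative \<open>D\<close> makes the slice complex
  differentiable: on multiples of \<open>v\<close>, \<open>D\<close> is multiplication by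
  \<open>D v\<close>.\<close>

lemma holomorphic_on_slice:
  assumes f: "holomorphic_vec_on f (ball 0 1)" and S: "\<And>x. x \<in> S \<Longrightarrow> c + x *s v \<in> ball 0 1"
  shows "(\<lambda>x. f (c + x *s v)) holomorphic_on S"
  unfolding holomorphic_on_def
proof
  fix x assume x: "x \<in> S"
  obtain D where D: "(f has_derivative D) (at (c + x *s v) within ball 0 1)" and lin: "\<And>a w. D (a *s w) = a * D w"
    using f S[OF x] unfolding holomorphic_vec_on_def by blast
  have D': "(f has_derivative D) (at (c + x *s v))"
    using D S[OF x] by (simp add: at_within_open[OF _ open_ball])
  have "bounded_linear (\<lambda>h. h *s v)"
    by (rule bounded_linear_intro[where K = "norm v"])
       (simp_all add: norm_vector_smult vec_eq_iff algebra_simps)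
  then have "((\<lambda>x. x *s v) has_derivative (\<lambda>h. h *s v)) (at x)"
    by (rule bounded_linear_imp_has_derivative)
  then have "((\<lambda>x. c + x *s v) has_derivative (\<lambda>h. 0 + h *s v)) (at x)"
    by (rule has_derivative_add[OF has_derivative_const])
  then have "((\<lambda>x. f (c + x *s v)) has_derivative (\<lambda>h. D (0 + h *s v))) (at x)"
    using has_derivative_compose[of "\<lambda>x. c + x *s v" _ x UNIV f D] D' by blast
  moreover have "(\<lambda>h. D (0 + h *s v)) = (*) (D v)"
    by (rule ext) (simp add: lin mult.commute)
  ultimately have "((\<lambda>x. f (c + x *s v)) has_field_derivative D v) (at x)"
    by (simp add: has_field_derivative_def)
  then show "(\<lambda>x. f (c + x *s v)) field_differentiable at x within S"
    using field_differentiable_at_within field_differentiable_def by blast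
qed

lemma holomorphic_vec_on_herm:
  assumes "\<And>i. holomorphic_vec_on (\<lambda>z. \<phi> z $ i) S"
  shows "holomorphic_vec_on (\<lambda>z. herm (\<phi> z) \<eta>) S"
  unfolding holomorphic_vec_on_def
proof
  fix z assume z: "z \<in> S"
  have "\<forall>i. \<exists>D. ((\<lambda>z. \<phi> z $ i) has_derivative D) (at z within S) \<and> (\<forall>c v. D (c *s v) = c * D v)"
    using assms z unfolding holomorphic_vec_on_def by blast
  then obtain D where D: "\<And>i. ((\<lambda>z. \<phi> z $ i) has_derivative D i) (at z within S)" "\<And>i c v. D i (c *s v) = c * D i v"
    by metis
  show "\<exists>D. ((\<lambda>z. herm (\<phi> z) \<eta>) has_derivative D) (at z within S) \<and> (\<forall>c v. D (c *s v) = c * D v)"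
  proof (intro exI conjI)
    show "((\<lambda>z. herm (\<phi> z) \<eta>) has_derivative (\<lambda>h. \<Sum>i\<in>UNIV. D i h * cnj (\<eta> $ i))) (at z within S)"
      unfolding herm_def by (intro has_derivative_sum has_derivative_mult_left D(1))
    show "\<forall>c v. (\<Sum>i\<in>UNIV. D i (c *s v) * cnj (\<eta> $ i)) = c * (\<Sum>i\<in>UNIV. D i v * cnj (\<eta> $ i))"
      by (simp add: D(2) sum_distrib_left mult.assoc)
  qed
qed

section \<open>Schwarz--Pick and Julia--Caratheodory inequalities\<close>

text \<open>The Schwarz lemma transported by the disc automorphism that carries 0 to
  \<open>w\<close>. The denominator of the pseudohyperbolic distance is cleared so that the estimate
  can be squared below.\<close>

lemma schwarz_lemma_at:
  assumes hol: "C holomorphic_on ball 0 1" and C1: "\<And>x. cmod x < 1 \<Longrightarrow> cmod (C x) < 1"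
    and C0: "C w = 0" and w: "cmod w < 1" and v: "cmod v < 1"
  shows "cmod (C v) * cmod (1 - cnj w * v) \<le> cmod (v - w)"
proof -
  define m where "m = Moebius_function 0 (- w)"
  have m1: "cmod x < 1 \<Longrightarrow> cmod (m x) < 1" for x
    unfolding m_def by (rule Moebius_function_norm_lt_1) (use w in auto)
  have holm: "m holomorphic_on ball 0 1"
    unfolding m_def by (rule Moebius_function_holomorphic) (use w in auto)
  define x where "x = Moebius_function 0 w v"
  have x1: "cmod x < 1" unfolding x_def by (rule Moebius_function_norm_lt_1[OF w v])
  have mx: "m x = v" unfolding m_def x_def by (rule Moebius_function_compose) (use w v in auto)
  have "cmod ((C \<circ> m) x) \<le> cmod x"
  proof (rule Schwarz_Lemma)
    show "C \<circ> m holomorphic_on ball 0 1"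
      by (rule holomorphic_on_compose_gen[OF holm hol]) (use m1 in auto)
    show "(C \<circ> m) 0 = 0" by (simp add: m_def Moebius_function_of_zero C0)
    show "cmod z < 1 \<Longrightarrow> cmod ((C \<circ> m) z) < 1" for z by (simp add: C1 m1)
  qed (rule x1)
  then have "cmod (C v) \<le> cmod x" by (simp add: mx)
  then have "cmod (C v) \<le> cmod (v - w) / cmod (1 - cnj w * v)"
    by (simp add: x_def Moebius_function_simple norm_divide)
  moreover have "cmod (1 - cnj w * v) > 0"
  proof -
    have "cmod (cnj w * v) < 1" using norm_mult_less[of "cnj w" 1 v 1] w v by simp
    then show ?thesis by auto
  qed
  ultimately show ?thesis by (simp add: field_simps)
qed

text \<open>Converts inequalities between pseudohyperbolic distances into inequalities between the
  defects 1 - |v|^2, the quantities that have limits of quotients at the boundary.\<close>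

lemma cmod_1_minus_cnj_mult:
  "(cmod (1 - cnj w * v))\<^sup>2 = (cmod (v - w))\<^sup>2 + (1 - (cmod v)\<^sup>2) * (1 - (cmod w)\<^sup>2)"
  unfolding cmod_power2 by (simp add: algebra_simps power2_eq_square)

text \<open>Post-composition with the automorphism vanishing at \<open>f w\<close> reduces to
  \<open>schwarz_lemma_at\<close>. The product form has no denominators, so one of the points may
  later be sent to the boundary.\<close>

lemma schwarz_pick_disc:
  assumes hol: "f holomorphic_on ball 0 1" and f1: "\<And>x. cmod x < 1 \<Longrightarrow> cmod (f x) < 1"
    and w: "cmod w < 1" and v: "cmod v < 1"
  shows "(cmod (1 - cnj (f w) * f v))\<^sup>2 * ((1 - (cmod v)\<^sup>2) * (1 - (cmod w)\<^sup>2))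
    \<le> (cmod (1 - cnj w * v))\<^sup>2 * ((1 - (cmod (f v))\<^sup>2) * (1 - (cmod (f w))\<^sup>2))"
proof -
  define C where "C = (\<lambda>x. Moebius_function 0 (f w) (f x))"
  have "C = Moebius_function 0 (f w) \<circ> f" by (auto simp: C_def)
  then have "C holomorphic_on ball 0 1"
    using holomorphic_on_compose_gen[OF hol Moebius_function_holomorphic[OF f1[OF w], of 0]] f1
    by (simp add: image_subset_iff)
  moreover have "C w = 0" by (simp add: C_def Moebius_function_eq_zero)
  moreover have "cmod x < 1 \<Longrightarrow> cmod (C x) < 1" for x
    unfolding C_def by (intro Moebius_function_norm_lt_1 f1 w)
  ultimately have le: "cmod (C v) * cmod (1 - cnj w * v) \<le> cmod (v - w)"
    using schwarz_lemma_at w v by blast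
  have pos: "cmod (1 - cnj (f w) * f v) > 0"
  proof -
    have "cmod (cnj (f w) * f v) < 1" using norm_mult_less[of "cnj (f w)" 1 "f v" 1] f1 w v by simp
    then show ?thesis by auto
  qed
  have "cmod (f v - f w) * cmod (1 - cnj w * v) \<le> cmod (v - w) * cmod (1 - cnj (f w) * f v)"
    using le pos by (simp add: C_def Moebius_function_simple norm_divide field_simps)
  then have "(cmod (f v - f w) * cmod (1 - cnj w * v))\<^sup>2 \<le> (cmod (v - w) * cmod (1 - cnj (f w) * f v))\<^sup>2"
    by (intro power_mono) auto
  then show ?thesis
    unfolding power_mult_distrib cmod_1_minus_cnj_mult by (simp add: algebra_simps)
qed

text \<open>The same argument with the Cayley map of the right half-plane centred at
  \<open>k w\<close> in place of the disc automorphism.\<close>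

lemma schwarz_pick_half_plane:
  assumes hol: "k holomorphic_on ball 0 1" and k1: "\<And>x. cmod x < 1 \<Longrightarrow> Re (k x) > 0"
    and w: "cmod w < 1" and v: "cmod v < 1"
  shows "(cmod (k v - k w))\<^sup>2 * ((1 - (cmod v)\<^sup>2) * (1 - (cmod w)\<^sup>2))
    \<le> 4 * Re (k v) * Re (k w) * (cmod (v - w))\<^sup>2"
proof -
  have id: "(cmod (k x + cnj (k w)))\<^sup>2 = (cmod (k x - k w))\<^sup>2 + 4 * Re (k x) * Re (k w)" for x
    unfolding cmod_power2 by (simp add: algebra_simps power2_eq_square)
  define C where "C = (\<lambda>x. (k x - k w) / (k x + cnj (k w)))"
  have nz: "k x + cnj (k w) \<noteq> 0" if "cmod x < 1" for x
  proof -
    have "Re (k x + cnj (k w)) > 0" using k1[OF that] k1[OF w] by simp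
    then show ?thesis by (metis less_irrefl zero_complex.sel(1))
  qed
  have "C holomorphic_on ball 0 1"
    unfolding C_def by (intro holomorphic_intros hol) (use nz in auto)
  moreover have "C w = 0" by (simp add: C_def)
  moreover have "cmod (C x) < 1" if x: "cmod x < 1" for x
  proof -
    have "4 * Re (k x) * Re (k w) > 0" using k1 x w by simp
    then have "(cmod (k x - k w))\<^sup>2 < (cmod (k x + cnj (k w)))\<^sup>2" unfolding id by linarith
    then have "cmod (k x - k w) < cmod (k x + cnj (k w))" by (rule power2_less_imp_less) simp
    then show ?thesis by (auto simp: C_def norm_divide divide_less_eq)
  qed
  ultimately have le: "cmod (C v) * cmod (1 - cnj w * v) \<le> cmod (v - w)"
    using schwarz_lemma_at w v by blast
  have "cmod (k v - k w) * cmod (1 - cnj w * v) \<le> cmod (v - w) * cmod (k v + cnj (k w))"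
    using le nz[OF v] by (simp add: C_def norm_divide field_simps)
  then have "(cmod (k v - k w) * cmod (1 - cnj w * v))\<^sup>2 \<le> (cmod (v - w) * cmod (k v + cnj (k w)))\<^sup>2"
    by (intro power_mono) auto
  then show ?thesis
    unfolding power_mult_distrib cmod_1_minus_cnj_mult id by (simp add: algebra_simps)
qed

text \<open>The right-hand side is the Poisson kernel; through it the Julia inequality becomes a
  comparison of real parts of Cayley transforms.\<close>

lemma Re_cayley:
  assumes "p \<noteq> (1::complex)"
  shows "Re ((1 + p) / (1 - p)) = (1 - (cmod p)\<^sup>2) / (cmod (1 - p))\<^sup>2"
proof -
  have "Re ((1 + p) * cnj (1 - p)) = 1 - (cmod p)\<^sup>2"
    unfolding cmod_power2 by (simp add: algebra_simps power2_eq_square)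
  then show ?thesis
    by (subst complex_div_cnj) (simp only: Re_divide_of_real flip: of_real_power)
qed

text \<open>The Julia inequality says that subtracting the half-plane model of the map with dilation \<open>d\<close>
  leaves a function of nonnegative real part; the half-plane Schwarz--Pick inequality against a
  point on the radius where its real part is relatively small shows that it is negligible.\<close>

lemma julia_caratheodory_disc:
  assumes hol: "p holomorphic_on ball 0 1" and p1: "\<And>x. cmod x < 1 \<Longrightarrow> cmod (p x) < 1"
    and d: "d > 0"
    and julia: "\<And>x. cmod x < 1 \<Longrightarrow>
      (cmod (1 - p x))\<^sup>2 * (1 - (cmod x)\<^sup>2) \<le> d * (cmod (1 - x))\<^sup>2 * (1 - (cmod (p x))\<^sup>2)"
    and radial: "\<And>e. e > 0 \<Longrightarrow> \<forall>\<^sub>F r in at_left 1. (d - e) * (1 - r) \<le> 1 - cmod (p (of_real r))"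
    and l1: "\<And>n. cmod (l n) < 1" and lim: "l \<longlonglongrightarrow> 1"
    and nt: "\<And>n. cmod (1 - l n) \<le> M * (1 - (cmod (l n))\<^sup>2)"
  shows "(\<lambda>n. (1 - p (l n)) / (1 - l n)) \<longlonglongrightarrow> of_real d"
proof -
  define G where "G = (\<lambda>x. (1 + p x) / (1 - p x))"
  \<comment> \<open>The Julia inequality gives nonnegative real part without the summand 1. The 1
    makes it strictly positive, as the half-plane estimate demands; it also turns \<open>G x\<close>
    into \<open>G x + 1 = 2 / (1 - p x)\<close>, from which \<open>p\<close> is recovered at the
    end.\<close>
  define k where "k = (\<lambda>x. G x - (1 + x) / (1 - x) / of_real d + 1)"
  have ne1: "x \<noteq> 1" "p x \<noteq> 1" if "cmod x < 1" for x
    using that p1[OF that] by auto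
  have holk: "k holomorphic_on ball 0 1"
    unfolding k_def G_def using ne1 d by (intro holomorphic_intros hol) auto
  have Rek: "Re (k x) = (1 - (cmod (p x))\<^sup>2) / (cmod (1 - p x))\<^sup>2 - (1 - (cmod x)\<^sup>2) / (cmod (1 - x))\<^sup>2 / d + 1"
    if "cmod x < 1" for x
    using Re_cayley[OF ne1(1)[OF that]] Re_cayley[OF ne1(2)[OF that]]
    by (simp add: k_def G_def Re_divide_of_real del: divide_divide_eq_left)
  have k1: "Re (k x) > 0" if x: "cmod x < 1" for x
  proof -
    have "(cmod (1 - p x))\<^sup>2 > 0" "(cmod (1 - x))\<^sup>2 > 0" using ne1[OF x] by auto
    then have "(1 - (cmod x)\<^sup>2) / (cmod (1 - x))\<^sup>2 / d \<le> (1 - (cmod (p x))\<^sup>2) / (cmod (1 - p x))\<^sup>2"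
      using julia[OF x] d by (simp add: field_simps)
    then show ?thesis using Rek[OF x] by linarith
  qed
  have small: "\<exists>r. 0 < r \<and> r < 1 \<and> (1 - r) * Re (k (of_real r)) \<le> e" if e: "e > 0" for e
  proof -
    \<comment> \<open>Chosen so that 2 / d' exceeds 2 / d by exactly e / 2. The radial hypothesis
      for d' < d then bounds the real part at \<open>r\<close>, and the other e / 2 is spent on the
      terms of order 1 - r.\<close>
    define d' where "d' = 2 / (2 / d + e / 2)"
    have "d * e + 4 > 0" using d e by (simp add: add_pos_pos)
    then have d': "0 < d'" "d' < d" using d e by (auto simp: d'_def divide_simps) (auto simp: algebra_simps)
    have d'2: "2 / d' = 2 / d + e / 2" using d e by (simp add: d'_def)
    have "\<forall>\<^sub>F r in at_left 1. d' * (1 - r) \<le> 1 - cmod (p (of_real r))"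
      using radial[of "d - d'"] d' by simp
    moreover have "\<forall>\<^sub>F r in at_left 1. (1 - r) * (1 / d + 1) < e / 2"
      by (rule order_tendstoD) (auto intro!: tendsto_eq_intros simp: e)
    moreover have "\<forall>\<^sub>F r in at_left (1::real). 0 < r \<and> r < 1"
      by (auto simp: eventually_at_left[of 0] intro: exI[of _ 0])
    ultimately have "\<forall>\<^sub>F r in at_left (1::real). d' * (1 - r) \<le> 1 - cmod (p (of_real r)) \<and>
        (1 - r) * (1 / d + 1) < e / 2 \<and> 0 < r \<and> r < 1"
      by eventually_elim simp
    then obtain r where r: "d' * (1 - r) \<le> 1 - cmod (p (of_real r))" "(1 - r) * (1 / d + 1) < e / 2"
        "0 < r" "r < 1"
      using eventually_happens' trivial_limit_at_left_real by (metis (no_types, lifting))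
    let ?q = "cmod (p (of_real r))"
    have q1: "?q < 1" using p1[of "of_real r"] r by simp
    have "1 - ?q \<le> cmod (1 - p (of_real r))" using norm_triangle_ineq2[of 1 "p (of_real r)"] by simp
    then have "(1 - ?q)\<^sup>2 \<le> (cmod (1 - p (of_real r)))\<^sup>2" using q1 by (intro power_mono) auto
    then have "(1 - ?q\<^sup>2) / (cmod (1 - p (of_real r)))\<^sup>2 \<le> (1 - ?q\<^sup>2) / (1 - ?q)\<^sup>2"
      using q1 ne1(2)[of "of_real r"] r
      by (intro divide_left_mono mult_pos_pos zero_less_power) (auto simp: abs_square_le_1)
    also have "\<dots> = (1 + ?q) / (1 - ?q)"
      using q1 by (simp add: divide_simps power2_eq_square) algebra
    also have "\<dots> \<le> 2 / (d' * (1 - r))"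
      using r q1 d' by (intro frac_le) auto
    finally have 1: "(1 - ?q\<^sup>2) / (cmod (1 - p (of_real r)))\<^sup>2 \<le> 2 / (d' * (1 - r))" .
    have "cmod (1 - of_real r) = 1 - r"
      by (metis abs_of_pos diff_gt_0_iff_gt norm_of_real of_real_1 of_real_diff r(4))
    then have 2: "(1 - (cmod (of_real r))\<^sup>2) / (cmod (1 - of_real r))\<^sup>2 = (1 + r) / (1 - r)"
      using r by (simp add: divide_simps power2_eq_square) (simp add: algebra_simps)
    have "Re (k (of_real r)) \<le> 2 / (d' * (1 - r)) - (1 + r) / (1 - r) / d + 1"
    proof -
      have "cmod (of_real r) < 1" using r by simp
      from Rek[OF this] 1 show ?thesis unfolding 2 by linarith
    qed
    then have "(1 - r) * Re (k (of_real r)) \<le> (1 - r) * (2 / (d' * (1 - r)) - (1 + r) / (1 - r) / d + 1)"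
      using r by (intro mult_left_mono) auto
    also have "\<dots> = 2 / d' - (1 + r) / d + (1 - r)"
    proof -
      have "c * (2 / (d' * c) - b / c / d + 1) = 2 / d' - b / d + c" if "c \<noteq> 0" for b c :: real
        using that d d' by (simp add: field_simps)
      then show ?thesis using r by simp
    qed
    also have "\<dots> = e / 2 + (1 - r) * (1 / d + 1)"
      unfolding d'2 using d by (simp add: field_simps)
    also have "\<dots> \<le> e" using r(2) by linarith
    finally show ?thesis using r by blast
  qed
  have M: "M \<ge> 0"
  proof -
    have "0 \<le> M * (1 - (cmod (l 0))\<^sup>2)" using nt[of 0] norm_ge_zero order_trans by blast
    moreover have "1 - (cmod (l 0))\<^sup>2 > 0" using l1[of 0] by (simp add: abs_square_less_1)
    ultimately show ?thesis by (simp add: zero_le_mult_iff)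
  qed
  have X0: "(\<lambda>n. (1 - l n) * k (l n)) \<longlonglongrightarrow> 0"
  proof (rule tendstoI)
    fix E :: real assume E: "E > 0"
    \<comment> \<open>This makes both \<open>e\<close> and \<open>64 * e * M\<close> smaller than E.
      The 64 is 4 * 16: 16 comes from 4 |l - r|^2 with |l - r| < 2 (1 - r), and 4 from squaring X /
      2.\<close>
    define e where "e = E / (2 * (64 * M + 1))"
    have e: "e > 0" using E M by (simp add: e_def)
    have eE: "e < E" "64 * e * M < E" using E M by (auto simp: e_def divide_simps)
    obtain r where r: "0 < r" "r < 1" "(1 - r) * Re (k (of_real r)) \<le> e" using small[OF e] by auto
    have ev1: "\<forall>\<^sub>F n in sequentially. 2 * (cmod (1 - l n) * cmod (k (of_real r))) < e"
      by (rule order_tendstoD) (auto intro!: tendsto_eq_intros lim simp: e)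
    have "(\<lambda>n. cmod (l n - of_real r)) \<longlonglongrightarrow> cmod (1 - of_real r)"
      by (intro tendsto_intros lim)
    moreover have c1r: "cmod (1 - of_real r) = 1 - r"
      by (metis abs_of_pos diff_gt_0_iff_gt norm_of_real of_real_1 of_real_diff r(2))
    ultimately have ev2: "\<forall>\<^sub>F n in sequentially. cmod (l n - of_real r) < 2 * (1 - r)"
      using r by (intro order_tendstoD(2)[of _ "1 - r"]) auto
    show "\<forall>\<^sub>F n in sequentially. dist ((1 - l n) * k (l n)) 0 < E"
      using ev1 ev2
    proof eventually_elim
      fix n assume n1: "2 * (cmod (1 - l n) * cmod (k (of_real r))) < e"
        and n2: "cmod (l n - of_real r) < 2 * (1 - r)"
      let ?D = "cmod (1 - l n)" and ?s = "1 - (cmod (l n))\<^sup>2"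
      let ?K = "cmod (k (l n) - k (of_real r))"
      define X where "X = ?D * cmod (k (l n))"
      have X: "X \<ge> 0" by (simp add: X_def)
      have s: "?s > 0" using l1[of n] by (simp add: abs_square_less_1)
      have "X < E"
      \<comment> \<open>Either X is controlled by the value at the fixed point \<open>r\<close>,
        which is negligible as 1 - l tends to 0, or the difference \<open>?K\<close> carries at
        least half of X. In the second case Schwarz-Pick bounds X^2 by a small multiple of
        X.\<close>
      proof (cases "X \<le> 2 * (?D * cmod (k (of_real r)))")
        case True
        then show ?thesis using n1 eE by linarith
      next
        case False
        have "?K\<^sup>2 * (?s * (1 - r\<^sup>2)) \<le> 4 * Re (k (l n)) * Re (k (of_real r)) * (cmod (l n - of_real r))\<^sup>2"
          using schwarz_pick_half_plane[OF holk k1, of "of_real r" "l n"] l1[of n] r by simp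
        also have "\<dots> \<le> 4 * cmod (k (l n)) * Re (k (of_real r)) * (2 * (1 - r))\<^sup>2"
          using k1[of "of_real r"] r n2 k1[OF l1[of n]]
          by (intro mult_mono power_mono complex_Re_le_cmod) auto
        also have "\<dots> = 16 * cmod (k (l n)) * ((1 - r) * Re (k (of_real r))) * (1 - r)"
          by (simp add: power2_eq_square algebra_simps)
        also have "\<dots> \<le> 16 * cmod (k (l n)) * e * (1 - r)"
          using r by (intro mult_right_mono mult_left_mono) auto
        finally have a: "?K\<^sup>2 * (?s * (1 - r\<^sup>2)) \<le> 16 * cmod (k (l n)) * e * (1 - r)" .
        have "1 - r \<le> 1 - r\<^sup>2" using r by (simp add: power2_eq_square mult_le_cancel_left1)
        then have "?K\<^sup>2 * (?s * (1 - r)) \<le> ?K\<^sup>2 * (?s * (1 - r\<^sup>2))"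
          using s by (intro mult_left_mono) auto
        then have "(?K\<^sup>2 * ?s) * (1 - r) \<le> (16 * cmod (k (l n)) * e) * (1 - r)"
          using a by (simp add: mult_ac)
        then have "?K\<^sup>2 * ?s \<le> 16 * cmod (k (l n)) * e" using r by simp
        then have "?D\<^sup>2 * (?K\<^sup>2 * ?s) \<le> ?D\<^sup>2 * (16 * cmod (k (l n)) * e)" by (intro mult_left_mono) auto
        also have "\<dots> = 16 * X * e * ?D" by (simp add: X_def power2_eq_square)
        also have "\<dots> \<le> 16 * X * e * (M * ?s)" using nt[of n] X e by (intro mult_left_mono) auto
        finally have "((?D * ?K)\<^sup>2) * ?s \<le> (16 * X * e * M) * ?s" by (simp add: power_mult_distrib mult_ac)
        then have b: "(?D * ?K)\<^sup>2 \<le> 16 * X * e * M" using s by simp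
        have "cmod (k (l n)) - cmod (k (of_real r)) \<le> ?K" by (rule norm_triangle_ineq2)
        then have "?D * (cmod (k (l n)) - cmod (k (of_real r))) \<le> ?D * ?K" by (intro mult_left_mono) auto
        then have "X / 2 \<le> ?D * ?K" using False by (simp add: X_def algebra_simps)
        then have "(X / 2)\<^sup>2 \<le> (?D * ?K)\<^sup>2" using X by (intro power_mono) auto
        then have "X * X \<le> X * (64 * e * M)" using b by (simp add: power2_eq_square)
        moreover have "X > 0" using False X by (smt (verit) mult_nonneg_nonneg norm_ge_zero)
        ultimately have "X \<le> 64 * e * M" by simp
        then show ?thesis using eE by linarith
      qed
      then show "dist ((1 - l n) * k (l n)) 0 < E" by (simp add: X_def norm_mult)
    qed
  qed
  \<comment> \<open>The denominator is (1 - l)(G(l) + 1) = 2 (1 - l) / (1 - p(l)), so the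
    negligibility of (1 - l) k(l) determines the limit of the difference quotient.\<close>
  have "(\<lambda>n. 2 / ((1 - l n) * k (l n) + (1 + l n) / of_real d)) \<longlonglongrightarrow> 2 / (0 + (1 + 1) / of_real d)"
    using d by (intro tendsto_intros X0 lim) auto
  moreover have "2 / ((1 - l n) * k (l n) + (1 + l n) / of_real d) = (1 - p (l n)) / (1 - l n)" for n
  proof -
    have "(1 - l n) * k (l n) + (1 + l n) / of_real d = (1 - l n) * (G (l n) + 1)"
      using ne1[OF l1[of n]] d by (simp add: k_def field_simps)
    also have "G (l n) + 1 = 2 / (1 - p (l n))"
      using ne1[OF l1[of n]] by (simp add: G_def field_simps)
    finally have "(1 - l n) * k (l n) + (1 + l n) / of_real d = (1 - l n) * (2 / (1 - p (l n)))" .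
    moreover have "2 / (a * (2 / b)) = b / a" for a b :: complex by (simp add: field_simps)
    ultimately show ?thesis by presburger
  qed
  ultimately show ?thesis by simp
qed

lemma norm_sgn_le_1: "norm (sgn (x::'a::real_normed_vector)) \<le> 1"
  by (simp add: norm_sgn)

text \<open>Restricting to the complex line through the two points, which meets the ball in a disc,
  reduces the inequality to the one for the disc.\<close>

lemma schwarz_pick_ball:
  fixes f :: "complex^'n \<Rightarrow> complex"
  assumes hol: "holomorphic_vec_on f (ball 0 1)" and f1: "\<And>z. norm z < 1 \<Longrightarrow> cmod (f z) < 1"
    and z: "norm z < 1" and w: "norm w < 1"
  shows "(cmod (1 - cnj (f w) * f z))\<^sup>2 * ((1 - (norm z)\<^sup>2) * (1 - (norm w)\<^sup>2))
    \<le> (cmod (1 - herm z w))\<^sup>2 * ((1 - (cmod (f z))\<^sup>2) * (1 - (cmod (f w))\<^sup>2))"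
proof -
  obtain u :: "complex^'n" where u: "norm u = 1" and zw: "z - w = herm (z - w) u *s u"
  proof (cases "z = w")
    case True
    obtain u :: "complex^'n" where "norm u = 1" using vector_choose_size[of 1] by auto
    then show ?thesis using that[of u] True by (simp add: herm_linear)
  next
    case False
    define u where "u = (1 / norm (z - w)) *\<^sub>R (z - w)"
    have "norm u = 1" using False by (simp add: u_def)
    moreover have "herm (z - w) u = of_real (norm (z - w))"
      using False by (simp add: u_def herm_linear(8) herm_self power2_eq_square)
    then have "herm (z - w) u *s u = z - w"
      using False by (simp add: smult_of_real u_def)
    ultimately show ?thesis using that[of u] by simp
  qed
  \<comment> \<open>The point of the line nearest to the origin, hence common to \<open>z\<close>
    and \<open>w\<close>. The line meets the ball in the disc with centre \<open>c\<close> and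
    radius \<rho> below; \<open>a\<close> and \<open>b\<close> are the coordinates of
    \<open>z\<close> and \<open>w\<close> in that disc.\<close>
  define c where "c = z - herm z u *s u"
  have cw: "c = w - herm w u *s u"
    using zw by (simp add: c_def herm_linear vec_eq_iff algebra_simps)
  have cu: "herm c u = 0" "herm u c = 0"
    using norm_herm_decomp(1)[OF u, of z] cnj_herm[of c u] by (simp_all add: c_def)
  have nz: "(norm z)\<^sup>2 = (cmod (herm z u))\<^sup>2 + (norm c)\<^sup>2"
    unfolding c_def by (rule norm_herm_decomp(2)[OF u])
  have nw: "(norm w)\<^sup>2 = (cmod (herm w u))\<^sup>2 + (norm c)\<^sup>2"
    unfolding cw by (rule norm_herm_decomp(2)[OF u])
  define \<rho> where "\<rho> = sqrt (1 - (norm c)\<^sup>2)"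
  have "(norm z)\<^sup>2 < 1" using z by (simp add: abs_square_less_1)
  then have "(norm c)\<^sup>2 < 1" using nz by (smt (verit) zero_le_power2)
  then have \<rho>: "\<rho> > 0" "\<rho>\<^sup>2 = 1 - (norm c)\<^sup>2" by (auto simp: \<rho>_def)
  define a where "a = herm z u / of_real \<rho>"
  define b where "b = herm w u / of_real \<rho>"
  have na: "1 - (norm z)\<^sup>2 = \<rho>\<^sup>2 * (1 - (cmod a)\<^sup>2)"
    using \<rho>(1) unfolding nz a_def by (simp add: norm_divide power_divide right_diff_distrib \<rho>(2)[symmetric])
  have nb: "1 - (norm w)\<^sup>2 = \<rho>\<^sup>2 * (1 - (cmod b)\<^sup>2)"
    using \<rho>(1) unfolding nw b_def by (simp add: norm_divide power_divide right_diff_distrib \<rho>(2)[symmetric])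
  have "1 - (norm z)\<^sup>2 > 0" "1 - (norm w)\<^sup>2 > 0" using z w by (auto simp: abs_square_less_1)
  then have ab: "cmod a < 1" "cmod b < 1"
    unfolding na nb using \<rho>(1) by (auto simp: zero_less_mult_iff abs_square_less_1)
  have zd: "z = herm z u *s u + c" and wd: "w = herm w u *s u + c"
    by (simp add: c_def, simp add: cw)
  have "herm z w = herm (herm z u *s u + c) (herm w u *s u + c)"
    by (rule arg_cong2[OF zd wd])
  also have "\<dots> = herm z u * cnj (herm w u) + of_real ((norm c)\<^sup>2)"
    using u by (simp add: herm_linear(1,3,5,6) herm_self cu)
  finally have hz: "herm z w = herm z u * cnj (herm w u) + of_real ((norm c)\<^sup>2)" .
  have "1 - herm z w = of_real (\<rho>\<^sup>2) * (1 - cnj b * a)"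
  proof -
    have "herm z u * cnj (herm w u) = of_real (\<rho>\<^sup>2) * (cnj b * a)"
      using \<rho>(1) by (simp add: a_def b_def power2_eq_square)
    moreover have "of_real ((norm c)\<^sup>2) = (1 - of_real (\<rho>\<^sup>2) :: complex)"
      unfolding \<rho>(2) by simp
    ultimately show ?thesis
      using hz by (simp add: algebra_simps)
  qed
  then have hzw: "cmod (1 - herm z w) = \<rho>\<^sup>2 * cmod (1 - cnj b * a)" by (simp add: norm_mult norm_power)
  define F where "F = (\<lambda>x. f (c + x *s (of_real \<rho> *s u)))"
  have inb: "norm (c + x *s (of_real \<rho> *s u)) < 1" if x: "cmod x < 1" for x
  proof -
    let ?y = "c + x *s (of_real \<rho> *s u)"
    have h: "herm ?y u = x * of_real \<rho>" using u by (simp add: herm_linear cu herm_self)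
    have "(norm ?y)\<^sup>2 = (cmod (x * of_real \<rho>))\<^sup>2 + (norm c)\<^sup>2"
      using norm_herm_decomp(2)[OF u, of ?y] unfolding h by (simp add: vector_smult_assoc)
    also have "\<dots> = \<rho>\<^sup>2 * (cmod x)\<^sup>2 + (1 - \<rho>\<^sup>2)" using \<rho>(2) by (simp add: norm_mult power_mult_distrib)
    also have "\<dots> < 1"
      using x \<rho>(1) by (simp add: abs_square_less_1)
    finally show ?thesis by (simp add: abs_square_less_1)
  qed
  have holF: "F holomorphic_on ball 0 1"
    unfolding F_def by (rule holomorphic_on_slice[OF hol]) (use inb in auto)
  have F1: "cmod x < 1 \<Longrightarrow> cmod (F x) < 1" for x using f1 inb by (simp add: F_def)
  have Fa: "F a = f z" and Fb: "F b = f w"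
    using \<rho>(1) by (simp_all add: F_def a_def b_def vector_smult_assoc)
      (simp add: c_def, simp add: cw)
  have "\<rho>^4 * ((cmod (1 - cnj (f w) * f z))\<^sup>2 * ((1 - (cmod a)\<^sup>2) * (1 - (cmod b)\<^sup>2)))
      \<le> \<rho>^4 * ((cmod (1 - cnj b * a))\<^sup>2 * ((1 - (cmod (f z))\<^sup>2) * (1 - (cmod (f w))\<^sup>2)))"
    using schwarz_pick_disc[OF holF F1 ab(2) ab(1)] \<rho>(1) unfolding Fa Fb by (intro mult_left_mono) auto
  then show ?thesis
    unfolding na nb hzw by (simp add: power_mult_distrib mult_ac power2_eq_square power4_eq_xxxx)
qed

lemma dilation_coeff_lower:
  assumes "ereal a < dilation_coeff \<phi> \<zeta>"
  shows "\<exists>\<delta>>0. \<forall>z. norm z < 1 \<and> z \<noteq> \<zeta> \<and> dist z \<zeta> < \<delta> \<longrightarrow> a < (1 - norm (\<phi> z)) / (1 - norm z)"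
proof -
  have "\<forall>\<^sub>F z in at \<zeta> within ball 0 1. ereal a < ereal ((1 - norm (\<phi> z)) / (1 - norm z))"
    using assms unfolding dilation_coeff_def by (rule less_LiminfD)
  then show ?thesis by (auto simp: eventually_at)
qed

lemma dilation_coeff_upper:
  assumes "dilation_coeff \<phi> \<zeta> < ereal a" "\<delta> > 0"
  shows "\<exists>z. norm z < 1 \<and> dist z \<zeta> < \<delta> \<and> (1 - norm (\<phi> z)) / (1 - norm z) < a"
proof (rule ccontr)
  assume "\<not> ?thesis"
  then have "\<forall>\<^sub>F z in at \<zeta> within ball 0 1. ereal a \<le> ereal ((1 - norm (\<phi> z)) / (1 - norm z))"
    using assms(2) by (auto simp: eventually_at intro!: exI[of _ \<delta>] leI)
  then have "ereal a \<le> dilation_coeff \<phi> \<zeta>"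
    unfolding dilation_coeff_def by (rule Liminf_bounded)
  then show False using assms(1) by simp
qed

lemma analytic_self_map_norm: "analytic_self_map \<phi> \<Longrightarrow> norm z < 1 \<Longrightarrow> norm (\<phi> z) < 1"
  unfolding analytic_self_map_def by (force simp: image_subset_iff)

lemma holomorphic_vec_on_self_map:
  "analytic_self_map \<phi> \<Longrightarrow> holomorphic_vec_on (\<lambda>z. herm (\<phi> z) \<eta>) (ball 0 1)"
  unfolding analytic_self_map_def by (intro holomorphic_vec_on_herm) blast

lemma herm_less_1: "norm x < 1 \<Longrightarrow> norm y \<le> 1 \<Longrightarrow> cmod (herm x y) < 1"
  using herm_cauchy_schwarz[of x y] mult_left_le[of "norm y" "norm x"] by simp

text \<open>Schwarz-Pick between \<open>z\<close> and points \<open>w n\<close> that realize the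
  liminf, applied to the component of \<phi> in the direction of \<phi>(w n), whose value at
  \<open>w n\<close> is |\<phi>(w n)|. Dividing by 1 - |w n| and passing to the limit gives the
  inequality.\<close>

lemma julia_ball:
  fixes \<phi> :: "complex^'n \<Rightarrow> complex^'n"
  assumes \<phi>: "analytic_self_map \<phi>" and \<zeta>: "norm \<zeta> = 1" and d: "dilation_coeff \<phi> \<zeta> = ereal d"
  obtains \<eta> where "norm \<eta> = 1"
    "\<And>z. norm z < 1 \<Longrightarrow> (cmod (1 - herm (\<phi> z) \<eta>))\<^sup>2 * (1 - (norm z)\<^sup>2)
      \<le> d * (cmod (1 - herm z \<zeta>))\<^sup>2 * (1 - (cmod (herm (\<phi> z) \<eta>))\<^sup>2)"
proof -
  have "\<exists>z. norm z < 1 \<and> dist z \<zeta> < inverse (real (Suc n)) \<and>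
      (1 - norm (\<phi> z)) / (1 - norm z) < d + inverse (real (Suc n))" for n
    by (rule dilation_coeff_upper) (auto simp: d)
  then obtain w where w: "\<And>n. norm (w n) < 1" "\<And>n. dist (w n) \<zeta> < inverse (real (Suc n))"
      "\<And>n. (1 - norm (\<phi> (w n))) / (1 - norm (w n)) < d + inverse (real (Suc n))"
    by metis
  have wl: "w \<longlonglongrightarrow> \<zeta>"
    unfolding tendsto_dist_iff[of w]
    by (rule tendsto_sandwich[OF _ _ tendsto_const LIMSEQ_inverse_real_of_nat])
       (intro always_eventually allI zero_le_dist less_imp_le w(2))+
  have \<phi>w: "norm (\<phi> (w n)) < 1" for n using analytic_self_map_norm[OF \<phi> w(1)] .
  have le: "1 - norm (\<phi> (w n)) \<le> (d + inverse (real (Suc n))) * (1 - norm (w n))" for n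
    using w(3)[of n] w(1)[of n] by (simp add: divide_less_eq)
  have nw: "(\<lambda>n. norm (w n)) \<longlonglongrightarrow> 1" using tendsto_norm[OF wl] \<zeta> by simp
  have n\<phi>: "(\<lambda>n. norm (\<phi> (w n))) \<longlonglongrightarrow> 1"
  proof -
    have lim: "(\<lambda>n. (d + inverse (real (Suc n))) * (1 - norm (w n))) \<longlonglongrightarrow> (d + 0) * (1 - 1)"
      by (intro tendsto_intros nw LIMSEQ_inverse_real_of_nat)
    have "(\<lambda>n. 1 - norm (\<phi> (w n))) \<longlonglongrightarrow> (d + 0) * (1 - 1)"
      by (rule tendsto_sandwich[OF always_eventually always_eventually _ lim, of "\<lambda>n. 0"])
         (use le \<phi>w less_imp_le in auto)
    then have "(\<lambda>n. 1 - (1 - norm (\<phi> (w n)))) \<longlonglongrightarrow> 1 - (d + 0) * (1 - 1)" by (intro tendsto_intros)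
    then show ?thesis by simp
  qed
  \<comment> \<open>No boundary value of \<phi> is available yet: \<eta> is obtained as a limit
    point of \<phi>(w n), and finiteness of \<open>d\<close> forces it onto the sphere.\<close>
  have "seq_compact (cball (0::complex^'n) 1)" by (simp add: compact_imp_seq_compact)
  moreover have "\<forall>n. \<phi> (w n) \<in> cball 0 1" using \<phi>w by (auto intro: less_imp_le)
  ultimately obtain \<eta> r where r: "strict_mono (r :: nat \<Rightarrow> nat)" and \<phi>l: "((\<lambda>n. \<phi> (w n)) \<circ> r) \<longlonglongrightarrow> \<eta>"
    by (rule seq_compactE)
  have n\<phi>r: "(\<lambda>n. norm (\<phi> (w (r n)))) \<longlonglongrightarrow> 1"
    using LIMSEQ_subseq_LIMSEQ[OF n\<phi> r] by (simp add: o_def)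
  have \<eta>: "norm \<eta> = 1"
    using LIMSEQ_unique[OF tendsto_norm[OF \<phi>l]] n\<phi>r by (simp add: o_def)
  have sl: "(\<lambda>n. sgn (\<phi> (w (r n)))) \<longlonglongrightarrow> \<eta>"
  proof -
    have "\<eta> \<noteq> 0" "sgn \<eta> = \<eta>" using \<eta> by (auto simp: sgn_div_norm)
    then show ?thesis using tendsto_sgn[OF \<phi>l] by (simp add: o_def)
  qed
  have wr: "(\<lambda>n. w (r n)) \<longlonglongrightarrow> \<zeta>" "(\<lambda>n. norm (w (r n))) \<longlonglongrightarrow> 1"
    using LIMSEQ_subseq_LIMSEQ[OF wl r] LIMSEQ_subseq_LIMSEQ[OF nw r] by (simp_all add: o_def)
  have ir: "(\<lambda>n. inverse (real (Suc (r n)))) \<longlonglongrightarrow> 0"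
    using LIMSEQ_subseq_LIMSEQ[OF LIMSEQ_inverse_real_of_nat r] by (simp add: o_def)
  have julia: "(cmod (1 - herm (\<phi> z) \<eta>))\<^sup>2 * (1 - (norm z)\<^sup>2)
      \<le> d * (cmod (1 - herm z \<zeta>))\<^sup>2 * (1 - (cmod (herm (\<phi> z) \<eta>))\<^sup>2)" if z: "norm z < 1" for z
  proof -
    define p where "p = (\<lambda>n. herm (\<phi> z) (sgn (\<phi> (w (r n)))))"
    have "(cmod (1 - of_real (norm (\<phi> (w (r n)))) * p n))\<^sup>2 * ((1 - (norm z)\<^sup>2) * (1 + norm (w (r n))))
        \<le> (cmod (1 - herm z (w (r n))))\<^sup>2 * ((1 - (cmod (p n))\<^sup>2) * ((d + inverse (real (Suc (r n)))) * (1 + norm (\<phi> (w (r n))))))"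
      (is "?L n \<le> ?R n") for n
    proof -
      let ?w = "w (r n)"
      have self: "herm (\<phi> ?w) (sgn (\<phi> ?w)) = of_real (norm (\<phi> ?w))"
        by (cases "\<phi> ?w = 0") (simp_all add: sgn_div_norm herm_linear herm_self power2_eq_square)
      have p1: "cmod (herm (\<phi> x) (sgn (\<phi> ?w))) < 1" if "norm x < 1" for x
        by (intro herm_less_1 analytic_self_map_norm[OF \<phi> that] norm_sgn_le_1)
      have "(cmod (1 - cnj (of_real (norm (\<phi> ?w))) * p n))\<^sup>2 * ((1 - (norm z)\<^sup>2) * (1 - (norm ?w)\<^sup>2))
          \<le> (cmod (1 - herm z ?w))\<^sup>2 * ((1 - (cmod (p n))\<^sup>2) * (1 - (norm (\<phi> ?w))\<^sup>2))"
        using schwarz_pick_ball[OF holomorphic_vec_on_self_map[OF \<phi>] p1 z w(1)[of "r n"]]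
        unfolding self p_def by simp
      also have "\<dots> \<le> (cmod (1 - herm z ?w))\<^sup>2 * ((1 - (cmod (p n))\<^sup>2) *
          ((d + inverse (real (Suc (r n)))) * (1 - norm ?w) * (1 + norm (\<phi> ?w))))"
      proof (intro mult_left_mono)
        have "1 - (norm (\<phi> ?w))\<^sup>2 = (1 - norm (\<phi> ?w)) * (1 + norm (\<phi> ?w))"
          by (simp add: power2_eq_square algebra_simps)
        also have "\<dots> \<le> (d + inverse (real (Suc (r n)))) * (1 - norm ?w) * (1 + norm (\<phi> ?w))"
          by (intro mult_right_mono le) auto
        finally show "1 - (norm (\<phi> ?w))\<^sup>2 \<le> (d + inverse (real (Suc (r n)))) * (1 - norm ?w) * (1 + norm (\<phi> ?w))" .
        show "0 \<le> 1 - (cmod (p n))\<^sup>2" using p1[OF z] by (simp add: p_def abs_square_le_1)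
      qed auto
      also have "1 - (norm ?w)\<^sup>2 = (1 + norm ?w) * (1 - norm ?w)"
        by (simp add: power2_eq_square algebra_simps)
      finally have "?L n * (1 - norm ?w) \<le> ?R n * (1 - norm ?w)"
        by (simp add: mult_ac)
      then show ?thesis using w(1)[of "r n"] by simp
    qed
    moreover have "?L \<longlonglongrightarrow> (cmod (1 - of_real 1 * herm (\<phi> z) \<eta>))\<^sup>2 * ((1 - (norm z)\<^sup>2) * (1 + 1))"
      unfolding p_def by (intro tendsto_intros n\<phi>r sl wr)
    moreover have "?R \<longlonglongrightarrow> (cmod (1 - herm z \<zeta>))\<^sup>2 * ((1 - (cmod (herm (\<phi> z) \<eta>))\<^sup>2) * ((d + 0) * (1 + 1)))"
      unfolding p_def by (intro tendsto_intros n\<phi>r sl wr ir)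
    ultimately have "(cmod (1 - of_real 1 * herm (\<phi> z) \<eta>))\<^sup>2 * ((1 - (norm z)\<^sup>2) * (1 + 1))
        \<le> (cmod (1 - herm z \<zeta>))\<^sup>2 * ((1 - (cmod (herm (\<phi> z) \<eta>))\<^sup>2) * ((d + 0) * (1 + 1)))"
      by (intro LIMSEQ_le[of ?L _ ?R]) auto
    moreover have "A * x \<le> d * B * y" if "A * (x * (1 + 1)) \<le> B * (y * ((d + 0) * (1 + 1)))" for A B x y :: real
      using that by (simp add: mult_ac)
    ultimately show ?thesis unfolding of_real_1 mult_1 by blast
  qed
  show thesis using that \<eta> julia by blast
qed

text \<open>The disc version is applied to the \<eta>-component of \<phi> on the slice through
  \<zeta>. Its radial hypothesis follows from the liminf defining \<open>d\<close>, since |herm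
  (\<phi> z) \<eta>| is at most |\<phi>(z)|.\<close>

lemma julia_caratheodory_ball:
  fixes \<phi> :: "complex^'n \<Rightarrow> complex^'n"
  assumes \<phi>: "analytic_self_map \<phi>" and \<zeta>: "norm \<zeta> = 1" and d: "dilation_coeff \<phi> \<zeta> = ereal d"
  obtains \<eta> where "norm \<eta> = 1" "d > 0"
    "\<And>l M. (\<And>n. cmod (l n) < 1) \<Longrightarrow> l \<longlonglongrightarrow> 1 \<Longrightarrow> (\<And>n. cmod (1 - l n) \<le> M * (1 - (cmod (l n))\<^sup>2))
      \<Longrightarrow> (\<lambda>n. (1 - herm (\<phi> (l n *s \<zeta>)) \<eta>) / (1 - l n)) \<longlonglongrightarrow> of_real d"
proof -
  obtain \<eta> where \<eta>: "norm \<eta> = 1" and julia: "\<And>z. norm z < 1 \<Longrightarrow> (cmod (1 - herm (\<phi> z) \<eta>))\<^sup>2 * (1 - (norm z)\<^sup>2)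
      \<le> d * (cmod (1 - herm z \<zeta>))\<^sup>2 * (1 - (cmod (herm (\<phi> z) \<eta>))\<^sup>2)"
    using julia_ball[OF \<phi> \<zeta> d] by blast
  have lt1: "cmod (herm (\<phi> z) \<eta>) < 1" if "norm z < 1" for z
    by (rule herm_less_1) (use analytic_self_map_norm[OF \<phi> that] \<eta> in auto)
  \<comment> \<open>At the origin the left side of the Julia inequality is strictly
    positive.\<close>
  have d0: "d > 0"
  proof -
    have p0: "cmod (herm (\<phi> 0) \<eta>) < 1" by (rule lt1) simp
    then have "herm (\<phi> 0) \<eta> \<noteq> 1" by auto
    then have "0 < (cmod (1 - herm (\<phi> 0) \<eta>))\<^sup>2" by simp
    also have "\<dots> \<le> d * (1 - (cmod (herm (\<phi> 0) \<eta>))\<^sup>2)"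
      using julia[of 0] by (simp add: herm_linear)
    finally have "0 < d * (1 - (cmod (herm (\<phi> 0) \<eta>))\<^sup>2)" .
    moreover have "0 < 1 - (cmod (herm (\<phi> 0) \<eta>))\<^sup>2" using p0 by (simp add: abs_square_less_1)
    ultimately show ?thesis by (simp only: zero_less_mult_iff) linarith
  qed
  have "(\<lambda>n. (1 - herm (\<phi> (l n *s \<zeta>)) \<eta>) / (1 - l n)) \<longlonglongrightarrow> of_real d"
    if l: "\<And>n. cmod (l n) < 1" "l \<longlonglongrightarrow> 1" "\<And>n. cmod (1 - l n) \<le> M * (1 - (cmod (l n))\<^sup>2)" for l M
  proof (rule julia_caratheodory_disc[OF _ _ d0 _ _ l])
    show "(\<lambda>x. herm (\<phi> (x *s \<zeta>)) \<eta>) holomorphic_on ball 0 1"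
      using holomorphic_on_slice[OF holomorphic_vec_on_self_map[OF \<phi>], of "ball 0 1" 0 \<zeta> \<eta>]
      by (simp add: norm_vector_smult \<zeta>)
    fix x assume x: "cmod x < 1"
    then have nx: "norm (x *s \<zeta>) < 1" by (simp add: norm_vector_smult \<zeta>)
    show "cmod (herm (\<phi> (x *s \<zeta>)) \<eta>) < 1" by (rule lt1[OF nx])
    show "(cmod (1 - herm (\<phi> (x *s \<zeta>)) \<eta>))\<^sup>2 * (1 - (cmod x)\<^sup>2)
        \<le> d * (cmod (1 - x))\<^sup>2 * (1 - (cmod (herm (\<phi> (x *s \<zeta>)) \<eta>))\<^sup>2)"
      using julia[OF nx] by (simp add: norm_vector_smult \<zeta> herm_linear herm_self)
  next
    fix e :: real assume e: "e > 0"
    obtain \<delta> where \<delta>: "\<delta> > 0" "\<And>z. norm z < 1 \<Longrightarrow> z \<noteq> \<zeta> \<Longrightarrow> dist z \<zeta> < \<delta> \<Longrightarrow> d - e < (1 - norm (\<phi> z)) / (1 - norm z)"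
      using dilation_coeff_lower[of "d - e" \<phi> \<zeta>] e d by auto
    show "\<forall>\<^sub>F r in at_left 1. (d - e) * (1 - r) \<le> 1 - cmod (herm (\<phi> (of_real r *s \<zeta>)) \<eta>)"
      unfolding eventually_at_left_field
    proof (intro exI[of _ "max 0 (1 - \<delta>)"] conjI allI impI)
      fix r :: real assume r: "max 0 (1 - \<delta>) < r" "r < 1"
      have n: "norm (of_real r *s \<zeta>) = r" using r by (simp add: norm_vector_smult \<zeta>)
      have "dist (of_real r *s \<zeta>) \<zeta> = norm ((r - 1) *\<^sub>R \<zeta>)"
        by (simp add: dist_norm smult_of_real algebra_simps)
      then have "dist (of_real r *s \<zeta>) \<zeta> < \<delta>" using r by (simp add: \<zeta>)
      moreover have "of_real r *s \<zeta> \<noteq> \<zeta>" using n r \<zeta> by (metis less_irrefl)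
      ultimately have "(d - e) * (1 - r) < 1 - norm (\<phi> (of_real r *s \<zeta>))"
        using \<delta>(2)[of "of_real r *s \<zeta>"] n r \<zeta> by (auto simp: less_divide_eq)
      also have "\<dots> \<le> 1 - cmod (herm (\<phi> (of_real r *s \<zeta>)) \<eta>)"
        using herm_cauchy_schwarz[of "\<phi> (of_real r *s \<zeta>)" \<eta>] \<eta> by simp
      finally show "(d - e) * (1 - r) \<le> 1 - cmod (herm (\<phi> (of_real r *s \<zeta>)) \<eta>)" by simp
    qed (use \<delta> in auto)
  qed
  then show thesis using that[OF \<eta> d0] by blast
qed

section \<open>Boundary sequences\<close>

text \<open>The factor 1 + M^2 = |1 + iM|^2 makes t (1 + M^2) at most 1 for every index, including
  0. Since the defect of 1 - t (1 + iM) is t (2 - t (1 + M^2)), the whole sequence lies in the disc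
  with defect at least t.\<close>

definition stolz_step :: "real \<Rightarrow> nat \<Rightarrow> real"
  where "stolz_step M n = 1 / ((1 + M\<^sup>2) * real (Suc n))"

definition stolz_seq :: "real \<Rightarrow> nat \<Rightarrow> complex"
  where "stolz_seq M n = 1 - of_real (stolz_step M n) * Complex 1 M"

lemma stolz_step_pos: "stolz_step M n > 0"
  by (simp add: stolz_step_def add_pos_nonneg)

lemma stolz_step_lim: "stolz_step M \<longlonglongrightarrow> 0"
proof -
  have "(\<lambda>n. 1 / (1 + M\<^sup>2) * inverse (real (Suc n))) \<longlonglongrightarrow> 1 / (1 + M\<^sup>2) * 0"
    by (intro tendsto_intros LIMSEQ_inverse_real_of_nat)
  moreover have "stolz_step M = (\<lambda>n. 1 / (1 + M\<^sup>2) * inverse (real (Suc n)))"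
    by (simp add: stolz_step_def fun_eq_iff divide_simps)
  ultimately show ?thesis by simp
qed

lemma stolz_seq_lim: "stolz_seq M \<longlonglongrightarrow> 1"
proof -
  have "(\<lambda>n. 1 - of_real (stolz_step M n) * Complex 1 M) \<longlonglongrightarrow> 1 - of_real 0 * Complex 1 M"
    by (intro tendsto_intros stolz_step_lim)
  then show ?thesis by (simp add: stolz_seq_def[abs_def])
qed

lemma stolz_seq_defect:
  "1 - (cmod (stolz_seq M n))\<^sup>2 = stolz_step M n * (2 - stolz_step M n * (1 + M\<^sup>2))"
  unfolding stolz_seq_def cmod_power2 by (simp add: power2_eq_square algebra_simps)

lemma stolz_seq_defect_ge: "stolz_step M n \<le> 1 - (cmod (stolz_seq M n))\<^sup>2"
proof -
  have "1 + M\<^sup>2 > 0" by (simp add: add_pos_nonneg)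
  then have "stolz_step M n * (1 + M\<^sup>2) \<le> 1" by (simp add: stolz_step_def divide_simps)
  then show ?thesis
    unfolding stolz_seq_defect using stolz_step_pos[of M n] by (simp add: mult_le_cancel_left1)
qed

lemma stolz_seq_norm: "cmod (stolz_seq M n) < 1"
proof -
  have "(cmod (stolz_seq M n))\<^sup>2 < 1"
    using stolz_seq_defect_ge[of M n] stolz_step_pos[of M n] by linarith
  then show ?thesis by (simp add: abs_square_less_1)
qed

lemma stolz_seq_defect_lim: "(\<lambda>n. (1 - (cmod (stolz_seq M n))\<^sup>2) / stolz_step M n) \<longlonglongrightarrow> 2"
proof -
  have "(\<lambda>n. 2 - stolz_step M n * (1 + M\<^sup>2)) \<longlonglongrightarrow> 2 - 0 * (1 + M\<^sup>2)"
    by (intro tendsto_intros stolz_step_lim)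
  moreover have "(1 - (cmod (stolz_seq M n))\<^sup>2) / stolz_step M n = 2 - stolz_step M n * (1 + M\<^sup>2)" for n
    unfolding stolz_seq_defect using stolz_step_pos[of M n] by simp
  ultimately show ?thesis by simp
qed

lemma stolz_seq_nontangential:
  "cmod (1 - stolz_seq M n) \<le> cmod (Complex 1 M) * (1 - (cmod (stolz_seq M n))\<^sup>2)"
proof -
  have "cmod (1 - stolz_seq M n) = cmod (Complex 1 M) * stolz_step M n"
    using stolz_step_pos[of M n] by (simp add: stolz_seq_def norm_mult)
  then show ?thesis using stolz_seq_defect_ge[of M n] by (simp add: mult_left_mono)
qed

text \<open>For a unit vector \<eta> and a point x of the ball, |x - \<eta>|^2 is at most 2 - 2 Re
  herm x \<eta>. Convergence of the single component along \<eta> to 1 therefore forces convergence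
  of the whole vector.\<close>

lemma radial_limitI:
  fixes \<phi> :: "complex^'n \<Rightarrow> complex^'n"
  assumes \<phi>: "analytic_self_map \<phi>" and \<zeta>: "norm \<zeta> = 1" and \<eta>: "norm \<eta> = 1"
    and l: "\<And>n. cmod (l n) < 1" "l \<longlonglongrightarrow> 1"
    and lim: "(\<lambda>n. (1 - herm (\<phi> (l n *s \<zeta>)) \<eta>) / (1 - l n)) \<longlonglongrightarrow> c"
  shows "(\<lambda>n. herm (\<phi> (l n *s \<zeta>)) \<eta>) \<longlonglongrightarrow> 1" "(\<lambda>n. \<phi> (l n *s \<zeta>)) \<longlonglongrightarrow> \<eta>"
proof -
  have ne: "1 - l n \<noteq> 0" for n using l(1)[of n] by auto
  have "(\<lambda>n. 1 - (1 - herm (\<phi> (l n *s \<zeta>)) \<eta>) / (1 - l n) * (1 - l n)) \<longlonglongrightarrow> 1 - c * (1 - 1)"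
    by (intro tendsto_intros lim l)
  then show p: "(\<lambda>n. herm (\<phi> (l n *s \<zeta>)) \<eta>) \<longlonglongrightarrow> 1" using ne by simp
  have n1: "norm (\<phi> (l n *s \<zeta>)) < 1" for n
    by (rule analytic_self_map_norm[OF \<phi>]) (simp add: norm_vector_smult \<zeta> l)
  have bound: "(norm (\<phi> (l n *s \<zeta>) - \<eta>))\<^sup>2 \<le> 2 - 2 * Re (herm (\<phi> (l n *s \<zeta>)) \<eta>)" for n
  proof -
    let ?x = "\<phi> (l n *s \<zeta>)"
    have "Re (herm \<eta> ?x) = Re (herm ?x \<eta>)" unfolding cnj_herm[of ?x \<eta>, symmetric] by simp
    then have "(norm (?x - \<eta>))\<^sup>2 = (norm ?x)\<^sup>2 + 1 - 2 * Re (herm ?x \<eta>)"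
      unfolding norm_eq_herm[of "?x - \<eta>"] norm_eq_herm[of ?x] using \<eta>
      by (simp add: herm_linear(2,4)) (simp add: herm_self)
    moreover have "(norm ?x)\<^sup>2 \<le> 1" using n1[of n] by (simp add: abs_square_le_1)
    ultimately show ?thesis by simp
  qed
  have "(\<lambda>n. 2 - 2 * Re (herm (\<phi> (l n *s \<zeta>)) \<eta>)) \<longlonglongrightarrow> 2 - 2 * Re 1"
    by (intro tendsto_intros p)
  then have lim2: "(\<lambda>n. 2 - 2 * Re (herm (\<phi> (l n *s \<zeta>)) \<eta>)) \<longlonglongrightarrow> 0" by simp
  have "(\<lambda>n. (norm (\<phi> (l n *s \<zeta>) - \<eta>))\<^sup>2) \<longlonglongrightarrow> 0"
    by (rule tendsto_sandwich[OF _ _ tendsto_const lim2]) (intro always_eventually allI bound zero_le_power2)+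
  from tendsto_real_sqrt[OF this] have "(\<lambda>n. norm (\<phi> (l n *s \<zeta>) - \<eta>)) \<longlonglongrightarrow> 0"
    by simp
  then show "(\<lambda>n. \<phi> (l n *s \<zeta>)) \<longlonglongrightarrow> \<eta>"
    by (rule LIM_zero_cancel[OF tendsto_norm_zero_cancel])
qed

text \<open>The expansion of one map that is needed to compare two. The defect ratio relates the
  kernel normalization at \<phi>(w) to the growth bound at w. The last clause says that the
  tangential part is of smaller order than the square root of the step, so a product of two
  tangential parts is of smaller order than the step.\<close>

definition angular_asymptotics ::
    "(complex^'n \<Rightarrow> complex^'n) \<Rightarrow> complex^'n \<Rightarrow> real \<Rightarrow> complex^'n \<Rightarrow> real \<Rightarrow> bool"
  where "angular_asymptotics \<phi> \<zeta> d \<eta> M \<longleftrightarrow>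
    ((\<lambda>n. \<phi> (stolz_seq M n *s \<zeta>)) \<longlonglongrightarrow> \<eta>) \<and>
    ((\<lambda>n. (1 - herm (\<phi> (stolz_seq M n *s \<zeta>)) \<eta>) / of_real (stolz_step M n)) \<longlonglongrightarrow> of_real d * Complex 1 M) \<and>
    ((\<lambda>n. (1 - (norm (\<phi> (stolz_seq M n *s \<zeta>)))\<^sup>2) / (1 - (cmod (stolz_seq M n))\<^sup>2)) \<longlonglongrightarrow> d) \<and>
    ((\<lambda>n. (norm (\<phi> (stolz_seq M n *s \<zeta>) - herm (\<phi> (stolz_seq M n *s \<zeta>)) \<eta> *s \<eta>))\<^sup>2 / stolz_step M n) \<longlonglongrightarrow> 0)"

text \<open>Only the second clause is directly the Julia-Caratheodory limit. The other sharp clauses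
  come from squeezing: the defect of \<phi>(w) is bounded above through the \<eta>-component and
  below by the definition of \<open>d\<close> as an unrestricted liminf, and equality of the two
  limits leaves no room for a tangential part.\<close>

lemma angular_data:
  fixes \<phi> :: "complex^'n \<Rightarrow> complex^'n"
  assumes \<phi>: "analytic_self_map \<phi>" and \<zeta>: "norm \<zeta> = 1" and d: "dilation_coeff \<phi> \<zeta> = ereal d"
  obtains \<eta> where "norm \<eta> = 1" "d > 0" "has_radial_limit \<phi> \<zeta> \<eta>"
    "\<And>M. angular_asymptotics \<phi> \<zeta> d \<eta> M"
proof -
  obtain \<eta> where \<eta>: "norm \<eta> = 1" and d0: "d > 0"
    and JC: "\<And>l M. (\<And>n. cmod (l n) < 1) \<Longrightarrow> l \<longlonglongrightarrow> 1 \<Longrightarrow> (\<And>n. cmod (1 - l n) \<le> M * (1 - (cmod (l n))\<^sup>2))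
      \<Longrightarrow> (\<lambda>n. (1 - herm (\<phi> (l n *s \<zeta>)) \<eta>) / (1 - l n)) \<longlonglongrightarrow> of_real d"
    using julia_caratheodory_ball[OF \<phi> \<zeta> d] by blast
  have rad: "has_radial_limit \<phi> \<zeta> \<eta>"
    unfolding has_radial_limit_def
  proof (rule tendsto_at_left_sequentially[where b = 0])
    fix S :: "nat \<Rightarrow> real" assume S: "\<And>n. S n < 1" "\<And>n. 0 < S n" "S \<longlonglongrightarrow> 1"
    have l1: "cmod (of_real (S n)) < 1" for n using S(1,2)[of n] by simp
    have lim: "(\<lambda>n. of_real (S n) :: complex) \<longlonglongrightarrow> 1" using tendsto_of_real[OF S(3)] by simp
    have nt: "cmod (1 - of_real (S n)) \<le> 1 * (1 - (cmod (of_real (S n)))\<^sup>2)" for n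
    proof -
      have "cmod (1 - of_real (S n)) = 1 - S n"
        using S(1)[of n] by (metis abs_of_pos diff_gt_0_iff_gt norm_of_real of_real_1 of_real_diff)
      moreover have "(S n)\<^sup>2 \<le> S n" using S(1,2)[of n] by (simp add: power2_eq_square)
      ultimately show ?thesis by simp
    qed
    from radial_limitI(2)[OF \<phi> \<zeta> \<eta> l1 lim JC[OF l1 lim nt]]
    show "(\<lambda>n. \<phi> (S n *\<^sub>R \<zeta>)) \<longlonglongrightarrow> \<eta>" by (simp add: smult_of_real)
  qed simp
  have main: "angular_asymptotics \<phi> \<zeta> d \<eta> M" for M
  proof -
    define l where "l = stolz_seq M"
    define t where "t = stolz_step M"
    define x where "x = (\<lambda>n. \<phi> (l n *s \<zeta>))"
    define p where "p = (\<lambda>n. herm (x n) \<eta>)"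
    have t0: "t n > 0" for n by (simp add: t_def stolz_step_pos)
    have l: "\<And>n. cmod (l n) < 1" "l \<longlonglongrightarrow> 1" by (auto simp: l_def stolz_seq_norm stolz_seq_lim)
    have lt: "1 - l n = of_real (t n) * Complex 1 M" for n by (simp add: l_def t_def stolz_seq_def)
    have ls: "1 - (cmod (l n))\<^sup>2 > 0" for n using l(1)[of n] by (simp add: abs_square_less_1)
    have nl\<zeta>: "norm (l n *s \<zeta>) = cmod (l n)" for n by (simp add: norm_vector_smult \<zeta>)
    have x1: "norm (x n) < 1" for n
      unfolding x_def by (rule analytic_self_map_norm[OF \<phi>]) (simp add: nl\<zeta> l)
    have A: "(\<lambda>n. (1 - p n) / (1 - l n)) \<longlonglongrightarrow> of_real d"
      unfolding p_def x_def by (rule JC[OF l]) (unfold l_def, rule stolz_seq_nontangential)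
    have p1: "p \<longlonglongrightarrow> 1" and xl: "x \<longlonglongrightarrow> \<eta>"
      using radial_limitI[OF \<phi> \<zeta> \<eta> l A[unfolded p_def x_def]] by (simp_all add: p_def[abs_def] x_def[abs_def])
    have c1: "Complex 1 M \<noteq> 0" by (simp add: complex_eq_iff)
    have B: "(\<lambda>n. (1 - p n) / of_real (t n)) \<longlonglongrightarrow> of_real d * Complex 1 M"
    proof -
      have "(\<lambda>n. (1 - p n) / (1 - l n) * Complex 1 M) \<longlonglongrightarrow> of_real d * Complex 1 M"
        by (intro tendsto_intros A)
      moreover have "(1 - p n) / (1 - l n) * Complex 1 M = (1 - p n) / of_real (t n)" for n
        unfolding lt using t0[of n] c1 by simp
      ultimately show ?thesis by simp
    qed
    have Re: "(\<lambda>n. (1 - Re (p n)) / t n) \<longlonglongrightarrow> d"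
      using tendsto_Re[OF B] by (simp add: Re_divide_of_real)
    have D: "(\<lambda>n. (1 - (cmod (l n))\<^sup>2) / t n) \<longlonglongrightarrow> 2"
      unfolding l_def t_def by (rule stolz_seq_defect_lim)
    have px: "cmod (p n) \<le> norm (x n)" for n
      using herm_cauchy_schwarz[of "x n" \<eta>] by (simp add: p_def \<eta>)
    have up: "1 - (norm (x n))\<^sup>2 \<le> 1 - (cmod (p n))\<^sup>2" "1 - (cmod (p n))\<^sup>2 \<le> 2 * (1 - Re (p n))" for n
    proof -
      show "1 - (norm (x n))\<^sup>2 \<le> 1 - (cmod (p n))\<^sup>2" using px[of n] by (simp add: power_mono)
      have "(Re (p n))\<^sup>2 \<le> (cmod (p n))\<^sup>2" by (simp add: cmod_power2)
      moreover have "0 \<le> (1 - Re (p n))\<^sup>2" by simp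
      ultimately show "1 - (cmod (p n))\<^sup>2 \<le> 2 * (1 - Re (p n))"
        by (simp add: power2_eq_square algebra_simps)
    qed
    \<comment> \<open>Above: 1 - |x|^2 is at most 2 (1 - Re p), and both this and the defect of
      \<open>l n\<close> are asymptotic to known multiples of \<open>t n\<close>. Below: the liminf,
      with \<open>b\<close> between \<open>a\<close> and \<open>d\<close> leaving room for the
      factor (1 + |x|) / (1 + |l|), which tends to 1.\<close>
    have C: "(\<lambda>n. (1 - (norm (x n))\<^sup>2) / (1 - (cmod (l n))\<^sup>2)) \<longlonglongrightarrow> d"
    proof (rule order_tendstoI)
      fix a assume a: "d < a"
      have "(\<lambda>n. 2 * ((1 - Re (p n)) / t n) / ((1 - (cmod (l n))\<^sup>2) / t n)) \<longlonglongrightarrow> 2 * d / 2"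
        by (intro tendsto_intros Re D) auto
      then have "\<forall>\<^sub>F n in sequentially. 2 * ((1 - Re (p n)) / t n) / ((1 - (cmod (l n))\<^sup>2) / t n) < a"
        using a by (intro order_tendstoD(2)) auto
      then show "\<forall>\<^sub>F n in sequentially. (1 - (norm (x n))\<^sup>2) / (1 - (cmod (l n))\<^sup>2) < a"
      proof eventually_elim
        fix n assume "2 * ((1 - Re (p n)) / t n) / ((1 - (cmod (l n))\<^sup>2) / t n) < a"
        moreover have "2 * ((1 - Re (p n)) / t n) / ((1 - (cmod (l n))\<^sup>2) / t n) = 2 * (1 - Re (p n)) / (1 - (cmod (l n))\<^sup>2)"
          using t0[of n] by simp
        moreover have "(1 - (norm (x n))\<^sup>2) / (1 - (cmod (l n))\<^sup>2) \<le> 2 * (1 - Re (p n)) / (1 - (cmod (l n))\<^sup>2)"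
          using order_trans[OF up(1) up(2), of n] less_imp_le[OF ls[of n]] by (rule divide_right_mono)
        ultimately show "(1 - (norm (x n))\<^sup>2) / (1 - (cmod (l n))\<^sup>2) < a" by linarith
      qed
    next
      fix a assume a: "a < d"
      obtain b where b: "a < b" "b < d" using dense[OF a] by blast
      obtain \<delta> where \<delta>: "\<delta> > 0" "\<And>z. norm z < 1 \<Longrightarrow> z \<noteq> \<zeta> \<Longrightarrow> dist z \<zeta> < \<delta> \<Longrightarrow> b < (1 - norm (\<phi> z)) / (1 - norm z)"
        using dilation_coeff_lower[of b \<phi> \<zeta>] b d by auto
      have "(\<lambda>n. b * ((1 + norm (x n)) / (1 + cmod (l n)))) \<longlonglongrightarrow> b * ((1 + norm \<eta>) / (1 + cmod 1))"
        by (intro tendsto_intros xl l) auto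
      then have "\<forall>\<^sub>F n in sequentially. a < b * ((1 + norm (x n)) / (1 + cmod (l n)))"
        using b \<eta> by (intro order_tendstoD(1)) auto
      moreover have "(\<lambda>n. cmod (l n - 1)) \<longlonglongrightarrow> cmod (1 - 1)" by (intro tendsto_intros l)
      then have "\<forall>\<^sub>F n in sequentially. cmod (l n - 1) < \<delta>"
        using \<delta> by (intro order_tendstoD(2)) auto
      ultimately show "\<forall>\<^sub>F n in sequentially. a < (1 - (norm (x n))\<^sup>2) / (1 - (cmod (l n))\<^sup>2)"
      proof eventually_elim
        fix n assume n: "a < b * ((1 + norm (x n)) / (1 + cmod (l n)))" "cmod (l n - 1) < \<delta>"
        have eq: "l n *s \<zeta> - \<zeta> = (l n - 1) *s \<zeta>" by (simp add: vec_eq_iff algebra_simps)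
        have "dist (l n *s \<zeta>) \<zeta> < \<delta>" unfolding dist_norm eq norm_vector_smult \<zeta> using n by simp
        moreover have "l n *s \<zeta> \<noteq> \<zeta>" using nl\<zeta>[of n] l(1)[of n] \<zeta> by (metis less_irrefl)
        ultimately have "b < (1 - norm (x n)) / (1 - cmod (l n))"
          using \<delta>(2)[of "l n *s \<zeta>"] l(1)[of n] by (simp add: x_def nl\<zeta>)
        then have "b * ((1 + norm (x n)) / (1 + cmod (l n)))
            \<le> (1 - norm (x n)) / (1 - cmod (l n)) * ((1 + norm (x n)) / (1 + cmod (l n)))"
          by (intro mult_right_mono) auto
        also have "\<dots> = (1 - (norm (x n))\<^sup>2) / (1 - (cmod (l n))\<^sup>2)"
          by (simp add: power2_eq_square algebra_simps)
        finally show "a < (1 - (norm (x n))\<^sup>2) / (1 - (cmod (l n))\<^sup>2)" using n by linarith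
      qed
    qed
    \<comment> \<open>The squared tangential part is |x|^2 - |p|^2, at most 2 (1 - Re p) - (1 -
      |x|^2). After division by \<open>t n\<close> both terms tend to 2 d, by \<open>Re\<close>,
      \<open>C\<close> and \<open>D\<close>.\<close>
    have E: "(\<lambda>n. (norm (x n - p n *s \<eta>))\<^sup>2 / t n) \<longlonglongrightarrow> 0"
    proof -
      have "(\<lambda>n. 2 * ((1 - Re (p n)) / t n) - (1 - (norm (x n))\<^sup>2) / (1 - (cmod (l n))\<^sup>2) * ((1 - (cmod (l n))\<^sup>2) / t n))
          \<longlonglongrightarrow> 2 * d - d * 2"
        by (intro tendsto_intros Re C D)
      then have lim: "(\<lambda>n. 2 * ((1 - Re (p n)) / t n) - (1 - (norm (x n))\<^sup>2) / (1 - (cmod (l n))\<^sup>2) * ((1 - (cmod (l n))\<^sup>2) / t n)) \<longlonglongrightarrow> 0"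
        by simp
      have "(norm (x n - p n *s \<eta>))\<^sup>2 / t n \<le> 2 * ((1 - Re (p n)) / t n) - (1 - (norm (x n))\<^sup>2) / (1 - (cmod (l n))\<^sup>2) * ((1 - (cmod (l n))\<^sup>2) / t n)" for n
      proof -
        have "(norm (x n - p n *s \<eta>))\<^sup>2 = (norm (x n))\<^sup>2 - (cmod (p n))\<^sup>2"
          using norm_herm_decomp(2)[OF \<eta>, of "x n"] by (simp add: p_def)
        also have "\<dots> \<le> 2 * (1 - Re (p n)) - (1 - (norm (x n))\<^sup>2)" using up(2)[of n] by simp
        finally have "(norm (x n - p n *s \<eta>))\<^sup>2 / t n \<le> (2 * (1 - Re (p n)) - (1 - (norm (x n))\<^sup>2)) / t n"
          using t0[of n] by (intro divide_right_mono) auto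
        also have "(1 - (norm (x n))\<^sup>2) = (1 - (norm (x n))\<^sup>2) / (1 - (cmod (l n))\<^sup>2) * (1 - (cmod (l n))\<^sup>2)"
          using ls[of n] by simp
        finally have "(norm (x n - p n *s \<eta>))\<^sup>2 / t n \<le> (2 * (1 - Re (p n)) - (1 - (norm (x n))\<^sup>2) / (1 - (cmod (l n))\<^sup>2) * (1 - (cmod (l n))\<^sup>2)) / t n" .
        moreover have "(2 * a - b * c) / u = 2 * (a / u) - b * (c / u)" for a b c u :: real
          by (simp add: diff_divide_distrib)
        ultimately show ?thesis by metis
      qed
      then show ?thesis
        by (intro tendsto_sandwich[OF _ _ tendsto_const lim] always_eventually allI divide_nonneg_pos t0 zero_le_power2)
    qed
    show ?thesis unfolding angular_asymptotics_def using xl B C E unfolding x_def p_def l_def t_def by blast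
  qed
  show thesis using that[OF \<eta> d0 rad] main by blast
qed

text \<open>The tolerance \<open>e\<close> comes before the sequence because the tilt M depends on
  it. The ratio for \<phi> has the same limit \<open>d\<close> for every tilt, so enlarging M costs
  nothing on the side of \<phi>.\<close>

lemma boundary_sequence:
  fixes \<phi> \<psi> :: "complex^'n \<Rightarrow> complex^'n"
  assumes \<phi>: "analytic_self_map \<phi>" and \<psi>: "analytic_self_map \<psi>" and \<zeta>: "norm \<zeta> = 1"
    and d: "dilation_coeff \<phi> \<zeta> = ereal d"
    and differ: "\<not> ((\<exists>w. has_radial_limit \<phi> \<zeta> w \<and> has_radial_limit \<psi> \<zeta> w) \<and>
          dilation_coeff \<psi> \<zeta> = dilation_coeff \<phi> \<zeta>)"
    and e: "e > 0"
  shows "\<exists>l. (\<forall>n. cmod (l n) < 1) \<and> l \<longlonglongrightarrow> 1 \<and>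
    (\<lambda>n. (1 - (norm (\<phi> (l n *s \<zeta>)))\<^sup>2) / (1 - (cmod (l n))\<^sup>2)) \<longlonglongrightarrow> d \<and>
    (\<forall>\<^sub>F n in sequentially. 1 - (cmod (l n))\<^sup>2 \<le> e * cmod (1 - herm (\<psi> (l n *s \<zeta>)) (\<phi> (l n *s \<zeta>))))"
proof -
  obtain \<eta> where \<eta>: "norm \<eta> = 1" and rad: "has_radial_limit \<phi> \<zeta> \<eta>"
    and asym: "\<And>M. angular_asymptotics \<phi> \<zeta> d \<eta> M"
    by (rule angular_data[OF \<phi> \<zeta> d], rule that)
  note X = asym[unfolded angular_asymptotics_def]
  note X1 = X[THEN conjunct1] and X2 = X[THEN conjunct2, THEN conjunct1]
    and X3 = X[THEN conjunct2, THEN conjunct2, THEN conjunct1] and X4 = X[THEN conjunct2, THEN conjunct2, THEN conjunct2]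
  have "\<exists>M. \<forall>\<^sub>F n in sequentially. 1 - (cmod (stolz_seq M n))\<^sup>2
      \<le> e * cmod (1 - herm (\<psi> (stolz_seq M n *s \<zeta>)) (\<phi> (stolz_seq M n *s \<zeta>)))"
  proof (cases "dilation_coeff \<psi> \<zeta>")
    case MInf
    have "0 \<le> dilation_coeff \<psi> \<zeta>"
      unfolding dilation_coeff_def
      by (rule Liminf_bounded)
         (auto simp: eventually_at intro!: exI[of _ 1] divide_nonneg_nonneg less_imp_le[OF analytic_self_map_norm[OF \<psi>]])
    then show ?thesis using MInf by simp
  next
    case PInf
    \<comment> \<open>The 2 in the threshold 2 / e pays for 1 - |l|^2 being at most 2 (1 -
      |l|).\<close>
    then obtain \<delta> where \<delta>: "\<delta> > 0" "\<And>z. norm z < 1 \<Longrightarrow> z \<noteq> \<zeta> \<Longrightarrow> dist z \<zeta> < \<delta> \<Longrightarrow> 2 / e < (1 - norm (\<psi> z)) / (1 - norm z)"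
      using dilation_coeff_lower[of "2 / e" \<psi> \<zeta>] by auto
    let ?l = "stolz_seq 0"
    have "(\<lambda>n. cmod (?l n - 1)) \<longlonglongrightarrow> cmod (1 - 1)" by (intro tendsto_intros stolz_seq_lim)
    then have "\<forall>\<^sub>F n in sequentially. cmod (?l n - 1) < \<delta>"
      using \<delta> by (intro order_tendstoD(2)) auto
    then have "\<forall>\<^sub>F n in sequentially. 1 - (cmod (?l n))\<^sup>2 \<le> e * cmod (1 - herm (\<psi> (?l n *s \<zeta>)) (\<phi> (?l n *s \<zeta>)))"
    proof eventually_elim
      fix n assume n: "cmod (?l n - 1) < \<delta>"
      let ?z = "?l n *s \<zeta>"
      have nz: "norm ?z = cmod (?l n)" by (simp add: norm_vector_smult \<zeta>)
      have l1: "cmod (?l n) < 1" by (rule stolz_seq_norm)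
      have eq: "?z - \<zeta> = (?l n - 1) *s \<zeta>" by (simp add: vec_eq_iff algebra_simps)
      have "dist ?z \<zeta> < \<delta>" unfolding dist_norm eq norm_vector_smult \<zeta> using n by simp
      moreover have "?z \<noteq> \<zeta>" using nz l1 \<zeta> by (metis less_irrefl)
      ultimately have "2 / e < (1 - norm (\<psi> ?z)) / (1 - cmod (?l n))"
        using \<delta>(2)[of ?z] l1 by (simp add: nz)
      then have "2 * (1 - cmod (?l n)) < e * (1 - norm (\<psi> ?z))"
        using e l1 by (simp add: field_simps)
      moreover have "1 - (cmod (?l n))\<^sup>2 \<le> 2 * (1 - cmod (?l n))"
      proof -
        have "0 \<le> (1 - cmod (?l n))\<^sup>2" by simp
        then show ?thesis by (simp add: power2_eq_square algebra_simps)
      qed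
      moreover have "1 - norm (\<psi> ?z) \<le> cmod (1 - herm (\<psi> ?z) (\<phi> ?z))"
      proof -
        have "norm (\<psi> ?z) * norm (\<phi> ?z) \<le> norm (\<psi> ?z)"
          using analytic_self_map_norm[OF \<phi>, of ?z] l1 nz by (intro mult_left_le) auto
        then have "cmod (herm (\<psi> ?z) (\<phi> ?z)) \<le> norm (\<psi> ?z)"
          using herm_cauchy_schwarz order_trans by blast
        then show ?thesis using norm_triangle_ineq2[of 1 "herm (\<psi> ?z) (\<phi> ?z)"] by simp
      qed
      then have "e * (1 - norm (\<psi> ?z)) \<le> e * cmod (1 - herm (\<psi> ?z) (\<phi> ?z))"
        using e by (intro mult_left_mono) auto
      ultimately show "1 - (cmod (?l n))\<^sup>2 \<le> e * cmod (1 - herm (\<psi> ?z) (\<phi> ?z))" by linarith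
    qed
    then show ?thesis by blast
  next
    case (real d')
    obtain \<eta>' where \<eta>': "norm \<eta>' = 1" and rad': "has_radial_limit \<psi> \<zeta> \<eta>'"
      and asym': "\<And>M. angular_asymptotics \<psi> \<zeta> d' \<eta>' M"
      by (rule angular_data[OF \<psi> \<zeta> real], rule that)
    note Y = asym'[unfolded angular_asymptotics_def]
    note Y1 = Y[THEN conjunct1] and Y2 = Y[THEN conjunct2, THEN conjunct1]
      and Y4 = Y[THEN conjunct2, THEN conjunct2, THEN conjunct2]
    show ?thesis
    proof (cases "\<eta>' = \<eta>")
      case False
      let ?l = "stolz_seq 0"
      \<comment> \<open>Two unit vectors with inner product 1 coincide. With distinct boundary
        values, 1 - herm \<psi> \<phi> stays away from 0 while the defect of the point tends to
        0.\<close>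
      have ne: "1 - herm \<eta>' \<eta> \<noteq> 0"
      proof
        assume "1 - herm \<eta>' \<eta> = 0"
        then have h: "herm \<eta>' \<eta> = 1" "herm \<eta> \<eta>' = 1" using cnj_herm[of \<eta>' \<eta>] by simp_all
        have "(norm (\<eta>' - \<eta>))\<^sup>2 = 0"
          unfolding norm_eq_herm using h \<eta> \<eta>' by (simp add: herm_linear(2,4)) (simp add: herm_self)
        then show False using False by simp
      qed
      have lim: "(\<lambda>n. e * cmod (1 - herm (\<psi> (?l n *s \<zeta>)) (\<phi> (?l n *s \<zeta>))) - (1 - (cmod (?l n))\<^sup>2))
          \<longlonglongrightarrow> e * cmod (1 - herm \<eta>' \<eta>) - (1 - (cmod 1)\<^sup>2)"
        by (intro tendsto_intros X1 Y1 stolz_seq_lim)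
      have "0 < e * cmod (1 - herm \<eta>' \<eta>) - (1 - (cmod 1)\<^sup>2)" using e ne by simp
      then have "\<forall>\<^sub>F n in sequentially. 0 < e * cmod (1 - herm (\<psi> (?l n *s \<zeta>)) (\<phi> (?l n *s \<zeta>))) - (1 - (cmod (?l n))\<^sup>2)"
        by (rule order_tendstoD(1)[OF lim])
      then show ?thesis by (intro exI[of _ 0]) (auto elim: eventually_mono)
    next
      case True
      then have dd: "d' \<noteq> d" using differ rad rad' d real by auto
      \<comment> \<open>The defect of \<open>l n\<close> divided by the step tends to 2, so the
        limit \<open>?Z\<close> below has to satisfy e |?Z| > 2. This M gives at least 3 from the
        imaginary part alone.\<close>
      define M where "M = 3 / (e * \<bar>d' - d\<bar>)"
      have M: "e * (M * \<bar>d' - d\<bar>) = 3" using e dd by (simp add: M_def)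
      define l where "l = stolz_seq M"
      define t where "t = stolz_step M"
      define x where "x = (\<lambda>n. \<phi> (l n *s \<zeta>))"
      define y where "y = (\<lambda>n. \<psi> (l n *s \<zeta>))"
      define p where "p = (\<lambda>n. herm (x n) \<eta>)"
      define q where "q = (\<lambda>n. herm (y n) \<eta>)"
      define x' where "x' = (\<lambda>n. x n - p n *s \<eta>)"
      define y' where "y' = (\<lambda>n. y n - q n *s \<eta>)"
      have t0: "t n > 0" for n by (simp add: t_def stolz_step_pos)
      have P: "(\<lambda>n. (1 - p n) / of_real (t n)) \<longlonglongrightarrow> of_real d * Complex 1 M"
        and Q: "(\<lambda>n. (1 - q n) / of_real (t n)) \<longlonglongrightarrow> of_real d' * Complex 1 M"
        and X': "(\<lambda>n. (norm (x' n))\<^sup>2 / t n) \<longlonglongrightarrow> 0" and Y': "(\<lambda>n. (norm (y' n))\<^sup>2 / t n) \<longlonglongrightarrow> 0"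
        using X2[of M] Y2[of M] X4[of M] Y4[of M] True
        by (simp_all add: x_def y_def p_def q_def l_def t_def x'_def y'_def)
      have "q \<longlonglongrightarrow> herm \<eta> \<eta>"
        unfolding q_def y_def l_def using Y1[of M] True by (intro tendsto_intros) auto
      then have q1: "q \<longlonglongrightarrow> 1" using \<eta> by (simp add: herm_self)
      \<comment> \<open>Cauchy-Schwarz, with each tangential part of smaller order than the square
        root of \<open>t n\<close>.\<close>
      have R0: "(\<lambda>n. herm (y' n) (x' n) / of_real (t n)) \<longlonglongrightarrow> 0"
      proof -
        have "(\<lambda>n. sqrt ((norm (y' n))\<^sup>2 / t n) * sqrt ((norm (x' n))\<^sup>2 / t n)) \<longlonglongrightarrow> sqrt 0 * sqrt 0"
          by (intro tendsto_intros X' Y')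
        then have lim: "(\<lambda>n. sqrt ((norm (y' n))\<^sup>2 / t n) * sqrt ((norm (x' n))\<^sup>2 / t n)) \<longlonglongrightarrow> 0" by simp
        have "cmod (herm (y' n) (x' n) / of_real (t n)) \<le> sqrt ((norm (y' n))\<^sup>2 / t n) * sqrt ((norm (x' n))\<^sup>2 / t n)" for n
          using t0[of n] herm_cauchy_schwarz[of "y' n" "x' n"]
          by (simp add: real_sqrt_divide norm_divide divide_right_mono)
        then show ?thesis by (intro Lim_null_comparison[OF always_eventually lim]) auto
      qed
      \<comment> \<open>Decomposing both vectors along the common boundary value \<eta> leaves q cnj
        p plus the tangential product; the rest is 1 - q cnj p = (1 - q) + q cnj (1 - p).\<close>
      have split: "1 - herm (y n) (x n) = (1 - q n) + q n * cnj (1 - p n) - herm (y' n) (x' n)" for n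
      proof -
        have o: "herm (x' n) \<eta> = 0" "herm (y' n) \<eta> = 0"
          unfolding x'_def y'_def p_def q_def by (rule norm_herm_decomp(1)[OF \<eta>])+
        then have o': "herm \<eta> (x' n) = 0" using cnj_herm[of "x' n" \<eta>] by simp
        have "herm (y n) (x n) = herm (q n *s \<eta> + y' n) (p n *s \<eta> + x' n)"
          by (simp add: x'_def y'_def)
        also have "\<dots> = q n * cnj (p n) + herm (y' n) (x' n)"
          using \<eta> by (simp add: herm_linear(1,3,5,6) o o' herm_self)
        finally show ?thesis by (simp add: algebra_simps)
      qed
      have "(\<lambda>n. (1 - q n) / of_real (t n) + q n * cnj ((1 - p n) / of_real (t n)) - herm (y' n) (x' n) / of_real (t n))
          \<longlonglongrightarrow> of_real d' * Complex 1 M + 1 * cnj (of_real d * Complex 1 M) - 0"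
        by (intro tendsto_intros P Q R0 q1)
      moreover have "(1 - q n) / of_real (t n) + q n * cnj ((1 - p n) / of_real (t n)) - herm (y' n) (x' n) / of_real (t n)
          = (1 - herm (y n) (x n)) / of_real (t n)" for n
      proof -
        have "a / u + b * (c / u) - r / u = (a + b * c - r) / u" for a b c r u :: complex
          by (simp add: add_divide_distrib diff_divide_distrib)
        then show ?thesis unfolding split complex_cnj_divide complex_cnj_complex_of_real .
      qed
      ultimately have Z: "(\<lambda>n. (1 - herm (y n) (x n)) / of_real (t n)) \<longlonglongrightarrow> of_real d' * Complex 1 M + cnj (of_real d * Complex 1 M)"
        (is "_ \<longlonglongrightarrow> ?Z") by (simp only: mult_1 diff_zero)
      \<comment> \<open>Conjugation reverses the sign of the imaginary part contributed by \<phi>,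
        so the difference of the dilations appears, multiplied by M.\<close>
      have "\<bar>Im ?Z\<bar> = \<bar>M\<bar> * \<bar>d' - d\<bar>" by (simp add: abs_mult[symmetric] algebra_simps)
      then have "\<bar>M\<bar> * \<bar>d' - d\<bar> \<le> cmod ?Z" using abs_Im_le_cmod[of ?Z] by simp
      moreover have "M * \<bar>d' - d\<bar> \<le> \<bar>M\<bar> * \<bar>d' - d\<bar>" by (intro mult_right_mono) auto
      ultimately have "e * (M * \<bar>d' - d\<bar>) \<le> e * cmod ?Z"
        using e by (intro mult_left_mono) auto
      then have Z3: "3 \<le> e * cmod ?Z" unfolding M .
      have lim: "(\<lambda>n. e * cmod ((1 - herm (y n) (x n)) / of_real (t n)) - (1 - (cmod (l n))\<^sup>2) / t n) \<longlonglongrightarrow> e * cmod ?Z - 2"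
        unfolding l_def t_def by (intro tendsto_intros Z[unfolded l_def t_def] stolz_seq_defect_lim)
      have "0 < e * cmod ?Z - 2" using Z3 by linarith
      then have "\<forall>\<^sub>F n in sequentially. 0 < e * cmod ((1 - herm (y n) (x n)) / of_real (t n)) - (1 - (cmod (l n))\<^sup>2) / t n"
        by (rule order_tendstoD(1)[OF lim])
      then have "\<forall>\<^sub>F n in sequentially. 1 - (cmod (l n))\<^sup>2 \<le> e * cmod (1 - herm (y n) (x n))"
      proof eventually_elim
        fix n assume "0 < e * cmod ((1 - herm (y n) (x n)) / of_real (t n)) - (1 - (cmod (l n))\<^sup>2) / t n"
        then have "(1 - (cmod (l n))\<^sup>2) / t n < e * cmod (1 - herm (y n) (x n)) / t n"
          using t0[of n] by (simp add: norm_divide)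
        then show "1 - (cmod (l n))\<^sup>2 \<le> e * cmod (1 - herm (y n) (x n))"
          using t0[of n] by (simp add: divide_less_cancel)
      qed
      then show ?thesis unfolding l_def x_def y_def by blast
    qed
  qed
  then show ?thesis using stolz_seq_norm stolz_seq_lim X3 by blast
qed

section \<open>Unitarily invariant measures and their moments\<close>

text \<open>The uniqueness argument for Haar measure: the image measure is again translation
  invariant, and it agrees with \<open>lborel\<close> on the unit ball because T preserves norms.
  Fubini applied to the product of the indicators of A and of that ball identifies the two
  measures.\<close>

lemma lborel_isometry_invariant:
  fixes T :: "'a::euclidean_space \<Rightarrow> 'a"
  assumes lin: "linear T" and iso: "\<And>x. norm (T x) = norm x"
  shows "distr lborel borel T = lborel"
proof -
  let ?M = "distr lborel borel T"
  have inj: "inj T"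
    using linear_injective_0[OF lin] by (metis iso norm_eq_zero)
  have surj: "surj T"
    using lin inj linear_injective_imp_surjective by blast
  have contT: "continuous_on UNIV T"
    using lin by (simp add: linear_continuous_on linear_conv_bounded_linear)
  have measT [measurable]: "T \<in> borel_measurable borel"
    by (intro borel_measurable_continuous_onI contT)
  define B where "B = ball (0::'a) 1"
  have [measurable]: "B \<in> sets borel" by (simp add: B_def)
  have MB: "emeasure ?M B = emeasure lborel B"
  proof -
    have "T -` B = B" by (auto simp: B_def iso)
    then show ?thesis by (subst emeasure_distr) auto
  qed
  have Bpos: "emeasure lborel B \<noteq> 0"
    using content_ball_pos[of 1 "0::'a"] by (auto simp: measure_def B_def)
  have Bfin: "emeasure lborel B \<noteq> \<infinity>"
    using emeasure_bounded_finite[OF bounded_ball, of "0::'a" 1] by (auto simp: B_def)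
  \<comment> \<open>Every translation vector is some T u by surjectivity, and translation by T u
    corresponds to translation by u before T is applied.\<close>
  have transM: "(\<integral>\<^sup>+x. f (x + y) \<partial>?M) = (\<integral>\<^sup>+x. f x \<partial>?M)"
    if f[measurable]: "f \<in> borel_measurable borel" for f :: "'a \<Rightarrow> ennreal" and y
  proof -
    obtain u where u: "y = T u" using surj by auto
    have "(\<integral>\<^sup>+x. f (x + y) \<partial>?M) = (\<integral>\<^sup>+x. f (T x + T u) \<partial>lborel)"
      by (subst nn_integral_distr) (auto simp: u)
    also have "\<dots> = (\<integral>\<^sup>+x. f (T (u + x)) \<partial>lborel)"
      by (simp add: linear_add[OF lin] add.commute)
    also have "\<dots> = (\<integral>\<^sup>+x. f (T x) \<partial>distr lborel borel ((+) u))"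
      by (subst nn_integral_distr) auto
    also have "\<dots> = (\<integral>\<^sup>+x. f x \<partial>?M)"
      by (simp add: lborel_distr_plus nn_integral_distr)
    finally show ?thesis .
  qed
  have transL: "(\<integral>\<^sup>+x. f (x + y) \<partial>lborel) = (\<integral>\<^sup>+x. f x \<partial>lborel)"
    if f[measurable]: "f \<in> borel_measurable borel" for f :: "'a \<Rightarrow> ennreal" and y
    by (subst (2) lborel_distr_plus[of y, symmetric], subst nn_integral_distr)
       (auto simp: add.commute)
  have refl: "(\<integral>\<^sup>+x. f (- x) \<partial>lborel) = (\<integral>\<^sup>+x. f x \<partial>lborel)"
    if f[measurable]: "f \<in> borel_measurable borel" for f :: "'a \<Rightarrow> ennreal"
    by (subst (2) lborel_affine[of "-1::real" "0::'a"])
       (auto simp: nn_integral_density nn_integral_distr)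
  have sfM: "sigma_finite_measure ?M"
  proof
    show "\<exists>A. countable A \<and> A \<subseteq> sets ?M \<and> \<Union>A = space ?M \<and> (\<forall>a\<in>A. emeasure ?M a \<noteq> \<infinity>)"
    proof (intro exI[of _ "(\<lambda>n::nat. ball (0::'a) (real n)) ` UNIV"] conjI ballI)
      show "\<Union>(range (\<lambda>n. ball 0 (real n))) = space ?M"
        by (auto simp: reals_Archimedean2)
      fix a assume "a \<in> range (\<lambda>n. ball (0::'a) (real n))"
      then obtain n where a: "a = ball 0 (real n)" by auto
      have "T -` a = a" by (auto simp: a iso)
      then show "emeasure ?M a \<noteq> \<infinity>"
        using emeasure_bounded_finite[OF bounded_ball, of "0::'a" "real n"]
        by (subst emeasure_distr) (auto simp: a)
    qed auto
  qed
  interpret pair_sigma_finite ?M lborel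
    using sfM sigma_finite_lborel by (simp add: pair_sigma_finite_def)
  show ?thesis
  proof (rule measure_eqI)
    show "sets ?M = sets lborel" by simp
    fix A assume "A \<in> sets ?M"
    then have A[measurable]: "A \<in> sets borel" by simp
    \<comment> \<open>Translation of \<open>y\<close> in \<open>lborel\<close>, translation of
      \<open>x\<close> in the image measure and a reflection move the coupling of x and y from B to
      A. The common mass of B, finite and nonzero, then cancels.\<close>
    have "emeasure ?M A * emeasure lborel B = (\<integral>\<^sup>+x. \<integral>\<^sup>+y. indicator A x * indicator B y \<partial>lborel \<partial>?M)"
      by (simp add: nn_integral_cmult nn_integral_multc)
    also have "\<dots> = (\<integral>\<^sup>+x. \<integral>\<^sup>+y. indicator A x * indicator B (y + x) \<partial>lborel \<partial>?M)"
      by (simp add: nn_integral_cmult transL[where f="indicator B"])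
    also have "\<dots> = (\<integral>\<^sup>+y. \<integral>\<^sup>+x. indicator A x * indicator B (y + x) \<partial>?M \<partial>lborel)"
      by (rule Fubini'[symmetric]) measurable
    also have "\<dots> = (\<integral>\<^sup>+y. \<integral>\<^sup>+x. indicator A (x + - y) * indicator B x \<partial>?M \<partial>lborel)"
    proof (rule nn_integral_cong)
      fix y
      show "(\<integral>\<^sup>+x. indicator A x * indicator B (y + x) \<partial>?M) = (\<integral>\<^sup>+x. indicator A (x + - y) * indicator B x \<partial>?M)"
        using transM[of "\<lambda>x. indicator A x * indicator B (y + x)" "-y"] by simp
    qed
    also have "\<dots> = (\<integral>\<^sup>+x. \<integral>\<^sup>+y. indicator A (x + - y) * indicator B x \<partial>lborel \<partial>?M)"
      by (rule Fubini') measurable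
    also have "\<dots> = (\<integral>\<^sup>+x. \<integral>\<^sup>+y. indicator A (x + y) * indicator B x \<partial>lborel \<partial>?M)"
      using refl[of "\<lambda>y. indicator A (x + y) * indicator B x" for x] by simp
    also have "\<dots> = (\<integral>\<^sup>+x. emeasure lborel A * indicator B x \<partial>?M)"
      using transL[of "indicator A"] by (simp add: nn_integral_multc add.commute)
    also have "\<dots> = emeasure lborel A * emeasure lborel B"
      by (simp add: nn_integral_cmult MB)
    finally show "emeasure ?M A = emeasure lborel A"
      using Bpos Bfin by (metis ennreal_mult_divide_eq infinity_ennreal_def)
  qed
qed

section \<open>Circle averages and Parseval's identity\<close>

definition circle_measure :: "real measure"
  where "circle_measure = density lborel (\<lambda>x. ennreal (indicator {0..2*pi} x / (2*pi)))"

lemma sets_circle_measure [measurable_cong, simp]: "sets circle_measure = sets borel"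
  by (simp add: circle_measure_def)

lemma space_circle_measure [simp]: "space circle_measure = UNIV"
  by (simp add: circle_measure_def)

lemma emeasure_circle_measure_UNIV: "emeasure circle_measure UNIV = 1"
proof -
  have "emeasure circle_measure UNIV = (\<integral>\<^sup>+x. ennreal (1 / (2*pi)) * indicator {0..2*pi} x \<partial>lborel)"
    unfolding circle_measure_def
    by (subst emeasure_density) (auto intro!: nn_integral_cong split: split_indicator)
  also have "\<dots> = 1"
    by (subst nn_integral_cmult_indicator) (auto simp flip: ennreal_mult)
  finally show ?thesis .
qed

interpretation circle: finite_measure circle_measure
  by standard (simp add: emeasure_circle_measure_UNIV)

lemma integral_circle_cis:
  "(LINT t|circle_measure. cis (real_of_int k * t)) = (if k = 0 then 1 else 0)"
proof (cases "k = 0")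
    case True
    then show ?thesis using emeasure_circle_measure_UNIV by (simp add: measure_def)
  next
    case False
    let ?D = "\<i> * of_int k * of_real (2*pi) :: complex"
    have "(LINT t|circle_measure. cis (real_of_int k * t))
        = (LINT t|lborel. (indicator {0..2*pi} t / (2*pi)) *\<^sub>R cis (real_of_int k * t))"
      unfolding circle_measure_def by (rule integral_density) (auto intro!: borel_measurable_continuous_onI continuous_intros)
    also have "\<dots> = (LINT t|lborel. indicator {0..2*pi} t *\<^sub>R ((1 / (2*pi)) *\<^sub>R cis (real_of_int k * t)))"
      by simp
    also have "\<dots> = cis (real_of_int k * (2*pi)) / ?D - cis (real_of_int k * 0) / ?D"
    proof (rule integral_FTC_Icc)
      fix x :: real
      have "((\<lambda>t. cis (real_of_int k * t)) has_vector_derivative real_of_int k *\<^sub>R (\<i> * cis (real_of_int k * x))) (at x within {0..2*pi})"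
        unfolding has_vector_derivative_def
        by (auto intro!: derivative_eq_intros simp: algebra_simps)
      then have "((\<lambda>t. cis (real_of_int k * t) / ?D) has_vector_derivative
          (real_of_int k *\<^sub>R (\<i> * cis (real_of_int k * x))) / ?D) (at x within {0..2*pi})"
        by (rule has_vector_derivative_divide)
      moreover have "(real_of_int k *\<^sub>R (\<i> * cis (real_of_int k * x))) / ?D = (1 / (2*pi)) *\<^sub>R cis (real_of_int k * x)"
        using False by (simp add: scaleR_conv_of_real)
      ultimately show "((\<lambda>t. cis (real_of_int k * t) / ?D) has_vector_derivative
          (1 / (2*pi)) *\<^sub>R cis (real_of_int k * x)) (at x within {0..2*pi})"
        by simp
    qed (auto intro!: continuous_intros)
    also have "cis (real_of_int k * (2*pi)) = 1"
      using cis_multiple_2pi[of "real_of_int k"] by (simp add: mult.commute)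
    finally show ?thesis using False by simp
qed

lemma integrable_circle:
  fixes f :: "real \<Rightarrow> 'a::{banach,second_countable_topology}"
  assumes "continuous_on UNIV f" "\<And>t. norm (f t) \<le> B"
  shows "integrable circle_measure f"
  by (rule circle.integrable_const_bound[where B = B])
     (use assms borel_measurable_continuous_onI in \<open>auto simp: measurable_cong_sets[OF sets_circle_measure refl]\<close>)

lemma parseval_polynomial:
  "(LINT t|circle_measure. (cmod (\<Sum>k<n. c k * cis (real k * t)))\<^sup>2) = (\<Sum>k<n. (cmod (c k))\<^sup>2)"
proof -
  let ?f = "\<lambda>j k t. c j * cnj (c k) * cis (real_of_int (int j - int k) * t)"
  have int: "integrable circle_measure (?f j k)" for j k
    by (rule integrable_circle[where B = "cmod (c j * cnj (c k))"]) (auto intro!: continuous_intros simp: norm_mult)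
  have eq: "complex_of_real ((cmod (\<Sum>k<n. c k * cis (real k * t)))\<^sup>2) = (\<Sum>j<n. \<Sum>k<n. ?f j k t)" for t
  proof -
    have cc: "cis (real j * t) * cnj (cis (real k * t)) = cis (real_of_int (int j - int k) * t)" for j k
      by (simp add: cis_cnj cis_mult left_diff_distrib)
    show ?thesis
      unfolding complex_norm_square cnj_sum sum_product cc[symmetric] by (simp add: mult_ac)
  qed
  have "complex_of_real (LINT t|circle_measure. (cmod (\<Sum>k<n. c k * cis (real k * t)))\<^sup>2)
      = (LINT t|circle_measure. (\<Sum>j<n. \<Sum>k<n. ?f j k t))"
    unfolding integral_complex_of_real[symmetric] eq ..
  also have "\<dots> = (\<Sum>j<n. \<Sum>k<n. LINT t|circle_measure. ?f j k t)"
    by (simp only: Bochner_Integration.integral_sum Bochner_Integration.integrable_sum int)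
  also have "\<dots> = (\<Sum>j<n. \<Sum>k<n. c j * cnj (c k) * (if int j - int k = 0 then 1 else 0))"
    by (simp only: integral_mult_right_zero integral_circle_cis)
  also have "\<dots> = (\<Sum>j<n. c j * cnj (c j))"
    by (intro sum.cong refl) (simp add: if_distrib sum.delta cong: if_cong)
  also have "\<dots> = complex_of_real (\<Sum>k<n. (cmod (c k))\<^sup>2)"
    by (simp add: complex_norm_square[symmetric])
  finally show ?thesis by (simp only: of_real_eq_iff)
qed

text \<open>Absolute summability bounds all partial sums by one constant, which is integrable on the
  circle; dominated convergence then carries the polynomial case to the limit.\<close>

lemma parseval:
  assumes c: "summable (\<lambda>k. cmod (c k))"
  shows "(\<lambda>k. (cmod (c k))\<^sup>2) sums (LINT t|circle_measure. (cmod (\<Sum>k. c k * cis (real k * t)))\<^sup>2)"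
    and "integrable circle_measure (\<lambda>t. (cmod (\<Sum>k. c k * cis (real k * t)))\<^sup>2)"
proof -
  let ?S = "\<lambda>n t. \<Sum>k<n. c k * cis (real k * t)" and ?f = "\<lambda>t. \<Sum>k. c k * cis (real k * t)"
  let ?B = "\<Sum>k. cmod (c k)"
  have sm: "summable (\<lambda>k. c k * cis (real k * t))" for t
    by (rule summable_norm_cancel) (simp add: norm_mult c)
  have bound: "cmod (?S n t) \<le> ?B" for n t
  proof -
    have "cmod (?S n t) \<le> (\<Sum>k<n. cmod (c k))"
      by (rule order_trans[OF norm_sum]) (simp add: norm_mult)
    also have "\<dots> \<le> ?B" by (rule sum_le_suminf[OF c]) auto
    finally show ?thesis .
  qed
  have meas: "(\<lambda>t. (cmod (?S n t))\<^sup>2) \<in> borel_measurable circle_measure" for n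
    by (simp add: measurable_cong_sets[OF sets_circle_measure refl])
       (intro borel_measurable_continuous_onI continuous_intros)
  have lim: "(\<lambda>n. (cmod (?S n t))\<^sup>2) \<longlonglongrightarrow> (cmod (?f t))\<^sup>2" for t
    by (intro tendsto_intros summable_LIMSEQ sm)
  have meas': "(\<lambda>t. (cmod (?f t))\<^sup>2) \<in> borel_measurable circle_measure"
    by (rule borel_measurable_LIMSEQ_real[OF lim meas])
  have w: "integrable circle_measure (\<lambda>t. ?B\<^sup>2)" by simp
  have bd: "AE t in circle_measure. norm ((cmod (?S n t))\<^sup>2) \<le> ?B\<^sup>2" for n
    using bound by (auto intro!: power_mono)
  have "(\<lambda>n. LINT t|circle_measure. (cmod (?S n t))\<^sup>2)
      \<longlonglongrightarrow> (LINT t|circle_measure. (cmod (?f t))\<^sup>2)"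
    by (rule integral_dominated_convergence[where s = "\<lambda>n t. (cmod (?S n t))\<^sup>2", OF meas' meas w _ bd]) (intro AE_I2 lim)
  then show "(\<lambda>k. (cmod (c k))\<^sup>2) sums (LINT t|circle_measure. (cmod (?f t))\<^sup>2)"
    unfolding sums_def parseval_polynomial .
  show "integrable circle_measure (\<lambda>t. (cmod (?f t))\<^sup>2)"
    by (rule integrable_dominated_convergence[where s = "\<lambda>n t. (cmod (?S n t))\<^sup>2", OF meas' meas w _ bd]) (intro AE_I2 lim)
qed

section \<open>Unitary maps and moments of unitarily invariant measures\<close>

definition unitary_map :: "(complex^'n \<Rightarrow> complex^'n) \<Rightarrow> bool"
  where "unitary_map T \<longleftrightarrow> (\<forall>x y. T (x + y) = T x + T y) \<and> (\<forall>c x. T (c *s x) = c *s T x) \<and>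
    (\<forall>x y. herm (T x) (T y) = herm x y)"

lemma unitary_map_norm:
  assumes "unitary_map T" shows "norm (T x) = norm x"
proof -
  have "(norm (T x))\<^sup>2 = (norm x)\<^sup>2"
    unfolding norm_eq_herm using assms by (metis unitary_map_def)
  then show ?thesis by (simp add: power2_eq_iff_nonneg)
qed

lemma unitary_map_linear: "unitary_map T \<Longrightarrow> linear T"
  by (rule linearI) (auto simp: unitary_map_def simp flip: smult_of_real)

lemma unitary_map_measurable [measurable_dest]: "unitary_map T \<Longrightarrow> T \<in> borel_measurable borel"
  by (intro borel_measurable_continuous_onI linear_continuous_on)
     (simp add: unitary_map_linear linear_conv_bounded_linear[symmetric])

lemma unitary_map_phase:
  assumes "cmod c = 1" shows "unitary_map (\<lambda>z::complex^'n. c *s z)"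
proof -
  have "c * cnj c = 1" using assms by (simp add: complex_norm_square[symmetric])
  then have "cnj c * c = 1" by (simp add: mult.commute)
  then have "herm (c *s x) (c *s y) = herm x y" for x y :: "complex^'n"
    by (simp add: herm_linear mult.assoc[symmetric])
  then show ?thesis
    by (simp add: unitary_map_def vec_eq_iff algebra_simps)
qed

text \<open>For a unit vector \<open>u\<close> this multiplies the \<open>u\<close>-component by
  \<open>c\<close> and fixes the orthogonal complement; c = -1 gives the reflection used for
  transitivity.\<close>

definition component_rotation :: "complex^'n \<Rightarrow> complex \<Rightarrow> complex^'n \<Rightarrow> complex^'n"
  where "component_rotation u c z = z + ((c - 1) * herm z u) *s u"

lemma unitary_map_component_rotation:
  assumes c: "cmod c = 1" and u: "norm u = 1"
  shows "unitary_map (component_rotation u c)"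
proof -
  have cc: "c * cnj c = 1" using c by (simp add: complex_norm_square[symmetric])
  have "herm (component_rotation u c x) (component_rotation u c y)
      = herm x y + herm x u * cnj (herm y u) * (c * cnj c - 1)" for x y
  proof -
    have "herm u y = cnj (herm y u)" by (simp add: cnj_herm)
    then show ?thesis
      using u unfolding component_rotation_def herm_linear(1,3,5,6) by (simp add: herm_self algebra_simps)
  qed
  then show ?thesis
    unfolding unitary_map_def cc
    by (simp add: component_rotation_def herm_linear(1,5) vec_eq_iff algebra_simps)
qed

text \<open>The phase \<open>c\<close> makes herm (c *s v) u real and nonnegative. The reflection
  along the difference of the two vectors then exchanges them, which needs herm w u = herm u w.
  Moments see only moduli, so the phase is harmless there.\<close>

lemma unitary_map_to_unit_vector:
  fixes u v :: "complex^'n"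
  assumes u: "norm u = 1" and v: "norm v = 1"
  obtains T c where "unitary_map T" "cmod c = 1" "T (c *s v) = u"
proof -
  define c where "c = (if herm v u = 0 then 1 else cnj (sgn (herm v u)))"
  have c: "cmod c = 1" by (simp add: c_def norm_sgn)
  define w where "w = c *s v"
  have w: "norm w = 1" by (simp add: w_def norm_vector_smult c v)
  have wu: "herm w u = of_real (cmod (herm v u))"
    by (auto simp: w_def herm_linear c_def sgn_eq norm_mult complex_norm_square[symmetric] field_simps power2_eq_square)
  then have uw: "herm u w = herm w u" using cnj_herm[of w u] by simp
  show thesis
  proof (cases "w = u")
    case True
    have "unitary_map (\<lambda>z::complex^'n. 1 *s z)" by (rule unitary_map_phase) simp
    then show ?thesis using that[of "\<lambda>z. 1 *s z" c] c True by (simp add: w_def)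
  next
    case False
    define r where "r = norm (w - u)"
    define e where "e = (1 / r) *\<^sub>R (w - u)"
    have r: "r \<noteq> 0" using False by (simp add: r_def)
    have e: "norm e = 1" using False by (simp add: e_def r_def)
    have "of_real (r\<^sup>2) = herm (w - u) (w - u)" by (simp add: r_def herm_self)
    also have "\<dots> = 2 * herm w (w - u)"
      using u w uw by (simp add: herm_linear(2,4)) (simp add: herm_self)
    finally have r2: "2 * herm w (w - u) = of_real (r\<^sup>2)" ..
    have "component_rotation e (-1) w = w - (2 * herm w e) *s e"
      by (simp add: component_rotation_def vec_eq_iff)
    also have "2 * herm w e = of_real r"
    proof -
      have "2 * herm w e = 2 * herm w (w - u) / of_real r" by (simp add: e_def herm_linear(8))
      then show ?thesis using r by (simp add: r2 power2_eq_square)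
    qed
    also have "of_real r *s e = w - u" using r by (simp add: smult_of_real e_def)
    finally have "component_rotation e (-1) w = u" by simp
    then show ?thesis
      using that[of "component_rotation e (-1)" c] unitary_map_component_rotation[OF _ e, of "-1"] c by (simp add: w_def)
  qed
qed

text \<open>By the binomial theorem the k-th power is a trigonometric polynomial in
  \<open>t\<close>, so Parseval gives squared binomial coefficients.\<close>

lemma circle_binomial:
  "(\<integral>\<^sup>+t. ennreal (cmod (a + cis t * b) ^ (2 * k)) \<partial>circle_measure)
    = ennreal (\<Sum>l\<le>k. (real (k choose l))\<^sup>2 * (cmod a ^ (2 * (k - l)) * cmod b ^ (2 * l)))"
proof -
  define c where "c = (\<lambda>l. of_nat (k choose l) * a ^ (k - l) * b ^ l)"
  have eq: "cmod (a + cis t * b) ^ (2 * k) = (cmod (\<Sum>l<Suc k. c l * cis (real l * t)))\<^sup>2" for t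
  proof -
    have "(a + cis t * b) ^ k = (cis t * b + a) ^ k" by (simp add: add.commute)
    also have "\<dots> = (\<Sum>l\<le>k. of_nat (k choose l) * (cis t * b) ^ l * a ^ (k - l))" by (rule binomial_ring)
    finally have 1: "(a + cis t * b) ^ k = (\<Sum>l\<le>k. of_nat (k choose l) * (cis t * b) ^ l * a ^ (k - l))" .
    have pw: "(cis t * b) ^ l = b ^ l * cis (real l * t)" for l
      by (simp only: power_mult_distrib Complex.DeMoivre mult.commute)
    have "(\<Sum>l\<le>k. of_nat (k choose l) * (cis t * b) ^ l * a ^ (k - l)) = (\<Sum>l<Suc k. c l * cis (real l * t))"
      unfolding lessThan_Suc_atMost pw by (intro sum.cong refl) (simp add: c_def mult_ac)
    then show ?thesis using 1 by (metis norm_power power_mult mult.commute)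
  qed
  have int: "integrable circle_measure (\<lambda>t. (cmod (\<Sum>l<Suc k. c l * cis (real l * t)))\<^sup>2)"
  proof (rule integrable_circle[where B = "(\<Sum>l<Suc k. cmod (c l))\<^sup>2"])
    fix t
    have "cmod (\<Sum>l<Suc k. c l * cis (real l * t)) \<le> (\<Sum>l<Suc k. cmod (c l))"
      by (rule order_trans[OF norm_sum]) (simp add: norm_mult)
    then show "norm ((cmod (\<Sum>l<Suc k. c l * cis (real l * t)))\<^sup>2) \<le> (\<Sum>l<Suc k. cmod (c l))\<^sup>2"
      by (simp add: power_mono)
  qed (intro continuous_intros)
  have "(\<integral>\<^sup>+t. ennreal (cmod (a + cis t * b) ^ (2 * k)) \<partial>circle_measure)
      = ennreal (\<Sum>l<Suc k. (cmod (c l))\<^sup>2)"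
    unfolding eq by (subst nn_integral_eq_integral[OF int]) (auto simp only: parseval_polynomial AE_I2 zero_le_power2)
  also have "(\<Sum>l<Suc k. (cmod (c l))\<^sup>2) = (\<Sum>l\<le>k. (real (k choose l))\<^sup>2 * (cmod a ^ (2 * (k - l)) * cmod b ^ (2 * l)))"
    unfolding lessThan_Suc_atMost
    by (intro sum.cong refl) (simp add: c_def norm_mult norm_power power_mult_distrib power_mult mult.commute[of 2] mult.assoc)
  finally show ?thesis .
qed

text \<open>Instantiated by surface measure, by volume measure, by the images of surface measure on
  smaller spheres and by the weighted Bergman measures. Concentration on the closed ball makes every
  continuous function integrable.\<close>

locale unitarily_invariant = finite_measure \<mu> for \<mu> :: "(complex^'n) measure" +
  assumes sets_borel [measurable_cong, simp]: "sets \<mu> = sets borel"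
    and AE_cball: "AE z in \<mu>. norm z \<le> 1"
    and invariant: "unitary_map T \<Longrightarrow> distr \<mu> borel T = \<mu>"
begin

lemma space_UNIV [simp]: "space \<mu> = UNIV"
  using sets_eq_imp_space_eq[OF sets_borel] by simp

lemma nn_integral_unitary:
  assumes h: "h \<in> borel_measurable borel" and T: "unitary_map T"
  shows "(\<integral>\<^sup>+z. h (T z) \<partial>\<mu>) = (\<integral>\<^sup>+z. h z \<partial>\<mu>)"
proof -
  have "(\<integral>\<^sup>+z. h z \<partial>distr \<mu> borel T) = (\<integral>\<^sup>+z. h (T z) \<partial>\<mu>)"
    using h unitary_map_measurable[OF T] by (intro nn_integral_distr) auto
  then show ?thesis by (simp add: invariant[OF T])
qed

text \<open>Invariance holds for each \<open>t\<close>; Tonelli then averages over \<open>t\<close>.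
  This replaces integrals over the ball by circle means along orbits, where one-variable theory
  applies. Joint continuity supplies measurability.\<close>

lemma nn_integral_average:
  assumes h[measurable]: "h \<in> borel_measurable borel"
    and T: "\<And>t. unitary_map (T t)" and cont: "continuous_on UNIV (\<lambda>(z, t). T t z)"
  shows "(\<integral>\<^sup>+z. h z \<partial>\<mu>) = (\<integral>\<^sup>+z. \<integral>\<^sup>+t. h (T t z) \<partial>circle_measure \<partial>\<mu>)"
proof -
  interpret pair_sigma_finite \<mu> circle_measure
    by (simp add: pair_sigma_finite_def sigma_finite_measure_axioms circle.sigma_finite_measure_axioms)
  have "(\<lambda>(z, t). T t z) \<in> borel_measurable (borel \<Otimes>\<^sub>M borel)"
    using borel_measurable_continuous_onI[OF cont] by (simp add: borel_prod)
  then have "(\<lambda>x. h (case x of (z, t) \<Rightarrow> T t z)) \<in> borel_measurable (borel \<Otimes>\<^sub>M borel)"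
    by (rule measurable_compose[OF _ h])
  then have meas: "(\<lambda>(z, t). h (T t z)) \<in> borel_measurable (\<mu> \<Otimes>\<^sub>M circle_measure)"
    by (simp add: case_prod_unfold cong: measurable_cong_sets sets_pair_measure_cong)
  have "(\<integral>\<^sup>+z. \<integral>\<^sup>+t. h (T t z) \<partial>circle_measure \<partial>\<mu>) = (\<integral>\<^sup>+t. \<integral>\<^sup>+z. h (T t z) \<partial>\<mu> \<partial>circle_measure)"
    by (rule Fubini'[symmetric, OF meas])
  also have "\<dots> = (\<integral>\<^sup>+z. h z \<partial>\<mu>)"
    by (simp add: nn_integral_unitary[OF h T] emeasure_circle_measure_UNIV)
  finally show ?thesis ..
qed

lemma integrable_bounded:
  fixes f :: "complex^'n \<Rightarrow> real"
  assumes "f \<in> borel_measurable borel" "\<And>z. norm z \<le> 1 \<Longrightarrow> \<bar>f z\<bar> \<le> B"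
  shows "integrable \<mu> f"
  by (rule integrable_const_bound[where B = B])
     (use assms AE_cball in \<open>auto elim: eventually_mono cong: measurable_cong_sets\<close>)

lemma continuous_integrable:
  fixes f :: "complex^'n \<Rightarrow> real"
  assumes "continuous_on UNIV f" shows "integrable \<mu> f"
proof -
  have "compact (f ` cball 0 1)"
    using assms by (intro compact_continuous_image) (auto intro: continuous_on_subset)
  then obtain B where "\<And>x. x \<in> f ` cball 0 1 \<Longrightarrow> norm x \<le> B"
    using compact_imp_bounded bounded_iff by metis
  then show ?thesis
    by (intro integrable_bounded[where B = B] borel_measurable_continuous_onI assms) auto
qed

definition moment :: "nat \<Rightarrow> complex^'n \<Rightarrow> real"
  where "moment k v = (LINT z|\<mu>. cmod (herm z v) ^ (2 * k))"

lemma nn_integral_moment: "(\<integral>\<^sup>+z. ennreal (cmod (herm z v) ^ (2 * k)) \<partial>\<mu>) = ennreal (moment k v)"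
  unfolding moment_def
  by (intro nn_integral_eq_integral continuous_integrable continuous_intros) auto

lemma moment_nonneg: "moment k v \<ge> 0"
  unfolding moment_def by (rule Bochner_Integration.integral_nonneg) simp

lemma moment_unit:
  assumes u: "norm u = 1" and v: "norm v = 1"
  shows "moment k u = moment k v"
proof -
  obtain T c where T: "unitary_map T" and c: "cmod c = 1" and Tc: "T (c *s v) = u"
    using unitary_map_to_unit_vector[OF u v] .
  have "cmod (herm (T z) u) = cmod (herm z v)" for z
  proof -
    have "herm (T z) u = herm z (c *s v)" using T unfolding Tc[symmetric] unitary_map_def by blast
    then show ?thesis by (simp add: herm_linear norm_mult c)
  qed
  moreover have "(\<integral>\<^sup>+z. ennreal (cmod (herm (T z) u) ^ (2 * k)) \<partial>\<mu>) = (\<integral>\<^sup>+z. ennreal (cmod (herm z u) ^ (2 * k)) \<partial>\<mu>)"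
    by (rule nn_integral_unitary[OF _ T])
       (intro measurable_compose[OF _ measurable_ennreal] borel_measurable_continuous_onI continuous_intros)
  ultimately have "ennreal (moment k v) = ennreal (moment k u)"
    by (simp add: nn_integral_moment)
  then show ?thesis by (simp add: moment_nonneg)
qed

lemma moment_scale: "norm u = 1 \<Longrightarrow> moment k v = norm v ^ (2 * k) * moment k u"
proof (cases "v = 0")
  case True
  then show "norm u = 1 \<Longrightarrow> ?thesis" by (cases k) (simp_all add: moment_def herm_linear)
next
  case False
  assume u: "norm u = 1"
  have "cmod (herm z v) ^ (2 * k) = norm v ^ (2 * k) * cmod (herm z (sgn v)) ^ (2 * k)" for z
    using False by (simp add: sgn_div_norm herm_linear(8) norm_mult norm_inverse power_mult_distrib[symmetric] mult.assoc[symmetric])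
  then have "moment k v = norm v ^ (2 * k) * moment k (sgn v)" by (simp add: moment_def)
  also have "moment k (sgn v) = moment k u" using False by (intro moment_unit u) (simp add: norm_sgn)
  finally show ?thesis .
qed

text \<open>Averaging \<open>\<bar>z\<^sub>u + t e\<^sup>i\<^sup>\<theta> z\<^sub>w\<bar>\<^sup>2\<^sup>k\<close> over \<open>\<theta>\<close> and comparing the coefficients of \<open>t\<^sup>2\<close> with those of
  \<open>(1 + t\<^sup>2)\<^sup>k\<close>.\<close>

lemma mixed_moment:
  assumes u: "norm u = 1" and w: "norm w = 1" and uw: "herm w u = 0"
  shows "real (Suc k) * (LINT z|\<mu>. cmod (herm z u) ^ (2 * k) * (cmod (herm z w))\<^sup>2) = moment (Suc k) u"
proof -
  let ?n = "Suc k"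
  define I where "I = (\<lambda>l. LINT z|\<mu>. cmod (herm z u) ^ (2 * (?n - l)) * cmod (herm z w) ^ (2 * l))"
  have I0: "I l \<ge> 0" for l unfolding I_def by (rule Bochner_Integration.integral_nonneg) simp
  have wu: "herm u w = 0" using cnj_herm[of w u] uw by simp
  \<comment> \<open>With x = t^2, the vector u + t w has squared norm 1 + x, so its moment is (1 +
    x)^n times that of u. Averaging over rotations of the w-component computes the same moment by
    \<open>circle_binomial\<close>.\<close>
  have poly: "(\<Sum>l\<le>?n. (real (?n choose l))\<^sup>2 * I l * x ^ l) = (\<Sum>l\<le>?n. real (?n choose l) * moment ?n u * x ^ l)"
    if x: "x \<ge> 0" for x
  proof -
    define t where "t = sqrt x"
    have t: "t\<^sup>2 = x" using x by (simp add: t_def)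
    have tl: "(\<bar>t\<bar> ^ l)\<^sup>2 = x ^ l" for l
      unfolding t[symmetric] by (simp add: power_even_abs flip: power_mult) (simp add: mult.commute)
    let ?v = "u + t *\<^sub>R w"
    have nv: "(norm ?v)\<^sup>2 = 1 + x"
      unfolding norm_eq_herm herm_linear(1,3,7,8) using u w
      by (simp add: uw wu herm_self t[symmetric] power2_eq_square)
    have rot: "herm (component_rotation w (cis s) z) ?v = herm z u + cis s * (of_real t * herm z w)" for s z
      using w unfolding component_rotation_def herm_linear(1,3,5,8) by (simp add: uw herm_self algebra_simps)
    have nv2: "norm ?v ^ (2 * ?n) = (1 + x) ^ ?n" by (simp only: power_mult nv)
    have "ennreal ((1 + x) ^ ?n * moment ?n u) = (\<integral>\<^sup>+z. ennreal (cmod (herm z ?v) ^ (2 * ?n)) \<partial>\<mu>)"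
      unfolding nn_integral_moment moment_scale[OF u, of _ ?v] nv2 ..
    also have "\<dots> = (\<integral>\<^sup>+z. \<integral>\<^sup>+s. ennreal (cmod (herm (component_rotation w (cis s) z) ?v) ^ (2 * ?n)) \<partial>circle_measure \<partial>\<mu>)"
    proof (rule nn_integral_average)
      show "(\<lambda>z. ennreal (cmod (herm z ?v) ^ (2 * ?n))) \<in> borel_measurable borel"
        by (intro measurable_compose[OF _ measurable_ennreal] borel_measurable_continuous_onI continuous_intros)
      show "unitary_map (component_rotation w (cis s))" for s
        by (rule unitary_map_component_rotation) (simp_all add: w)
      show "continuous_on UNIV (\<lambda>(z, s). component_rotation w (cis s) z)"
        unfolding component_rotation_def case_prod_unfold by (intro continuous_intros)
    qed
    also have "\<dots> = (\<integral>\<^sup>+z. ennreal (\<Sum>l\<le>?n. (real (?n choose l))\<^sup>2 * x ^ l * (cmod (herm z u) ^ (2 * (?n - l)) * cmod (herm z w) ^ (2 * l))) \<partial>\<mu>)"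
      unfolding rot circle_binomial
      by (intro nn_integral_cong arg_cong[where f = ennreal] sum.cong refl)
         (simp add: norm_mult power_mult_distrib power_mult tl mult_ac)
    also have "\<dots> = ennreal (LINT z|\<mu>. (\<Sum>l\<le>?n. (real (?n choose l))\<^sup>2 * x ^ l * (cmod (herm z u) ^ (2 * (?n - l)) * cmod (herm z w) ^ (2 * l))))"
      using x by (intro nn_integral_eq_integral continuous_integrable continuous_intros AE_I2 sum_nonneg mult_nonneg_nonneg)
        simp_all
    also have "(LINT z|\<mu>. (\<Sum>l\<le>?n. (real (?n choose l))\<^sup>2 * x ^ l * (cmod (herm z u) ^ (2 * (?n - l)) * cmod (herm z w) ^ (2 * l))))
        = (\<Sum>l\<le>?n. (real (?n choose l))\<^sup>2 * x ^ l * I l)"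
      unfolding I_def
      by (subst Bochner_Integration.integral_sum) (auto intro!: continuous_integrable continuous_intros simp del: power_Suc binomial_Suc_Suc)
    finally have e: "ennreal ((1 + x) ^ ?n * moment ?n u) = ennreal (\<Sum>l\<le>?n. (real (?n choose l))\<^sup>2 * x ^ l * I l)" .
    have "0 \<le> (1 + x) ^ ?n * moment ?n u"
      using x by (intro mult_nonneg_nonneg zero_le_power moment_nonneg) simp
    moreover have "0 \<le> (\<Sum>l\<le>?n. (real (?n choose l))\<^sup>2 * x ^ l * I l)"
      using x by (intro sum_nonneg mult_nonneg_nonneg I0 zero_le_power zero_le_power2)
    ultimately have "(1 + x) ^ ?n * moment ?n u = (\<Sum>l\<le>?n. (real (?n choose l))\<^sup>2 * x ^ l * I l)"
      using e by (simp only: ennreal_inj)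
    moreover have "(1 + x) ^ ?n = (\<Sum>l\<le>?n. real (?n choose l) * x ^ l)"
      using binomial_ring[of x 1 ?n] by (simp add: add.commute del: power_Suc binomial_Suc_Suc)
    moreover have "(\<Sum>l\<le>?n. real (?n choose l) * moment ?n u * x ^ l) = (\<Sum>l\<le>?n. real (?n choose l) * x ^ l) * moment ?n u"
      unfolding sum_distrib_right by (simp only: mult_ac)
    moreover have "(\<Sum>l\<le>?n. (real (?n choose l))\<^sup>2 * I l * x ^ l) = (\<Sum>l\<le>?n. (real (?n choose l))\<^sup>2 * x ^ l * I l)"
      by (simp only: mult_ac)
    ultimately show ?thesis by metis
  qed
  \<comment> \<open>A polynomial vanishing on the whole half-line has zero coefficients; the
    coefficient of \<open>x\<close> is the claim.\<close>
  have "\<not> finite {x. (\<Sum>l\<le>?n. ((real (?n choose l))\<^sup>2 * I l - real (?n choose l) * moment ?n u) * x ^ l) = 0}"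
  proof
    assume "finite {x. (\<Sum>l\<le>?n. ((real (?n choose l))\<^sup>2 * I l - real (?n choose l) * moment ?n u) * x ^ l) = 0}"
    moreover have "{0..} \<subseteq> {x. (\<Sum>l\<le>?n. ((real (?n choose l))\<^sup>2 * I l - real (?n choose l) * moment ?n u) * x ^ l) = 0}"
      using poly by (auto simp: left_diff_distrib sum_subtractf simp del: power_Suc binomial_Suc_Suc sum.atMost_Suc)
    ultimately have "finite {0::real..}" using finite_subset by blast
    then show False using infinite_Ici by blast
  qed
  then have "(real (?n choose 1))\<^sup>2 * I 1 - real (?n choose 1) * moment ?n u = 0"
    unfolding polyfun_finite_roots by auto
  then show ?thesis by (simp add: I_def power2_eq_square)
qed

text \<open>Expand |z|^2 in coordinates with \<open>u\<close> moved to a coordinate axis. That axis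
  contributes the full moment, each of the N - 1 others the fraction 1 / (k + 1) of it by
  \<open>mixed_moment\<close>. Knowing the left-hand integral for a particular measure turns this
  into a recursion for its moments.\<close>

lemma moment_norm_sq:
  assumes u: "norm u = 1"
  shows "(LINT z|\<mu>. cmod (herm z u) ^ (2 * k) * (norm z)\<^sup>2) = moment (Suc k) u * (real k + real CARD('n)) / real (Suc k)"
proof -
  obtain i :: 'n where True by blast
  let ?e = "\<lambda>j. axis j 1 :: complex^'n"
  have ne: "norm (?e j) = 1" for j by simp
  have he: "herm z (?e j) = z $ j" for z j
    unfolding herm_def by (simp add: axis_def if_distrib[of cnj] if_distrib[of "(*) _"] cong: if_cong)
  have J: "(LINT z|\<mu>. cmod (z $ i) ^ (2 * k) * (cmod (z $ j))\<^sup>2) = moment (Suc k) (?e i) * (if j = i then 1 else 1 / real (Suc k))" for j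
  proof (cases "j = i")
    case True
    then show ?thesis by (simp add: moment_def he power_add[symmetric] del: power_Suc)
  next
    case False
    have "herm (?e j) (?e i) = 0" using False unfolding he by (simp add: axis_def)
    from mixed_moment[OF ne ne this, of k] show ?thesis using False by (simp add: he field_simps)
  qed
  have "(LINT z|\<mu>. cmod (z $ i) ^ (2 * k) * (norm z)\<^sup>2) = (LINT z|\<mu>. (\<Sum>j\<in>UNIV. cmod (z $ i) ^ (2 * k) * (cmod (z $ j))\<^sup>2))"
    by (simp add: norm_vec_def L2_set_def sum_nonneg sum_distrib_left)
  also have "\<dots> = (\<Sum>j\<in>UNIV. LINT z|\<mu>. cmod (z $ i) ^ (2 * k) * (cmod (z $ j))\<^sup>2)"
    by (intro Bochner_Integration.integral_sum continuous_integrable continuous_intros)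
  also have "\<dots> = moment (Suc k) (?e i) * (\<Sum>j\<in>UNIV. if j = i then 1 else 1 / real (Suc k))"
    unfolding J sum_distrib_left ..
  also have "(\<Sum>j\<in>UNIV. if j = i then 1 else 1 / real (Suc k)) = (real k + real CARD('n)) / real (Suc k)"
  proof -
    have "(\<Sum>j\<in>UNIV. if j = i then 1 else 1 / real (Suc k)) = 1 + (\<Sum>j\<in>UNIV - {i}. 1 / real (Suc k))"
      by (subst sum.remove[of _ i]) (auto intro!: sum.cong)
    then show ?thesis by (simp add: field_simps of_nat_diff)
  qed
  finally have "(LINT z|\<mu>. cmod (z $ i) ^ (2 * k) * (norm z)\<^sup>2) = moment (Suc k) (?e i) * (real k + real CARD('n)) / real (Suc k)" by simp
  moreover have "(LINT z|\<mu>. cmod (herm z u) ^ (2 * k) * (norm z)\<^sup>2) = (LINT z|\<mu>. cmod (z $ i) ^ (2 * k) * (norm z)\<^sup>2)"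
  proof -
    obtain T c where T: "unitary_map T" and c: "cmod c = 1" and Tc: "T (c *s ?e i) = u"
      using unitary_map_to_unit_vector[OF u ne] .
    have "cmod (herm (T z) u) = cmod (z $ i)" for z
    proof -
      have "herm (T z) u = herm z (c *s ?e i)" using T unfolding Tc[symmetric] unitary_map_def by blast
      then show ?thesis by (simp add: herm_linear(6) he norm_mult c)
    qed
    moreover have "(LINT z|distr \<mu> borel T. cmod (herm z u) ^ (2 * k) * (norm z)\<^sup>2)
        = (LINT z|\<mu>. cmod (herm (T z) u) ^ (2 * k) * (norm (T z))\<^sup>2)"
      by (rule integral_distr)
         (use unitary_map_measurable[OF T] in \<open>auto intro!: borel_measurable_continuous_onI continuous_intros cong: measurable_cong_sets\<close>)
    ultimately show ?thesis by (simp add: invariant[OF T] unitary_map_norm[OF T])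
  qed
  ultimately show ?thesis using moment_unit[OF u ne, of "Suc k" i] by simp
qed

end

section \<open>Moments of normalized surface and volume measure\<close>

lemma borel_measurable_herm [measurable]:
  assumes "f \<in> borel_measurable M" shows "(\<lambda>x. herm (f x) u) \<in> borel_measurable M"
proof -
  have "(\<lambda>z. herm z u) \<in> borel_measurable borel"
    by (intro borel_measurable_continuous_onI continuous_intros)
  from measurable_compose[OF assms this] show ?thesis .
qed

lemma sets_ball_measure [measurable_cong, simp]: "sets ball_measure = sets borel"
  by (simp add: ball_measure_def)

lemma space_ball_measure [simp]: "space ball_measure = UNIV"
  by (simp add: ball_measure_def)

lemma sets_sphere_measure [measurable_cong, simp]: "sets sphere_measure = sets borel"
  by (simp add: sphere_measure_def)

lemma space_sphere_measure [simp]: "space sphere_measure = UNIV"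
  by (simp add: sphere_measure_def)

lemma emeasure_lborel_unit_ball:
  "emeasure lborel (ball (0::complex^'n) 1) \<noteq> 0" "emeasure lborel (ball (0::complex^'n) 1) \<noteq> \<infinity>"
  using content_ball_pos[of 1 "0::complex^'n"] emeasure_bounded_finite[OF bounded_ball, of "0::complex^'n" 1]
  by (auto simp: measure_def)

lemma emeasure_ball_measure_UNIV: "emeasure (ball_measure :: (complex^'n) measure) UNIV = 1"
  using emeasure_lborel_unit_ball[where 'n='n]
  by (simp add: ball_measure_def ennreal_divide_self less_top[symmetric])

lemma emeasure_sphere_measure_UNIV: "emeasure (sphere_measure :: (complex^'n) measure) UNIV = 1"
  unfolding sphere_measure_def
  by (subst emeasure_distr) (auto simp: emeasure_ball_measure_UNIV cong: measurable_cong_sets)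

lemma AE_sphere_measure: "AE z in (sphere_measure :: (complex^'n) measure). norm z = 1"
proof (rule AE_I[where N = "- sphere 0 1"])
  show "{z \<in> space sphere_measure. norm (z::complex^'n) \<noteq> 1} \<subseteq> - sphere 0 1" by auto
  have "emeasure (sphere_measure :: (complex^'n) measure) (UNIV - sphere 0 1) = 1 - 1"
    by (subst emeasure_Diff) (auto simp: emeasure_sphere_measure emeasure_sphere_measure_UNIV)
  then show "emeasure (sphere_measure :: (complex^'n) measure) (- sphere 0 1) = 0" by (simp add: Compl_eq_Diff_UNIV)
qed simp

lemma unitarily_invariant_ball_measure: "unitarily_invariant (ball_measure :: (complex^'n) measure)"
proof (intro unitarily_invariant.intro unitarily_invariant_axioms.intro finite_measureI)
  show "AE z in (ball_measure :: (complex^'n) measure). norm z \<le> 1"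
    using AE_ball_measure by eventually_elim simp
  fix T :: "complex^'n \<Rightarrow> complex^'n" assume T: "unitary_map T"
  have [measurable]: "T \<in> borel_measurable borel" by (rule unitary_map_measurable[OF T])
  have inv: "distr lborel borel T = lborel"
    by (rule lborel_isometry_invariant[OF unitary_map_linear[OF T] unitary_map_norm[OF T]])
  show "distr ball_measure borel T = ball_measure"
  proof (rule measure_eqI)
    fix A :: "(complex^'n) set" assume "A \<in> sets (distr ball_measure borel T)"
    then have A[measurable]: "A \<in> sets borel" by simp
    have TA: "T -` A \<in> sets borel"
      using measurable_sets[OF \<open>T \<in> borel_measurable borel\<close> A] by simp
    have "emeasure lborel (ball 0 1 \<inter> A) = emeasure (distr lborel borel T) (ball 0 1 \<inter> A)" by (simp add: inv)
    also have "\<dots> = emeasure lborel (T -` (ball 0 1 \<inter> A))"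
      by (subst emeasure_distr) auto
    also have "T -` (ball 0 1 \<inter> A) = ball 0 1 \<inter> T -` A" by (auto simp: unitary_map_norm[OF T])
    finally have "emeasure lborel (ball 0 1 \<inter> T -` A) = emeasure lborel (ball 0 1 \<inter> A)" ..
    then show "emeasure (distr ball_measure borel T) A = emeasure ball_measure A"
      using A TA by (subst emeasure_distr) (auto simp: ball_measure_def cong: measurable_cong_sets)
  qed simp
qed (simp_all add: emeasure_ball_measure_UNIV)

interpretation ball: unitarily_invariant "ball_measure :: (complex^'n) measure"
  by (rule unitarily_invariant_ball_measure)

text \<open>A unitary map commutes with z / |z|, so the cone measure inherits invariance from the
  ball.\<close>

lemma unitarily_invariant_sphere_measure: "unitarily_invariant (sphere_measure :: (complex^'n) measure)"
proof (intro unitarily_invariant.intro unitarily_invariant_axioms.intro finite_measureI)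
  show "AE z in (sphere_measure :: (complex^'n) measure). norm z \<le> 1"
    using AE_sphere_measure by eventually_elim simp
  fix T :: "complex^'n \<Rightarrow> complex^'n" assume T: "unitary_map T"
  have [measurable]: "T \<in> borel_measurable borel" by (rule unitary_map_measurable[OF T])
  have "T (z /\<^sub>R norm z) = T z /\<^sub>R norm (T z)" for z
    unfolding unitary_map_norm[OF T] by (rule linear_scale[OF unitary_map_linear[OF T]])
  then have "distr sphere_measure borel T = distr ball_measure borel ((\<lambda>z. z /\<^sub>R norm z) \<circ> T)"
    unfolding sphere_measure_def by (subst distr_distr) (auto simp: o_def cong: measurable_cong_sets)
  also have "\<dots> = distr (distr ball_measure borel T) borel (\<lambda>z. z /\<^sub>R norm z)"
    by (subst distr_distr) (auto cong: measurable_cong_sets)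
  also have "\<dots> = sphere_measure" by (simp add: ball.invariant[OF T] sphere_measure_def)
  finally show "distr sphere_measure borel T = sphere_measure" .
qed (simp_all add: emeasure_sphere_measure_UNIV)

interpretation sphere: unitarily_invariant "sphere_measure :: (complex^'n) measure"
  by (rule unitarily_invariant_sphere_measure)

text \<open>On the sphere |z| = 1, so the left side of \<open>moment_norm_sq\<close> is the k-th
  moment itself and each step multiplies by (k + 1) / (k + N).\<close>

lemma sphere_moment:
  assumes u: "norm u = 1"
  shows "sphere.moment k (u :: complex^'n) = fact k / pochhammer (real CARD('n)) k"
proof (induction k)
  case 0
  have "measure (sphere_measure :: (complex^'n) measure) UNIV = 1"
    by (simp add: measure_def emeasure_sphere_measure_UNIV)
  then show ?case by (simp add: sphere.moment_def)
next
  case (Suc k)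
  have N: "real CARD('n) > 0" by simp
  have "sphere.moment (Suc k) u * (real k + real CARD('n)) / real (Suc k)
      = (LINT z|sphere_measure. cmod (herm z u) ^ (2 * k) * (norm z)\<^sup>2)"
    by (rule sphere.moment_norm_sq[OF u, symmetric])
  also have "\<dots> = sphere.moment k u"
    unfolding sphere.moment_def
    by (rule integral_cong_AE)
       (use AE_sphere_measure in \<open>auto intro!: borel_measurable_continuous_onI continuous_intros elim: eventually_mono cong: measurable_cong_sets\<close>)
  finally have eq: "sphere.moment (Suc k) u * (real k + real CARD('n)) / real (Suc k) = sphere.moment k u" .
  have "sphere.moment (Suc k) u = sphere.moment k u * real (Suc k) / (real k + real CARD('n))"
  proof -
    have "real k + real CARD('n) > 0" using N by linarith
    then show ?thesis using eq by (simp add: eq_divide_eq divide_eq_eq)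
  qed
  then show ?case using Suc N by (simp add: pochhammer_Suc field_simps)
qed

lemma AE_lborel_norm_ne: "AE z in lborel. norm (z::'a::euclidean_space) \<noteq> r"
proof (rule AE_I')
  show "sphere 0 r \<in> null_sets (lborel :: 'a measure)"
    using negligible_sphere[of "0::'a" r] by (simp add: negligible_iff_null_sets null_sets_completion_iff)
qed auto

lemma nn_integral_ball_measure:
  fixes f :: "complex^'n \<Rightarrow> ennreal"
  assumes "f \<in> borel_measurable borel"
  shows "(\<integral>\<^sup>+z. f z \<partial>ball_measure) = (\<integral>\<^sup>+z. f z * indicator (ball 0 1) z \<partial>lborel) / emeasure lborel (ball (0::complex^'n) 1)"
  unfolding ball_measure_def using assms by (intro nn_integral_uniform_measure) auto

lemma nn_integral_lborel_scale:
  fixes f :: "complex^'n \<Rightarrow> ennreal"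
  assumes f[measurable]: "f \<in> borel_measurable borel" and r: "r > 0"
  shows "(\<integral>\<^sup>+z. f z \<partial>lborel) = ennreal (r ^ (2 * CARD('n))) * (\<integral>\<^sup>+z. f (r *\<^sub>R z) \<partial>lborel)"
proof -
  have "(\<integral>\<^sup>+z. f z \<partial>lborel) = (\<integral>\<^sup>+z. f z \<partial>density (distr lborel borel (\<lambda>x::complex^'n. 0 + r *\<^sub>R x)) (\<lambda>_. ennreal (\<bar>r\<bar> ^ DIM(complex^'n))))"
    using r by (subst lborel_affine[of r "0::complex^'n"]) auto
  also have "\<dots> = ennreal (\<bar>r\<bar> ^ DIM(complex^'n)) * (\<integral>\<^sup>+z. f (r *\<^sub>R z) \<partial>lborel)"
    by (simp add: nn_integral_density nn_integral_distr nn_integral_cmult)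
  also have "\<bar>r\<bar> ^ DIM(complex^'n) = r ^ (2 * CARD('n))"
    using r by (simp add: mult.commute)
  finally show ?thesis .
qed

text \<open>Dilation by the square root of \<open>x\<close>: the real dimension 2N contributes x^N
  and homogeneity of the integrand x^k. This is the distribution function of |z|^2 under the
  weighted measure.\<close>

lemma nn_integral_ball_scale:
  assumes x: "0 < x" "x \<le> 1"
  shows "(\<integral>\<^sup>+z. ennreal (cmod (herm z u) ^ (2 * k)) * indicator {..<x} ((norm z)\<^sup>2) \<partial>ball_measure)
    = ennreal (x ^ (k + CARD('n)) * ball.moment k (u :: complex^'n))"
proof -
  let ?h = "\<lambda>z. ennreal (cmod (herm z u) ^ (2 * k))"
  let ?V = "emeasure lborel (ball (0::complex^'n) 1)"
  define r where "r = sqrt x"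
  have r: "r > 0" "r \<le> 1" "r\<^sup>2 = x" using x by (auto simp: r_def)
  have [measurable]: "?h \<in> borel_measurable borel"
    by measurable
  have [measurable]: "ball (0::complex^'n) a \<in> sets borel" for a by simp
  have lt: "(norm z)\<^sup>2 < x \<longleftrightarrow> norm z < r" for z :: "complex^'n"
    unfolding r(3)[symmetric] using r by (auto intro: power2_less_imp_less power_strict_mono)
  have "(\<integral>\<^sup>+z. ?h z * indicator {..<x} ((norm z)\<^sup>2) \<partial>ball_measure)
      = (\<integral>\<^sup>+z. ?h z * indicator {..<x} ((norm z)\<^sup>2) * indicator (ball 0 1) z \<partial>lborel) / ?V"
    by (rule nn_integral_ball_measure) measurable
  also have "(\<integral>\<^sup>+z. ?h z * indicator {..<x} ((norm z)\<^sup>2) * indicator (ball 0 1) z \<partial>lborel)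
      = (\<integral>\<^sup>+z. ?h z * indicator (ball 0 r) z \<partial>lborel)"
    by (intro nn_integral_cong) (use r(2) in \<open>auto simp: lt split: split_indicator\<close>)
  also have "\<dots> = ennreal (r ^ (2 * CARD('n))) * (\<integral>\<^sup>+z. ?h (r *\<^sub>R z) * indicator (ball 0 r) (r *\<^sub>R z) \<partial>lborel)"
    by (rule nn_integral_lborel_scale[OF _ r(1)]) measurable
  also have "(\<integral>\<^sup>+z. ?h (r *\<^sub>R z) * indicator (ball 0 r) (r *\<^sub>R z) \<partial>lborel)
      = (\<integral>\<^sup>+z. ennreal (r ^ (2 * k)) * (?h z * indicator (ball 0 1) z) \<partial>lborel)"
    using r(1) by (intro nn_integral_cong)
      (auto simp: herm_linear(7) norm_mult power_mult_distrib ennreal_mult split: split_indicator)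
  also have "\<dots> = ennreal (r ^ (2 * k)) * (\<integral>\<^sup>+z. ?h z * indicator (ball 0 1) z \<partial>lborel)"
    by (rule nn_integral_cmult) measurable
  also have "ennreal (r ^ (2 * CARD('n))) * (ennreal (r ^ (2 * k)) * (\<integral>\<^sup>+z. ?h z * indicator (ball 0 1) z \<partial>lborel)) / ?V
      = ennreal (r ^ (2 * CARD('n))) * ennreal (r ^ (2 * k)) * ((\<integral>\<^sup>+z. ?h z * indicator (ball 0 1) z \<partial>lborel) / ?V)"
    by (simp add: mult.assoc ennreal_times_divide)
  also have "(\<integral>\<^sup>+z. ?h z * indicator (ball 0 1) z \<partial>lborel) / ?V = (\<integral>\<^sup>+z. ?h z \<partial>ball_measure)"
    by (rule nn_integral_ball_measure[symmetric]) measurable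
  also have "\<dots> = ennreal (ball.moment k u)" by (rule ball.nn_integral_moment)
  also have "ennreal (r ^ (2 * CARD('n))) * ennreal (r ^ (2 * k)) = ennreal (x ^ (k + CARD('n)))"
  proof -
    have "r ^ (2 * CARD('n)) * r ^ (2 * k) = x ^ (k + CARD('n))"
      unfolding r(3)[symmetric] power_mult[symmetric] power_add[symmetric] by (simp add: algebra_simps)
    then show ?thesis using r by (simp add: ennreal_mult[symmetric])
  qed
  also have "ennreal (x ^ (k + CARD('n))) * ennreal (ball.moment k u) = ennreal (x ^ (k + CARD('n)) * ball.moment k u)"
    using x by (simp add: ennreal_mult' ball.moment_nonneg)
  finally show ?thesis .
qed

lemma nn_integral_power_tail:
  assumes x: "0 \<le> x" "x \<le> 1" and m: "m > 0" and B: "B \<ge> 0"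
  shows "(\<integral>\<^sup>+t. ennreal (B * real m * t ^ (m - 1)) * indicator {x..1} t \<partial>lborel) = ennreal (B * (1 - x ^ m))"
proof -
  have "(\<integral>\<^sup>+t. ennreal (B * real m * t ^ (m - 1)) * indicator {x..1} t \<partial>lborel) = ennreal (B * 1 ^ m - B * x ^ m)"
  proof (rule nn_integral_FTC_Icc)
    show "\<And>t. t \<in> {x..1} \<Longrightarrow> ((\<lambda>t. B * t ^ m) has_real_derivative B * real m * t ^ (m - 1)) (at t)"
      by (auto intro!: derivative_eq_intros)
  qed (use x B in auto)
  then show ?thesis by (simp add: right_diff_distrib)
qed

text \<open>Plays the role of polar coordinates: under the density |herm z u|^(2k), the law of |z|^2
  has distribution function x^(k+N) times the moment, and hence the displayed density on
  [0, 1].\<close>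

lemma nn_integral_ball_radial:
  fixes u :: "complex^'n" and g :: "real \<Rightarrow> ennreal"
  assumes g[measurable]: "g \<in> borel_measurable borel"
  shows "(\<integral>\<^sup>+z. ennreal (cmod (herm z u) ^ (2 * k)) * g ((norm z)\<^sup>2) \<partial>ball_measure)
    = (\<integral>\<^sup>+x. ennreal (ball.moment k u * real (k + CARD('n)) * x ^ (k + CARD('n) - 1)) * indicator {0..1} x * g x \<partial>lborel)"
proof -
  let ?m = "k + CARD('n)"
  let ?B = "ball.moment k u"
  let ?h = "\<lambda>z. ennreal (cmod (herm z u) ^ (2 * k))"
  let ?d = "\<lambda>x. ennreal (?B * real ?m * x ^ (?m - 1)) * indicator {0..1} x"
  have m: "?m > 0" by simp
  have B0: "?B \<ge> 0" by (rule ball.moment_nonneg)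
  have [measurable]: "?h \<in> borel_measurable borel"
    by measurable
  define M where "M = distr (density ball_measure ?h) borel (\<lambda>z. (norm z)\<^sup>2)"
  define L where "L = density lborel ?d"
  have eM: "emeasure M A = (\<integral>\<^sup>+z. ?h z * indicator A ((norm z)\<^sup>2) \<partial>ball_measure)" if [measurable]: "A \<in> sets borel" for A
  proof -
    have "emeasure M A = (\<integral>\<^sup>+x. indicator A x \<partial>M)" by (simp add: M_def)
    also have "\<dots> = (\<integral>\<^sup>+z. ?h z * indicator A ((norm z)\<^sup>2) \<partial>ball_measure)"
      unfolding M_def by (subst nn_integral_distr) (auto simp: nn_integral_density)
    finally show ?thesis .
  qed
  have eL: "emeasure L A = (\<integral>\<^sup>+x. ?d x * indicator A x \<partial>lborel)" if [measurable]: "A \<in> sets borel" for A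
    unfolding L_def by (subst emeasure_density) auto
  have total: "(\<integral>\<^sup>+z. ?h z \<partial>ball_measure) = ennreal ?B" by (rule ball.nn_integral_moment)
  \<comment> \<open>Two Borel measures on the line with equal finite values on all upper half-lines
    coincide.\<close>
  have "M = L"
  proof (rule measure_eqI_lessThan)
    fix x :: real
    have "emeasure M {x<..} \<le> (\<integral>\<^sup>+z. ?h z \<partial>ball_measure)"
      by (subst eM) (auto intro!: nn_integral_mono split: split_indicator)
    also have "\<dots> < \<infinity>" unfolding total by simp
    finally show "emeasure M {x<..} < \<infinity>" .
    show "emeasure M {x<..} = emeasure L {x<..}"
    proof (cases "x < 0 \<or> 1 \<le> x")
      case True
      then show ?thesis
      proof
        assume x: "x < 0"
        have "emeasure M {x<..} = (\<integral>\<^sup>+z. ?h z \<partial>ball_measure)"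
        proof (subst eM)
          have "x < (norm z)\<^sup>2" for z :: "complex^'n" using x zero_le_power2 by (rule less_le_trans)
          then show "(\<integral>\<^sup>+z. ?h z * indicator {x<..} ((norm z)\<^sup>2) \<partial>ball_measure) = (\<integral>\<^sup>+z. ?h z \<partial>ball_measure)"
            by simp
        qed simp
        moreover have "emeasure L {x<..} = (\<integral>\<^sup>+t. ?d t \<partial>lborel)"
          by (subst eL) (use x in \<open>auto intro!: nn_integral_cong split: split_indicator\<close>)
        moreover have "\<dots> = ennreal (?B * (1 - 0 ^ ?m))"
          by (rule nn_integral_power_tail[OF _ _ m B0]) auto
        moreover have "(0::real) ^ ?m = 0" using m by (rule zero_power)
        ultimately show ?thesis using total by (simp only: diff_zero mult_1_right)
      next
        assume x: "1 \<le> x"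
        have "emeasure M {x<..} = (\<integral>\<^sup>+z. 0 \<partial>(ball_measure :: (complex^'n) measure))"
        proof (subst eM)
          show "(\<integral>\<^sup>+z. ?h z * indicator {x<..} ((norm z)\<^sup>2) \<partial>ball_measure) = (\<integral>\<^sup>+z. 0 \<partial>(ball_measure :: (complex^'n) measure))"
          proof (rule nn_integral_cong_AE)
            show "AE z in ball_measure. ?h z * indicator {x<..} ((norm z)\<^sup>2) = 0"
              using AE_ball_measure
            proof eventually_elim
              fix z :: "complex^'n" assume "z \<in> ball 0 1 \<and> z \<noteq> 0"
              then have "(norm z)\<^sup>2 < 1" by (simp add: abs_square_less_1)
              then show "?h z * indicator {x<..} ((norm z)\<^sup>2) = 0" using x by simp
            qed
          qed
        qed simp
        moreover have "emeasure L {x<..} = (\<integral>\<^sup>+t. 0 \<partial>(lborel :: real measure))"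
        proof (subst eL)
          show "(\<integral>\<^sup>+t. ?d t * indicator {x<..} t \<partial>lborel) = (\<integral>\<^sup>+t. 0 \<partial>(lborel :: real measure))"
            by (intro nn_integral_cong) (use x in \<open>auto split: split_indicator\<close>)
        qed simp
        ultimately show ?thesis by simp
      qed
    next
      case False
      then have x: "0 \<le> x" "x < 1" by auto
      \<comment> \<open>The scaling formula covers the strict inequality only; the difference is a
        sphere, a null set. The open ball is empty at x = 0, hence the separate case.\<close>
      have low: "(\<integral>\<^sup>+z. ?h z * indicator {..x} ((norm z)\<^sup>2) \<partial>ball_measure) = ennreal (x ^ ?m * ?B)"
      proof -
        have "AE z in (ball_measure :: (complex^'n) measure). norm z \<noteq> sqrt x"
          unfolding ball_measure_def
          by (intro AE_uniform_measureI eventually_mono[OF AE_lborel_norm_ne[of "sqrt x"]]) auto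
        then have "AE z in ball_measure. ?h z * indicator {..x} ((norm z)\<^sup>2) = ?h z * indicator {..<x} ((norm z)\<^sup>2)"
        proof eventually_elim
          fix z :: "complex^'n" assume "norm z \<noteq> sqrt x"
          then have "(norm z)\<^sup>2 \<noteq> x" by (metis norm_ge_zero real_sqrt_unique)
          then show "?h z * indicator {..x} ((norm z)\<^sup>2) = ?h z * indicator {..<x} ((norm z)\<^sup>2)"
            by (auto split: split_indicator)
        qed
        then have "(\<integral>\<^sup>+z. ?h z * indicator {..x} ((norm z)\<^sup>2) \<partial>ball_measure) = (\<integral>\<^sup>+z. ?h z * indicator {..<x} ((norm z)\<^sup>2) \<partial>ball_measure)"
          by (rule nn_integral_cong_AE)
        also have "\<dots> = ennreal (x ^ ?m * ?B)"
        proof (cases "x = 0")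
          case True
          have "(\<integral>\<^sup>+z. ?h z * indicator {..<x} ((norm z)\<^sup>2) \<partial>ball_measure) = (\<integral>\<^sup>+z. 0 \<partial>(ball_measure :: (complex^'n) measure))"
            by (intro nn_integral_cong) (auto simp: True not_less split: split_indicator)
          then show ?thesis unfolding True zero_power[OF m] by simp
        next
          case False
          then show ?thesis using x by (intro nn_integral_ball_scale) auto
        qed
        finally show ?thesis .
      qed
      have "emeasure M {x<..} + ennreal (x ^ ?m * ?B) = (\<integral>\<^sup>+z. ?h z * indicator {x<..} ((norm z)\<^sup>2) + ?h z * indicator {..x} ((norm z)\<^sup>2) \<partial>ball_measure)"
        unfolding low[symmetric] by (subst eM) (auto intro!: nn_integral_add[symmetric])
      also have "\<dots> = (\<integral>\<^sup>+z. ?h z \<partial>ball_measure)"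
        by (intro nn_integral_cong) (auto split: split_indicator)
      also have "\<dots> = ennreal (?B * (1 - x ^ ?m) + x ^ ?m * ?B)"
        unfolding total by (simp add: algebra_simps)
      also have "\<dots> = ennreal (?B * (1 - x ^ ?m)) + ennreal (x ^ ?m * ?B)"
        using x B0 by (intro ennreal_plus mult_nonneg_nonneg) (auto simp: power_le_one)
      finally have "emeasure M {x<..} = ennreal (?B * (1 - x ^ ?m))"
        by (metis ennreal_add_diff_cancel_right ennreal_neq_top)
      moreover have "emeasure L {x<..} = (\<integral>\<^sup>+t. ennreal (?B * real ?m * t ^ (?m - 1)) * indicator {x..1} t \<partial>lborel)"
      proof (subst eL)
        show "(\<integral>\<^sup>+t. ?d t * indicator {x<..} t \<partial>lborel) = (\<integral>\<^sup>+t. ennreal (?B * real ?m * t ^ (?m - 1)) * indicator {x..1} t \<partial>lborel)"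
          using x by (intro nn_integral_cong_AE eventually_mono[OF AE_lborel_singleton[of x]]) (auto split: split_indicator)
      qed simp
      ultimately show ?thesis
        using nn_integral_power_tail[OF x(1) less_imp_le[OF x(2)] m B0] by simp
    qed
  qed (simp_all add: M_def L_def)
  have "(\<integral>\<^sup>+z. ?h z * g ((norm z)\<^sup>2) \<partial>ball_measure) = (\<integral>\<^sup>+x. g x \<partial>M)"
    unfolding M_def by (subst nn_integral_distr) (auto simp: nn_integral_density)
  also have "\<dots> = (\<integral>\<^sup>+x. ?d x * g x \<partial>lborel)"
    unfolding \<open>M = L\<close> L_def by (subst nn_integral_density) auto
  finally show ?thesis .
qed

text \<open>The radial formula with g the identity multiplies the k-th moment by (k + N) / (k + N +
  1). Together with \<open>moment_norm_sq\<close> this gives the recursion factor (k + 1) / (k + N +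
  1).\<close>

lemma ball_moment:
  assumes u: "norm u = 1"
  shows "ball.moment k (u :: complex^'n) = fact k / pochhammer (real CARD('n) + 1) k"
proof (induction k)
  case 0
  have "measure (ball_measure :: (complex^'n) measure) UNIV = 1"
    by (simp add: measure_def emeasure_ball_measure_UNIV)
  then show ?case by (simp add: ball.moment_def)
next
  case (Suc k)
  let ?m = "k + CARD('n)"
  let ?B = "ball.moment k u"
  have N: "real CARD('n) > 0" by simp
  have "ennreal (ball.moment (Suc k) u * (real k + real CARD('n)) / real (Suc k))
      = ennreal (LINT z|ball_measure. cmod (herm z u) ^ (2 * k) * (norm z)\<^sup>2)"
    by (simp only: ball.moment_norm_sq[OF u])
  also have "\<dots> = (\<integral>\<^sup>+z. ennreal (cmod (herm z u) ^ (2 * k) * (norm z)\<^sup>2) \<partial>ball_measure)"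
    by (intro nn_integral_eq_integral[symmetric] ball.continuous_integrable continuous_intros) auto
  also have "\<dots> = (\<integral>\<^sup>+z. ennreal (cmod (herm z u) ^ (2 * k)) * ennreal ((norm z)\<^sup>2) \<partial>ball_measure)"
    by (simp add: ennreal_mult)
  also have "\<dots> = (\<integral>\<^sup>+x. ennreal (?B * real ?m * x ^ (?m - 1)) * indicator {0..1} x * ennreal x \<partial>lborel)"
    by (rule nn_integral_ball_radial) simp
  also have "\<dots> = (\<integral>\<^sup>+x. ennreal (?B * real ?m / real (Suc ?m) * real (Suc ?m) * x ^ (Suc ?m - 1)) * indicator {0..1} x \<partial>lborel)"
  proof (intro nn_integral_cong)
    fix x :: real
    have "x ^ (?m - 1) * x = x ^ ?m" by (metis add_gr_0 zero_less_card_finite power_minus_mult)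
    then show "ennreal (?B * real ?m * x ^ (?m - 1)) * indicator {0..1} x * ennreal x
        = ennreal (?B * real ?m / real (Suc ?m) * real (Suc ?m) * x ^ (Suc ?m - 1)) * indicator {0..1} x"
      by (auto simp: ennreal_mult''[symmetric] mult.assoc split: split_indicator)
  qed
  also have "\<dots> = ennreal (?B * real ?m / real (Suc ?m) * (1 - 0 ^ Suc ?m))"
    by (rule nn_integral_power_tail) (auto intro!: divide_nonneg_nonneg mult_nonneg_nonneg add_nonneg_nonneg ball.moment_nonneg)
  finally have "ball.moment (Suc k) u * (real k + real CARD('n)) / real (Suc k) = ?B * real ?m / real (Suc ?m)"
    by (subst (asm) ennreal_inj) (auto intro!: divide_nonneg_nonneg mult_nonneg_nonneg ball.moment_nonneg)
  then have "ball.moment (Suc k) u * real ?m / real (Suc k) = ?B * real ?m / real (Suc ?m)" by simp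
  moreover have "a = b * c / e" if "a * d / c = b * d / e" "d > 0" "c > 0" "e > 0" for a b c d e :: real
    using that by (simp add: field_simps)
  moreover have "real ?m > 0" "real (Suc k) > 0" "real (Suc ?m) > 0" using N by (simp_all add: add_nonneg_pos)
  ultimately have "ball.moment (Suc k) u = ?B * real (Suc k) / real (Suc ?m)" by blast
  also have "\<dots> = fact k * real (Suc k) / (pochhammer (real CARD('n) + 1) k * real (Suc ?m))"
    unfolding Suc by simp
  also have "\<dots> = fact (Suc k) / pochhammer (real CARD('n) + 1) (Suc k)"
    unfolding pochhammer_Suc by (simp add: algebra_simps)
  finally show ?case .
qed

section \<open>Slices and kernels in weighted spaces\<close>

definition taylor :: "(complex \<Rightarrow> complex) \<Rightarrow> nat \<Rightarrow> complex"
  where "taylor F k = (deriv ^^ k) F 0 / fact k"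

lemma taylor_sums:
  assumes "F holomorphic_on ball 0 R" "cmod x < R"
  shows "(\<lambda>k. taylor F k * x ^ k) sums F x"
  using holomorphic_power_series[OF assms(1), of x] assms(2) by (simp add: taylor_def)

lemma circle_parseval:
  fixes c :: "nat \<Rightarrow> complex"
  assumes F: "\<And>x. cmod x < R \<Longrightarrow> (\<lambda>k. c k * x ^ k) sums F x" and a: "cmod a < R"
  shows "summable (\<lambda>k. (cmod (c k))\<^sup>2 * cmod a ^ (2 * k))"
    and "(\<integral>\<^sup>+t. ennreal ((cmod (F (cis t * a)))\<^sup>2) \<partial>circle_measure)
      = ennreal (\<Sum>k. (cmod (c k))\<^sup>2 * cmod a ^ (2 * k))"
proof -
  define e where "e = (\<lambda>k. c k * a ^ k)"
  \<comment> \<open>Convergence at a larger radius gives absolute convergence on the circle through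
    \<open>a\<close>.\<close>
  obtain b where b: "cmod a < b" "b < R" using dense[OF a] by blast
  have "summable (\<lambda>k. c k * of_real b ^ k)"
    using F[of "of_real b"] b norm_ge_zero[of a] by (simp add: sums_iff)
  then have "summable (\<lambda>k. norm (c k * a ^ k))"
    by (rule powser_insidea) (use b in auto)
  then have e: "summable (\<lambda>k. cmod (e k))" by (simp add: e_def)
  have eq: "F (cis t * a) = (\<Sum>k. e k * cis (real k * t))" for t
  proof -
    have "(\<lambda>k. c k * (cis t * a) ^ k) sums F (cis t * a)"
      using a by (intro F) (simp add: norm_mult)
    moreover have "c k * (cis t * a) ^ k = e k * cis (real k * t)" for k
      by (simp add: e_def power_mult_distrib Complex.DeMoivre)
    ultimately show ?thesis by (simp add: sums_iff)
  qed
  have e2: "(cmod (e k))\<^sup>2 = (cmod (c k))\<^sup>2 * cmod a ^ (2 * k)" for k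
    by (simp add: e_def norm_mult norm_power power_mult_distrib power_mult[symmetric] mult.commute)
  show "summable (\<lambda>k. (cmod (c k))\<^sup>2 * cmod a ^ (2 * k))"
    using parseval(1)[OF e] unfolding e2 by (rule sums_summable)
  show "(\<integral>\<^sup>+t. ennreal ((cmod (F (cis t * a)))\<^sup>2) \<partial>circle_measure)
      = ennreal (\<Sum>k. (cmod (c k))\<^sup>2 * cmod a ^ (2 * k))"
    unfolding eq using parseval[OF e] unfolding e2
    by (subst nn_integral_eq_integral) (auto simp: sums_iff)
qed

lemma circle_bessel:
  assumes hol: "F holomorphic_on ball 0 R" and a: "cmod a < R"
  shows "ennreal (\<Sum>k<n. (cmod (taylor F k))\<^sup>2 * cmod a ^ (2 * k))
    \<le> (\<integral>\<^sup>+t. ennreal ((cmod (F (cis t * a)))\<^sup>2) \<partial>circle_measure)"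
proof -
  have "summable (\<lambda>k. (cmod (taylor F k))\<^sup>2 * cmod a ^ (2 * k))"
    by (rule circle_parseval(1)[OF _ a]) (rule taylor_sums[OF hol])
  moreover have "(\<integral>\<^sup>+t. ennreal ((cmod (F (cis t * a)))\<^sup>2) \<partial>circle_measure)
      = ennreal (\<Sum>k. (cmod (taylor F k))\<^sup>2 * cmod a ^ (2 * k))"
    by (rule circle_parseval(2)[OF _ a]) (rule taylor_sums[OF hol])
  ultimately show ?thesis by (auto intro!: ennreal_leI sum_le_suminf)
qed

lemma unitary_map_compose: "unitary_map S \<Longrightarrow> unitary_map T \<Longrightarrow> unitary_map (\<lambda>z. S (T z))"
  unfolding unitary_map_def by simp

lemma holomorphic_ball_measurable:
  fixes f :: "complex^'n \<Rightarrow> complex"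
  assumes f: "f \<in> holomorphic_ball" shows "f \<in> borel_measurable borel"
proof -
  have "continuous_on (ball 0 1) f"
    unfolding continuous_on_eq_continuous_within
  proof
    fix z :: "complex^'n" assume "z \<in> ball 0 1"
    then obtain D where "(f has_derivative D) (at z within ball 0 1)"
      using f unfolding holomorphic_ball_def holomorphic_vec_on_def by blast
    then show "continuous (at z within ball 0 1) f" by (rule has_derivative_continuous)
  qed
  then have "(\<lambda>z. indicator (ball 0 1) z *\<^sub>R f z) \<in> borel_measurable borel"
    by (intro borel_measurable_continuous_on_indicator) auto
  moreover have "(\<lambda>z. indicator (ball 0 1) z *\<^sub>R f z) = f"
    using f by (auto simp: holomorphic_ball_def fun_eq_iff indicator_def)
  ultimately show ?thesis by simp
qed

lemma holomorphic_ball_slice: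
  fixes u :: "complex^'n"
  assumes f: "f \<in> holomorphic_ball" and u: "norm u = 1"
  shows "(\<lambda>x. f (x *s u)) holomorphic_on ball 0 1"
  using holomorphic_on_slice[of f "ball 0 1" 0 u] f u
  by (simp add: holomorphic_ball_def norm_vector_smult)

text \<open>Rotating the part of \<open>z\<close> orthogonal to \<open>u\<close>, subharmonicity compares \<open>f\<close> with its restriction
  to the slice through \<open>u\<close>.\<close>

lemma slice_subharmonic:
  fixes u z :: "complex^'n"
  assumes f: "f \<in> holomorphic_ball" and u: "norm u = 1" and z: "norm z < 1"
  shows "ennreal ((cmod (f (herm z u *s u)))\<^sup>2)
    \<le> (\<integral>\<^sup>+t. ennreal ((cmod (f (herm z u *s u + cis t *s (z - herm z u *s u))))\<^sup>2) \<partial>circle_measure)"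
proof -
  define a where "a = herm z u *s u"
  define b where "b = z - herm z u *s u"
  have nz: "(norm z)\<^sup>2 = (cmod (herm z u))\<^sup>2 + (norm b)\<^sup>2"
    unfolding b_def by (rule norm_herm_decomp(2)[OF u])
  have ab: "(norm (a + x *s b))\<^sup>2 = (cmod (herm z u))\<^sup>2 + (cmod x * norm b)\<^sup>2" for x
  proof -
    have h: "herm (a + x *s b) u = herm z u"
      using norm_herm_decomp(1)[OF u, of z] u by (simp add: a_def b_def[symmetric] herm_linear(1,5) herm_self)
    have e: "a + x *s b - herm z u *s u = x *s b" by (simp add: a_def)
    show ?thesis using norm_herm_decomp(2)[OF u, of "a + x *s b"] unfolding h e norm_vector_smult .
  qed
  have z2: "(norm z)\<^sup>2 < 1" using z by (simp add: abs_square_less_1)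
  \<comment> \<open>The circle mean is taken on the unit circle of the parameter, so holomorphy is
    needed on a strictly larger disc. For b = 0 the map is constant and any R > 1 serves.\<close>
  obtain R where R: "R > 1" "\<And>x. cmod x < R \<Longrightarrow> norm (a + x *s b) < 1"
  proof (cases "b = 0")
    case True
    have "norm (a + x *s b) < 1" for x
      using ab[of x] nz z2 True by (simp add: abs_square_less_1)
    then show ?thesis using that[of 2] by simp
  next
    case False
    then have nb: "norm b > 0" by simp
    define R where "R = sqrt (1 - (cmod (herm z u))\<^sup>2) / norm b"
    have "norm b < sqrt (1 - (cmod (herm z u))\<^sup>2)"
      using nz z2 by (intro real_less_rsqrt) simp
    then have "R > 1" using nb by (simp add: R_def)
    moreover have "norm (a + x *s b) < 1" if x: "cmod x < R" for x
    proof -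
      have "cmod x * norm b < sqrt (1 - (cmod (herm z u))\<^sup>2)" using x nb by (simp add: R_def less_divide_eq)
      then have "(cmod x * norm b)\<^sup>2 < (sqrt (1 - (cmod (herm z u))\<^sup>2))\<^sup>2"
        by (intro power_strict_mono) auto
      also have "\<dots> = 1 - (cmod (herm z u))\<^sup>2"
        using nz z2 zero_le_power2[of "norm b"] by (intro real_sqrt_pow2) linarith
      finally have "(norm (a + x *s b))\<^sup>2 < 1" unfolding ab by simp
      then show ?thesis by (simp add: abs_square_less_1)
    qed
    ultimately show ?thesis using that by blast
  qed
  define g where "g = (\<lambda>x. f (a + x *s b))"
  have "g holomorphic_on ball 0 R"
    unfolding g_def by (rule holomorphic_on_slice) (use f R in \<open>auto simp: holomorphic_ball_def\<close>)
  \<comment> \<open>Bessel with the constant coefficient only: \<open>taylor g 0\<close> is the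
    value of \<open>f\<close> at the projection.\<close>
  from circle_bessel[OF this, of 1 1] R(1)
  have "ennreal ((cmod (taylor g 0))\<^sup>2) \<le> (\<integral>\<^sup>+t. ennreal ((cmod (g (cis t)))\<^sup>2) \<partial>circle_measure)" by simp
  then show ?thesis by (simp add: taylor_def g_def a_def b_def)
qed

context unitarily_invariant
begin

text \<open>Two averages are used. Multiplying \<open>z\<close> by phases turns the Taylor
  coefficients of the slice into a lower bound for the composition of \<open>f\<close> with the
  projection onto the slice; rotating the orthogonal component bounds that composition by
  \<open>f\<close> itself.\<close>

lemma slice_inequality:
  assumes f: "f \<in> holomorphic_ball" and ball: "AE z in \<mu>. norm z < 1" and u: "norm u = 1"
  shows "ennreal (\<Sum>k<n. (cmod (taylor (\<lambda>x. f (x *s u)) k))\<^sup>2 * moment k u) \<le> (\<integral>\<^sup>+z. ennreal ((cmod (f z))\<^sup>2) \<partial>\<mu>)"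
proof -
  let ?F = "\<lambda>x. f (x *s u)"
  have [measurable]: "f \<in> borel_measurable borel" by (rule holomorphic_ball_measurable[OF f])
  have [measurable]: "(\<lambda>z. herm z u *s u) \<in> borel_measurable borel"
    by (intro borel_measurable_continuous_onI continuous_intros)
  \<comment> \<open>The global phase undoes the opposite rotation of the \<open>u\<close>-component,
    so this unitary map rotates exactly the part orthogonal to \<open>u\<close>.\<close>
  let ?T = "\<lambda>t z. cis t *s component_rotation u (cis (- t)) z"
  have T: "?T t z = herm z u *s u + cis t *s (z - herm z u *s u)" for t z
    by (simp add: component_rotation_def vec_eq_iff algebra_simps cis_mult)
  have "ennreal (\<Sum>k<n. (cmod (taylor ?F k))\<^sup>2 * moment k u)
      = ennreal (LINT z|\<mu>. (\<Sum>k<n. (cmod (taylor ?F k))\<^sup>2 * cmod (herm z u) ^ (2 * k)))"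
    unfolding moment_def
    by (subst Bochner_Integration.integral_sum) (auto intro!: continuous_integrable continuous_intros)
  also have "\<dots> = (\<integral>\<^sup>+z. ennreal (\<Sum>k<n. (cmod (taylor ?F k))\<^sup>2 * cmod (herm z u) ^ (2 * k)) \<partial>\<mu>)"
    by (intro nn_integral_eq_integral[symmetric] continuous_integrable continuous_intros AE_I2 sum_nonneg) auto
  also have "\<dots> \<le> (\<integral>\<^sup>+z. \<integral>\<^sup>+t. ennreal ((cmod (f (herm (cis t *s z) u *s u)))\<^sup>2) \<partial>circle_measure \<partial>\<mu>)"
  proof (rule nn_integral_mono_AE)
    show "AE z in \<mu>. ennreal (\<Sum>k<n. (cmod (taylor ?F k))\<^sup>2 * cmod (herm z u) ^ (2 * k))
        \<le> (\<integral>\<^sup>+t. ennreal ((cmod (f (herm (cis t *s z) u *s u)))\<^sup>2) \<partial>circle_measure)"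
      using ball
    proof eventually_elim
      fix z :: "complex^'n" assume "norm z < 1"
      then have "cmod (herm z u) < 1" using herm_cauchy_schwarz[of z u] u by simp
      from circle_bessel[OF holomorphic_ball_slice[OF f u] this, of n]
      show "ennreal (\<Sum>k<n. (cmod (taylor ?F k))\<^sup>2 * cmod (herm z u) ^ (2 * k))
        \<le> (\<integral>\<^sup>+t. ennreal ((cmod (f (herm (cis t *s z) u *s u)))\<^sup>2) \<partial>circle_measure)"
        by (simp add: herm_linear(5))
    qed
  qed
  also have "\<dots> = (\<integral>\<^sup>+z. ennreal ((cmod (f (herm z u *s u)))\<^sup>2) \<partial>\<mu>)"
    by (rule nn_integral_average[symmetric])
       (auto intro!: unitary_map_phase continuous_intros simp: case_prod_unfold)
  also have "\<dots> \<le> (\<integral>\<^sup>+z. \<integral>\<^sup>+t. ennreal ((cmod (f (?T t z)))\<^sup>2) \<partial>circle_measure \<partial>\<mu>)"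
    unfolding T by (rule nn_integral_mono_AE) (use ball slice_subharmonic[OF f u] in \<open>auto elim: eventually_mono\<close>)
  also have "\<dots> = (\<integral>\<^sup>+z. ennreal ((cmod (f z))\<^sup>2) \<partial>\<mu>)"
  proof (rule nn_integral_average[symmetric])
    show "unitary_map (?T t)" for t
      by (rule unitary_map_compose[OF unitary_map_phase unitary_map_component_rotation]) (simp_all add: u)
    show "continuous_on UNIV (\<lambda>(z, t). ?T t z)"
      unfolding component_rotation_def case_prod_unfold by (intro continuous_intros)
  qed measurable
  finally show ?thesis .
qed

text \<open>A function of the single variable herm z a. The phase average diagonalizes its power
  series, and exchanging sum and integral leaves the sum of |c_k|^2 times the moments, whose partial
  sums are bounded by B.\<close>

lemma nn_integral_slice_function:
  fixes c :: "nat \<Rightarrow> complex"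
  assumes G: "\<And>x. cmod x < 1 \<Longrightarrow> (\<lambda>k. c k * x ^ k) sums G x" and f [measurable]: "f \<in> borel_measurable borel"
    and fG: "\<And>z. norm z < 1 \<Longrightarrow> f z = G (herm z a)"
    and ball: "AE z in \<mu>. norm z < 1" and a: "norm a < 1" and bound: "\<And>n. (\<Sum>k<n. (cmod (c k))\<^sup>2 * moment k a) \<le> B"
  shows "(\<integral>\<^sup>+z. ennreal ((cmod (f z))\<^sup>2) \<partial>\<mu>) \<le> ennreal B"
proof -
  have coeff: "(\<integral>\<^sup>+z. ennreal ((cmod (c k))\<^sup>2 * cmod (herm z a) ^ (2 * k)) \<partial>\<mu>) = ennreal ((cmod (c k))\<^sup>2 * moment k a)" for k
  proof -
    have "(\<integral>\<^sup>+z. ennreal ((cmod (c k))\<^sup>2 * cmod (herm z a) ^ (2 * k)) \<partial>\<mu>)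
        = ennreal (LINT z|\<mu>. (cmod (c k))\<^sup>2 * cmod (herm z a) ^ (2 * k))"
      by (intro nn_integral_eq_integral continuous_integrable continuous_intros) auto
    then show ?thesis by (simp add: moment_def)
  qed
  have "(\<integral>\<^sup>+z. ennreal ((cmod (f z))\<^sup>2) \<partial>\<mu>)
      = (\<integral>\<^sup>+z. \<integral>\<^sup>+t. ennreal ((cmod (f (cis t *s z)))\<^sup>2) \<partial>circle_measure \<partial>\<mu>)"
  proof (rule nn_integral_average)
    show "(\<lambda>z. ennreal ((cmod (f z))\<^sup>2)) \<in> borel_measurable borel" by measurable
  qed (auto intro!: unitary_map_phase continuous_intros simp: case_prod_unfold)
  also have "\<dots> = (\<integral>\<^sup>+z. (\<Sum>k. ennreal ((cmod (c k))\<^sup>2 * cmod (herm z a) ^ (2 * k))) \<partial>\<mu>)"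
  proof (rule nn_integral_cong_AE)
    show "AE z in \<mu>. (\<integral>\<^sup>+t. ennreal ((cmod (f (cis t *s z)))\<^sup>2) \<partial>circle_measure)
        = (\<Sum>k. ennreal ((cmod (c k))\<^sup>2 * cmod (herm z a) ^ (2 * k)))"
      using ball
    proof eventually_elim
      fix z :: "complex^'n" assume z: "norm z < 1"
      have "norm z * norm a \<le> norm a" using z by (simp add: mult_left_le_one_le)
      then have "cmod (herm z a) < 1" using herm_cauchy_schwarz[of z a] a by linarith
      moreover have "f (cis t *s z) = G (cis t * herm z a)" for t
        using z by (simp add: fG norm_vector_smult herm_linear(5))
      ultimately show "(\<integral>\<^sup>+t. ennreal ((cmod (f (cis t *s z)))\<^sup>2) \<partial>circle_measure)
        = (\<Sum>k. ennreal ((cmod (c k))\<^sup>2 * cmod (herm z a) ^ (2 * k)))"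
        using circle_parseval[where c = c and F = G, OF G] by (simp add: suminf_ennreal2)
    qed
  qed
  also have "\<dots> = (\<Sum>k. \<integral>\<^sup>+z. ennreal ((cmod (c k))\<^sup>2 * cmod (herm z a) ^ (2 * k)) \<partial>\<mu>)"
    by (rule nn_integral_suminf)
       (auto intro!: measurable_compose[OF _ measurable_ennreal] borel_measurable_continuous_onI continuous_intros cong: measurable_cong_sets)
  also have "\<dots> = (\<Sum>k. ennreal ((cmod (c k))\<^sup>2 * moment k a))" unfolding coeff ..
  also have "\<dots> \<le> ennreal B"
  proof (rule suminf_le_const)
    fix n
    have "(\<Sum>k<n. ennreal ((cmod (c k))\<^sup>2 * moment k a)) = ennreal (\<Sum>k<n. (cmod (c k))\<^sup>2 * moment k a)"
      by (rule sum_ennreal) (simp add: moment_nonneg)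
    also have "\<dots> \<le> ennreal B" by (rule ennreal_leI[OF bound])
    finally show "(\<Sum>k<n. ennreal ((cmod (c k))\<^sup>2 * moment k a)) \<le> ennreal B" .
  qed simp
  finally show ?thesis .
qed

end

section \<open>Binomial series and weighted power series\<close>

lemma gbinomial_neg: "((- b) gchoose k) * (- x) ^ k = pochhammer b k / fact k * x ^ k" for b x :: "'a::field_char_0"
proof -
  have "(- 1) ^ k * (- 1) ^ k = (1 :: 'a)" by (simp flip: power_mult_distrib)
  then have "((- 1) ^ k * pochhammer b k / fact k) * ((- 1) ^ k * x ^ k) = pochhammer b k / fact k * x ^ k"
    by (metis (no_types, opaque_lifting) mult.assoc mult.left_commute mult_1 times_divide_eq_right)
  then show ?thesis unfolding gbinomial_pochhammer power_minus[of x k] by simp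
qed

lemma binomial_kernel_complex:
  fixes x :: complex and b :: real
  assumes "cmod x < 1"
  shows "(\<lambda>k. of_real (pochhammer b k / fact k) * x ^ k) sums ((1 - x) powr (- of_real b))"
proof -
  have "(\<lambda>k. ((- of_real b) gchoose k) * (- x) ^ k) sums ((1 + - x) powr (- of_real b))"
    by (rule gen_binomial_complex) (use assms in simp)
  then show ?thesis
    unfolding gbinomial_neg by (simp flip: pochhammer_of_real)
qed

lemma binomial_kernel_real:
  fixes x b :: real
  assumes "\<bar>x\<bar> < 1"
  shows "(\<lambda>k. pochhammer b k / fact k * x ^ k) sums ((1 - x) powr (- b))"
proof -
  have "(\<lambda>k. ((- b) gchoose k) * (- x) ^ k) sums ((1 + - x) powr (- b))"
    by (rule gen_binomial_real) (use assms in simp)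
  then show ?thesis unfolding gbinomial_neg by simp
qed

lemma norm_powr_of_real: "z \<noteq> 0 \<Longrightarrow> cmod (z powr (- of_real b)) = cmod z powr (- b)"
  by (simp add: powr_def exp_minus norm_exp_eq_Re norm_inverse)

text \<open>Cauchy-Schwarz with weights (b)_k / k!, the coefficients of the binomial series: the
  second factor sums to (1 - |x|^2)^(-b).\<close>

lemma power_series_weighted_bound:
  fixes c :: "nat \<Rightarrow> complex" and b :: real
  assumes b: "b > 0" and B: "\<And>n. (\<Sum>k<n. (cmod (c k))\<^sup>2 * (fact k / pochhammer b k)) \<le> B"
    and S: "(\<lambda>k. c k * x ^ k) sums S" and x: "cmod x < 1"
  shows "(cmod S)\<^sup>2 \<le> B * (1 - (cmod x)\<^sup>2) powr (- b)"
proof -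
  let ?s = "1 - (cmod x)\<^sup>2" and ?G = "\<lambda>n. \<Sum>k<n. pochhammer b k / fact k * ((cmod x)\<^sup>2) ^ k"
  define g where "g = (\<lambda>k. pochhammer b k / fact k)"
  have g: "g k > 0" for k using b by (simp add: g_def pochhammer_pos)
  have x2: "\<bar>(cmod x)\<^sup>2\<bar> < 1" using x by (simp add: abs_square_less_1)
  have nn: "0 \<le> pochhammer b k / fact k * ((cmod x)\<^sup>2) ^ k" for k
    using less_imp_le[OF g[of k]] unfolding g_def by (intro mult_nonneg_nonneg) auto
  have B0: "B \<ge> 0" using B[of 0] by simp
  have "(cmod (\<Sum>k<n. c k * x ^ k))\<^sup>2 \<le> B * ?s powr (- b)" for n
  proof -
    have "cmod (\<Sum>k<n. c k * x ^ k) \<le> (\<Sum>k<n. (cmod (c k) / sqrt (g k)) * (sqrt (g k) * cmod x ^ k))"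
    proof -
      have "sqrt (g k) \<noteq> 0" for k using g[of k] by simp
      then show ?thesis by (intro order_trans[OF norm_sum] sum_mono) (simp add: norm_mult norm_power)
    qed
    then have "(cmod (\<Sum>k<n. c k * x ^ k))\<^sup>2 \<le> (\<Sum>k<n. (cmod (c k) / sqrt (g k)) * (sqrt (g k) * cmod x ^ k))\<^sup>2"
      by (intro power_mono) auto
    also have "\<dots> \<le> (\<Sum>k<n. (cmod (c k) / sqrt (g k))\<^sup>2) * (\<Sum>k<n. (sqrt (g k) * cmod x ^ k)\<^sup>2)"
      by (rule Cauchy_Schwarz_ineq_sum)
    also have "(\<Sum>k<n. (cmod (c k) / sqrt (g k))\<^sup>2) = (\<Sum>k<n. (cmod (c k))\<^sup>2 * (fact k / pochhammer b k))"
      using g by (intro sum.cong refl) (simp add: power_divide less_imp_le, simp add: g_def)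
    also have "(\<Sum>k<n. (sqrt (g k) * cmod x ^ k)\<^sup>2) = ?G n"
      using g by (intro sum.cong refl) (simp add: power_mult_distrib less_imp_le power_mult[symmetric] mult.commute, simp add: g_def)
    also have "(\<Sum>k<n. (cmod (c k))\<^sup>2 * (fact k / pochhammer b k)) * ?G n
        \<le> B * ?s powr (- b)"
    proof (intro mult_mono B)
      have "?G n \<le> (\<Sum>k. pochhammer b k / fact k * ((cmod x)\<^sup>2) ^ k)"
        by (intro sum_le_suminf sums_summable[OF binomial_kernel_real[OF x2]] nn) auto
      then show "?G n \<le> ?s powr (- b)"
        using binomial_kernel_real[OF x2, of b] by (simp add: sums_iff)
      show "0 \<le> ?G n"
        by (intro sum_nonneg nn)
    qed (rule B0)
    finally show ?thesis .
  qed
  moreover have "(\<lambda>n. (cmod (\<Sum>k<n. c k * x ^ k))\<^sup>2) \<longlonglongrightarrow> (cmod S)\<^sup>2"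
    using S unfolding sums_def by (intro tendsto_intros)
  ultimately show ?thesis by (intro LIMSEQ_le_const2) auto
qed

text \<open>Splitting off finitely many Taylor coefficients improves the pointwise bound to little-o.\<close>

lemma power_series_weighted_little_o:
  fixes c :: "nat \<Rightarrow> complex" and b :: real
  assumes b: "b > 0" and B: "\<And>n. (\<Sum>k<n. (cmod (c k))\<^sup>2 * (fact k / pochhammer b k)) \<le> B"
    and F: "\<And>x. cmod x < 1 \<Longrightarrow> (\<lambda>k. c k * x ^ k) sums F x"
    and l: "\<And>n. cmod (l n) < 1" "(\<lambda>n. cmod (l n)) \<longlonglongrightarrow> 1"
  shows "(\<lambda>n. cmod (F (l n)) * (1 - (cmod (l n))\<^sup>2) powr (b / 2)) \<longlonglongrightarrow> 0"
proof (rule tendstoI)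
  fix e :: real assume e: "e > 0"
  let ?w = "\<lambda>k. (cmod (c k))\<^sup>2 * (fact k / pochhammer b k)"
  have w0: "?w k \<ge> 0" for k using pochhammer_pos[OF b, of k] by simp
  have sm: "summable ?w" by (rule summableI_nonneg_bounded[OF w0 B])
  obtain m where m: "(\<Sum>k. ?w (k + m)) < (e / 2)\<^sup>2"
  proof -
    have "\<forall>\<^sub>F m in sequentially. (\<Sum>k. ?w (k + m)) < (e / 2)\<^sup>2"
      using suminf_exist_split2[OF sm] e by (intro order_tendstoD(2)) auto
    then show ?thesis using that by (auto simp: eventually_sequentially)
  qed
  \<comment> \<open>The series without its initial polynomial has weighted norm below e / 2, while C
    bounds that polynomial on the whole disc and is killed by the vanishing factor (1 -
    |x|^2)^(b/2).\<close>
  define c' where "c' = (\<lambda>k. if k < m then 0 else c k)"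
  define C where "C = (\<Sum>k<m. cmod (c k))"
  have B': "(\<Sum>k<n. (cmod (c' k))\<^sup>2 * (fact k / pochhammer b k)) \<le> (e / 2)\<^sup>2" for n
  proof -
    have s': "summable (\<lambda>k. ?w (k + m))" using sm by (rule summable_ignore_initial_segment)
    have "(\<Sum>k<n. (cmod (c' k))\<^sup>2 * (fact k / pochhammer b k)) \<le> (\<Sum>k<n + m. (cmod (c' k))\<^sup>2 * (fact k / pochhammer b k))"
      using pochhammer_pos[OF b] by (intro sum_mono2) (auto intro!: mult_nonneg_nonneg divide_nonneg_pos)
    also have "\<dots> = (\<Sum>k<m. (cmod (c' k))\<^sup>2 * (fact k / pochhammer b k)) + (\<Sum>k<n. (cmod (c' (k + m)))\<^sup>2 * (fact (k + m) / pochhammer b (k + m)))"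
    proof -
      have "(\<Sum>k<n + m. h k) = (\<Sum>k<m. h k) + (\<Sum>k<n. h (k + m))" for h :: "nat \<Rightarrow> real"
        by (induction n) simp_all
      then show ?thesis .
    qed
    also have "\<dots> = (\<Sum>k<n. ?w (k + m))" by (simp add: c'_def)
    also have "\<dots> \<le> (\<Sum>k. ?w (k + m))" by (rule sum_le_suminf[OF s']) (use w0 in auto)
    finally show ?thesis using m by linarith
  qed
  have le: "cmod (F x) * (1 - (cmod x)\<^sup>2) powr (b / 2) \<le> C * (1 - (cmod x)\<^sup>2) powr (b / 2) + e / 2" if x: "cmod x < 1" for x
  proof -
    let ?s = "1 - (cmod x)\<^sup>2"
    have s: "?s > 0" using x by (simp add: abs_square_less_1)
    let ?P = "\<Sum>k<m. c k * x ^ k"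
    have "(\<lambda>k. if k \<in> {..<m} then c k * x ^ k else 0) sums ?P" by (rule sums_If_finite_set) simp
    from sums_diff[OF F[OF x] this] have "(\<lambda>k. c' k * x ^ k) sums (F x - ?P)"
      by (rule sums_cong[THEN iffD1, rotated]) (simp add: c'_def)
    from power_series_weighted_bound[OF b B' this x]
    have "(cmod (F x - ?P))\<^sup>2 \<le> (e / 2)\<^sup>2 * ?s powr (- b)" .
    also have "\<dots> = (e / 2 * ?s powr (- b / 2))\<^sup>2"
    proof -
      have "(?s powr (- b / 2))\<^sup>2 = ?s powr (- b)"
        unfolding power2_eq_square powr_add[symmetric] by simp
      then show ?thesis unfolding power_mult_distrib by simp
    qed
    finally have "cmod (F x - ?P) \<le> e / 2 * ?s powr (- b / 2)"
      by (rule power2_le_imp_le) (use e in simp)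
    moreover have "cmod ?P \<le> C"
      unfolding C_def using x
      by (intro order_trans[OF norm_sum] sum_mono) (simp add: norm_mult norm_power mult_left_le power_le_one)
    moreover have "cmod (F x) \<le> cmod (F x - ?P) + cmod ?P" using norm_triangle_ineq[of "F x - ?P" ?P] by simp
    ultimately have "cmod (F x) \<le> C + e / 2 * ?s powr (- b / 2)" by linarith
    then have "cmod (F x) * ?s powr (b / 2) \<le> (C + e / 2 * ?s powr (- b / 2)) * ?s powr (b / 2)"
      by (intro mult_right_mono) auto
    also have "\<dots> = C * ?s powr (b / 2) + e / 2"
      using s by (simp add: algebra_simps powr_add[symmetric])
    finally show ?thesis .
  qed
  have "(\<lambda>n. (1 - (cmod (l n))\<^sup>2) powr (b / 2)) \<longlonglongrightarrow> 0"
  proof -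
    have "(\<lambda>n. (1 - (cmod (l n))\<^sup>2)) \<longlonglongrightarrow> 1 - 1\<^sup>2" by (intro tendsto_intros l)
    then have "(\<lambda>n. (1 - (cmod (l n))\<^sup>2)) \<longlonglongrightarrow> 0" by simp
    moreover have "0 \<le> 1 - (cmod (l n))\<^sup>2" for n using l(1)[of n] by (simp add: abs_square_le_1)
    ultimately have "(\<lambda>n. (1 - (cmod (l n))\<^sup>2) powr (b / 2)) \<longlonglongrightarrow> 0 powr (b / 2)"
      using b by (intro tendsto_powr') (auto intro!: always_eventually)
    then show ?thesis by simp
  qed
  then have "(\<lambda>n. C * (1 - (cmod (l n))\<^sup>2) powr (b / 2) + e / 2) \<longlonglongrightarrow> C * 0 + e / 2" by (intro tendsto_intros)
  from order_tendstoD(2)[OF this, of e] have "\<forall>\<^sub>F n in sequentially. C * (1 - (cmod (l n))\<^sup>2) powr (b / 2) + e / 2 < e"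
    using e by simp
  then show "\<forall>\<^sub>F n in sequentially. dist (cmod (F (l n)) * (1 - (cmod (l n))\<^sup>2) powr (b / 2)) 0 < e"
  proof eventually_elim
    fix n assume "C * (1 - (cmod (l n))\<^sup>2) powr (b / 2) + e / 2 < e"
    then show "dist (cmod (F (l n)) * (1 - (cmod (l n))\<^sup>2) powr (b / 2)) 0 < e"
      using le[OF l(1)[of n]] by (simp add: abs_mult)
  qed
qed

text \<open>Extended by 0 as membership in \<open>holomorphic_ball\<close> requires. For
  \<open>a\<close> in the ball, 1 - herm z a has positive real part, so the principal power is
  holomorphic.\<close>

definition ball_kernel :: "real \<Rightarrow> complex^'n \<Rightarrow> complex^'n \<Rightarrow> complex"
  where "ball_kernel b a z = (if norm z < 1 then (1 - herm z a) powr (- of_real b) else 0)"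

lemma ball_kernel_holomorphic:
  fixes a :: "complex^'n"
  assumes a: "norm a < 1"
  shows "ball_kernel b a \<in> holomorphic_ball"
proof -
  have "holomorphic_vec_on (ball_kernel b a) (ball 0 1)"
    unfolding holomorphic_vec_on_def
  proof
    fix z :: "complex^'n" assume z: "z \<in> ball 0 1"
    have "cmod (herm z a) < 1" using herm_less_1[of z a] z a by simp
    then have "Re (1 - herm z a) > 0" using complex_Re_le_cmod[of "herm z a"] by simp
    then have nr: "1 - herm z a \<notin> \<real>\<^sub>\<le>\<^sub>0" by (auto simp: complex_nonpos_Reals_iff)
    obtain E where E: "((\<lambda>x. x powr (- of_real b)) has_field_derivative E) (at (1 - herm z a))"
      using has_field_derivative_powr[OF nr] by blast
    have "((\<lambda>z. 1 - herm z a) has_derivative (\<lambda>h. - herm h a)) (at z within ball 0 1)"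
      unfolding herm_def
      by (auto intro!: derivative_eq_intros bounded_linear_imp_has_derivative[OF bounded_linear_vec_nth])
    from has_derivative_compose[OF this E[unfolded has_field_derivative_def]]
    have "((\<lambda>z. (1 - herm z a) powr (- of_real b)) has_derivative (\<lambda>h. E * (- herm h a))) (at z within ball 0 1)" .
    then have "(ball_kernel b a has_derivative (\<lambda>h. E * (- herm h a))) (at z within ball 0 1)"
      by (rule has_derivative_transform[rotated 2]) (use z in \<open>auto simp: ball_kernel_def\<close>)
    then show "\<exists>D. (ball_kernel b a has_derivative D) (at z within ball 0 1) \<and> (\<forall>c v. D (c *s v) = c * D v)"
      by (intro exI[of _ "\<lambda>h. E * (- herm h a)"]) (simp add: herm_linear(5))
  qed
  then show ?thesis by (simp add: holomorphic_ball_def ball_kernel_def)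
qed

section \<open>The essential norm estimate\<close>

lemma holomorphic_ball_diff:
  fixes f g :: "complex^'n \<Rightarrow> complex"
  assumes f: "f \<in> holomorphic_ball" and g: "g \<in> holomorphic_ball"
  shows "(\<lambda>z. f z - g z) \<in> holomorphic_ball"
  unfolding holomorphic_ball_def mem_Collect_eq holomorphic_vec_on_def
proof (intro conjI ballI allI impI)
  fix z :: "complex^'n" assume "z \<in> ball 0 1"
  then obtain D E where "(f has_derivative D) (at z within ball 0 1)" "\<forall>c v. D (c *s v) = c * D v"
    "(g has_derivative E) (at z within ball 0 1)" "\<forall>c v. E (c *s v) = c * E v"
    using f g unfolding holomorphic_ball_def holomorphic_vec_on_def by blast
  then show "\<exists>D. ((\<lambda>z. f z - g z) has_derivative D) (at z within ball 0 1) \<and> (\<forall>c v. D (c *s v) = c * D v)"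
    by (intro exI[of _ "\<lambda>h. D h - E h"]) (auto intro: has_derivative_diff simp: algebra_simps)
qed (use f g in \<open>auto simp: holomorphic_ball_def\<close>)

lemma holomorphic_ball_scale:
  fixes f :: "complex^'n \<Rightarrow> complex"
  assumes f: "f \<in> holomorphic_ball"
  shows "(\<lambda>z. a * f z) \<in> holomorphic_ball"
  unfolding holomorphic_ball_def mem_Collect_eq holomorphic_vec_on_def
proof (intro conjI ballI allI impI)
  fix z :: "complex^'n" assume "z \<in> ball 0 1"
  then obtain D where "(f has_derivative D) (at z within ball 0 1)" "\<forall>c v. D (c *s v) = c * D v"
    using f unfolding holomorphic_ball_def holomorphic_vec_on_def by blast
  then show "\<exists>D. ((\<lambda>z. a * f z) has_derivative D) (at z within ball 0 1) \<and> (\<forall>c v. D (c *s v) = c * D v)"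
    by (intro exI[of _ "\<lambda>h. a * D h"]) (auto intro: has_derivative_mult_right simp: algebra_simps)
qed (use f in \<open>auto simp: holomorphic_ball_def\<close>)

text \<open>\<open>H_bound\<close> and \<open>H_intro\<close> together say that the squared norm is
  the supremum of the squared L^2 norms over the measures \<open>M i\<close>: spheres of all radii
  below 1 for the Hardy space, one weighted measure for a Bergman space. The upper bound on moments
  serves the kernel norms, their limit serves the coefficient bound.\<close>

locale invariant_norm =
  fixes I :: "'i set" and M :: "'i \<Rightarrow> (complex^'n) measure"
    and H :: "(complex^'n \<Rightarrow> complex) set" and nrm :: "(complex^'n \<Rightarrow> complex) \<Rightarrow> real" and \<beta> :: real
  assumes \<beta>: "\<beta> > 0"
    and M: "i \<in> I \<Longrightarrow> unitarily_invariant (M i)"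
    and M_ball: "i \<in> I \<Longrightarrow> AE z in M i. norm z < 1"
    and moment_le: "i \<in> I \<Longrightarrow> norm u = 1 \<Longrightarrow> unitarily_invariant.moment (M i) k u \<le> fact k / pochhammer \<beta> k"
    and moment_lim: "\<exists>r. (\<forall>n. r n \<in> I) \<and> (\<forall>k u. norm u = 1 \<longrightarrow>
      (\<lambda>n. unitarily_invariant.moment (M (r n)) k u) \<longlonglongrightarrow> fact k / pochhammer \<beta> k)"
    and H_holomorphic: "H \<subseteq> holomorphic_ball"
    and nrm_nonneg: "f \<in> H \<Longrightarrow> 0 \<le> nrm f"
    and H_bound: "f \<in> H \<Longrightarrow> i \<in> I \<Longrightarrow> (\<integral>\<^sup>+z. ennreal ((cmod (f z))\<^sup>2) \<partial>M i) \<le> ennreal ((nrm f)\<^sup>2)"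
    and H_intro: "f \<in> holomorphic_ball \<Longrightarrow> 0 \<le> C \<Longrightarrow>
      (\<And>i. i \<in> I \<Longrightarrow> (\<integral>\<^sup>+z. ennreal ((cmod (f z))\<^sup>2) \<partial>M i) \<le> ennreal C) \<Longrightarrow> f \<in> H \<and> (nrm f)\<^sup>2 \<le> C"
begin

lemma measurable_M: "i \<in> I \<Longrightarrow> f \<in> holomorphic_ball \<Longrightarrow> f \<in> borel_measurable (M i)"
  using holomorphic_ball_measurable[of f] unitarily_invariant.sets_borel[OF M[of i]]
  by (simp cong: measurable_cong_sets)

text \<open>The constants come from |a - b|^2 being at most 2|a|^2 + 2|b|^2. The norm estimate is
  used to see that the supremum defining the operator norm is over a bounded set.\<close>

lemma H_diff:
  assumes f: "f \<in> H" and g: "g \<in> H"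
  shows "(\<lambda>z. f z - g z) \<in> H" "nrm (\<lambda>z. f z - g z) \<le> 2 * (nrm f + nrm g)"
proof -
  have ennreal_comb: "ennreal (2 * x + 2 * y) = ennreal 2 * ennreal x + ennreal 2 * ennreal y" if "x \<ge> 0" "y \<ge> 0" for x y
    using that by (simp add: ennreal_mult')
  have fg: "f \<in> holomorphic_ball" "g \<in> holomorphic_ball" using f g H_holomorphic by auto
  have "(\<integral>\<^sup>+z. ennreal ((cmod (f z - g z))\<^sup>2) \<partial>M i) \<le> ennreal (2 * (nrm f)\<^sup>2 + 2 * (nrm g)\<^sup>2)" if i: "i \<in> I" for i
  proof -
    note [measurable] = measurable_M[OF i fg(1)] measurable_M[OF i fg(2)]
    have "(\<integral>\<^sup>+z. ennreal ((cmod (f z - g z))\<^sup>2) \<partial>M i)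
        \<le> (\<integral>\<^sup>+z. ennreal 2 * ennreal ((cmod (f z))\<^sup>2) + ennreal 2 * ennreal ((cmod (g z))\<^sup>2) \<partial>M i)"
    proof (rule nn_integral_mono)
      fix z
      have "cmod (f z - g z) \<le> cmod (f z) + cmod (g z)" by (rule norm_triangle_ineq4)
      then have "(cmod (f z - g z))\<^sup>2 \<le> (cmod (f z) + cmod (g z))\<^sup>2" by (intro power_mono) auto
      also have "\<dots> \<le> 2 * (cmod (f z))\<^sup>2 + 2 * (cmod (g z))\<^sup>2"
        using zero_le_power2[of "cmod (f z) - cmod (g z)"] by (simp add: power2_eq_square algebra_simps)
      finally show "ennreal ((cmod (f z - g z))\<^sup>2) \<le> ennreal 2 * ennreal ((cmod (f z))\<^sup>2) + ennreal 2 * ennreal ((cmod (g z))\<^sup>2)"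
        unfolding ennreal_comb[OF zero_le_power2 zero_le_power2, symmetric] by (rule ennreal_leI)
    qed
    also have "\<dots> = ennreal 2 * (\<integral>\<^sup>+z. ennreal ((cmod (f z))\<^sup>2) \<partial>M i) + ennreal 2 * (\<integral>\<^sup>+z. ennreal ((cmod (g z))\<^sup>2) \<partial>M i)"
      by (subst nn_integral_add) (auto simp: nn_integral_cmult)
    also have "\<dots> \<le> ennreal 2 * ennreal ((nrm f)\<^sup>2) + ennreal 2 * ennreal ((nrm g)\<^sup>2)"
      by (intro add_mono mult_left_mono H_bound i f g) auto
    also have "\<dots> = ennreal (2 * (nrm f)\<^sup>2 + 2 * (nrm g)\<^sup>2)"
      by (rule ennreal_comb[symmetric]) auto
    finally show ?thesis .
  qed
  from H_intro[OF holomorphic_ball_diff[OF fg] _ this]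
  have *: "(\<lambda>z. f z - g z) \<in> H" "(nrm (\<lambda>z. f z - g z))\<^sup>2 \<le> 2 * (nrm f)\<^sup>2 + 2 * (nrm g)\<^sup>2" by auto
  show "(\<lambda>z. f z - g z) \<in> H" by (rule *)
  have "0 \<le> nrm f * nrm g" using nrm_nonneg f g by simp
  then have "2 * (nrm f)\<^sup>2 + 2 * (nrm g)\<^sup>2 \<le> (2 * (nrm f + nrm g))\<^sup>2"
    by (simp add: power2_eq_square algebra_simps)
  with *(2) have "(nrm (\<lambda>z. f z - g z))\<^sup>2 \<le> (2 * (nrm f + nrm g))\<^sup>2" by linarith
  then show "nrm (\<lambda>z. f z - g z) \<le> 2 * (nrm f + nrm g)"
    by (rule power2_le_imp_le) (use nrm_nonneg f g in simp)
qed

lemma H_scale: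
  assumes f: "f \<in> H"
  shows "(\<lambda>z. a * f z) \<in> H" "nrm (\<lambda>z. a * f z) \<le> cmod a * nrm f"
proof -
  have fh: "f \<in> holomorphic_ball" using f H_holomorphic by auto
  have "(\<integral>\<^sup>+z. ennreal ((cmod (a * f z))\<^sup>2) \<partial>M i) \<le> ennreal ((cmod a * nrm f)\<^sup>2)" if i: "i \<in> I" for i
  proof -
    note [measurable] = measurable_M[OF i fh]
    have "(\<integral>\<^sup>+z. ennreal ((cmod (a * f z))\<^sup>2) \<partial>M i) = (\<integral>\<^sup>+z. ennreal ((cmod a)\<^sup>2) * ennreal ((cmod (f z))\<^sup>2) \<partial>M i)"
      by (simp add: norm_mult power_mult_distrib ennreal_mult)
    also have "\<dots> = ennreal ((cmod a)\<^sup>2) * (\<integral>\<^sup>+z. ennreal ((cmod (f z))\<^sup>2) \<partial>M i)"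
      by (rule nn_integral_cmult) measurable
    also have "\<dots> \<le> ennreal ((cmod a)\<^sup>2) * ennreal ((nrm f)\<^sup>2)" by (intro mult_left_mono H_bound f i) auto
    finally show ?thesis by (simp add: power_mult_distrib ennreal_mult)
  qed
  from H_intro[OF holomorphic_ball_scale[OF fh] _ this]
  have *: "(\<lambda>z. a * f z) \<in> H" "(nrm (\<lambda>z. a * f z))\<^sup>2 \<le> (cmod a * nrm f)\<^sup>2" by auto
  show "(\<lambda>z. a * f z) \<in> H" by (rule *)
  show "nrm (\<lambda>z. a * f z) \<le> cmod a * nrm f"
    by (rule power2_le_imp_le[OF *(2)]) (use nrm_nonneg[OF f] in simp)
qed

text \<open>The slice inequality for one measure of the family carries its own moments; along the
  sequence of \<open>moment_lim\<close> these reach the sharp weights.\<close>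

lemma H_slice:
  assumes f: "f \<in> H" and u: "norm u = 1"
  shows "(\<Sum>k<n. (cmod (taylor (\<lambda>x. f (x *s u)) k))\<^sup>2 * (fact k / pochhammer \<beta> k)) \<le> (nrm f)\<^sup>2"
proof -
  obtain r where r: "\<And>n. r n \<in> I"
    "\<And>k u. norm u = 1 \<Longrightarrow> (\<lambda>n. unitarily_invariant.moment (M (r n)) k u) \<longlonglongrightarrow> fact k / pochhammer \<beta> k"
    using moment_lim by blast
  have "(\<Sum>k<n. (cmod (taylor (\<lambda>x. f (x *s u)) k))\<^sup>2 * unitarily_invariant.moment (M (r m)) k u) \<le> (nrm f)\<^sup>2" for m
  proof -
    have "ennreal (\<Sum>k<n. (cmod (taylor (\<lambda>x. f (x *s u)) k))\<^sup>2 * unitarily_invariant.moment (M (r m)) k u)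
        \<le> (\<integral>\<^sup>+z. ennreal ((cmod (f z))\<^sup>2) \<partial>M (r m))"
      using f H_holomorphic by (intro unitarily_invariant.slice_inequality[OF M[OF r(1)]] M_ball r u) auto
    also have "\<dots> \<le> ennreal ((nrm f)\<^sup>2)" by (rule H_bound[OF f r(1)])
    finally show ?thesis by (simp add: ennreal_le_iff)
  qed
  moreover have "(\<lambda>m. \<Sum>k<n. (cmod (taylor (\<lambda>x. f (x *s u)) k))\<^sup>2 * unitarily_invariant.moment (M (r m)) k u)
      \<longlonglongrightarrow> (\<Sum>k<n. (cmod (taylor (\<lambda>x. f (x *s u)) k))\<^sup>2 * (fact k / pochhammer \<beta> k))"
    by (intro tendsto_intros r u)
  ultimately show ?thesis by (intro LIMSEQ_le_const2) auto
qed

lemma H_point_evaluation: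
  assumes f: "f \<in> H" and u: "norm u = 1" and x: "cmod x < 1"
  shows "cmod (f (x *s u)) * (1 - (cmod x)\<^sup>2) powr (\<beta> / 2) \<le> nrm f"
proof -
  have fh: "f \<in> holomorphic_ball" using f H_holomorphic by auto
  let ?s = "1 - (cmod x)\<^sup>2"
  have s: "?s > 0" using x by (simp add: abs_square_less_1)
  have "(cmod (f (x *s u)))\<^sup>2 \<le> (nrm f)\<^sup>2 * ?s powr (- \<beta>)"
    by (rule power_series_weighted_bound[OF \<beta> H_slice[OF f u] taylor_sums[OF holomorphic_ball_slice[OF fh u] x] x])
  then have "(cmod (f (x *s u)))\<^sup>2 * ?s powr \<beta> \<le> (nrm f)\<^sup>2 * ?s powr (- \<beta>) * ?s powr \<beta>"
    by (intro mult_right_mono) auto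
  also have "\<dots> = (nrm f)\<^sup>2" using s by (simp add: mult.assoc powr_add[symmetric])
  also have "?s powr \<beta> = (?s powr (\<beta> / 2))\<^sup>2" unfolding power2_eq_square powr_add[symmetric] by simp
  finally have "(cmod (f (x *s u)) * ?s powr (\<beta> / 2))\<^sup>2 \<le> (nrm f)\<^sup>2" by (simp add: power_mult_distrib)
  then show ?thesis using nrm_nonneg[OF f] by (rule power2_le_imp_le)
qed

lemma H_little_o:
  assumes f: "f \<in> H" and u: "norm u = 1" and l: "\<And>n. cmod (l n) < 1" "l \<longlonglongrightarrow> 1"
  shows "(\<lambda>n. cmod (f (l n *s u)) * (1 - (cmod (l n))\<^sup>2) powr (\<beta> / 2)) \<longlonglongrightarrow> 0"
proof (rule power_series_weighted_little_o[OF \<beta> H_slice[OF f u]])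
  have "f \<in> holomorphic_ball" using f H_holomorphic by auto
  then show "\<And>x. cmod x < 1 \<Longrightarrow> (\<lambda>k. taylor (\<lambda>x. f (x *s u)) k * x ^ k) sums f (x *s u)"
    by (intro taylor_sums[OF holomorphic_ball_slice[OF _ u]])
  show "(\<lambda>n. cmod (l n)) \<longlonglongrightarrow> 1" using tendsto_norm[OF l(2)] by simp
qed (rule l)

text \<open>With g k = (\<beta>)_k / k! as kernel coefficient, the k-th moment at \<open>a\<close>
  is at most |a|^(2k) / g k. One factor g k cancels, and the remaining series is the binomial series
  at |a|^2.\<close>

lemma kernel_in_H:
  fixes a :: "complex^'n"
  assumes a: "norm a < 1"
  shows "ball_kernel \<beta> a \<in> H" "(nrm (ball_kernel \<beta> a))\<^sup>2 \<le> (1 - (norm a)\<^sup>2) powr (- \<beta>)"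
proof -
  define g where "g = (\<lambda>k. pochhammer \<beta> k / fact k)"
  have g: "g k > 0" for k using \<beta> by (simp add: g_def pochhammer_pos)
  have a2: "\<bar>(norm a)\<^sup>2\<bar> < 1" using a by (simp add: abs_square_less_1)
  have "(\<integral>\<^sup>+z. ennreal ((cmod (ball_kernel \<beta> a z))\<^sup>2) \<partial>M i) \<le> ennreal ((1 - (norm a)\<^sup>2) powr (- \<beta>))" if i: "i \<in> I" for i
  proof (rule unitarily_invariant.nn_integral_slice_function[OF M[OF i], where c = "\<lambda>k. of_real (g k)" and a = a
        and G = "\<lambda>x. (1 - x) powr (- of_real \<beta>)"])
    show "\<And>x. cmod x < 1 \<Longrightarrow> (\<lambda>k. of_real (g k) * x ^ k) sums ((1 - x) powr (- of_real \<beta>))"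
      unfolding g_def by (rule binomial_kernel_complex)
    show "ball_kernel \<beta> a \<in> borel_measurable borel"
      by (rule holomorphic_ball_measurable[OF ball_kernel_holomorphic[OF a]])
    show "AE z in M i. norm z < 1" by (rule M_ball[OF i])
    fix n
    \<comment> \<open>An arbitrary reference direction: \<open>moment_scale\<close> then covers a =
      0 as well.\<close>
    obtain u :: "complex^'n" where u: "norm u = 1" using vector_choose_size[of 1] by auto
    have "(\<Sum>k<n. (cmod (of_real (g k)))\<^sup>2 * unitarily_invariant.moment (M i) k a) \<le> (\<Sum>k<n. g k * ((norm a)\<^sup>2) ^ k)"
    proof (rule sum_mono)
      fix k
      have "unitarily_invariant.moment (M i) k a = norm a ^ (2 * k) * unitarily_invariant.moment (M i) k u"
        by (rule unitarily_invariant.moment_scale[OF M[OF i] u])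
      also have "\<dots> \<le> norm a ^ (2 * k) * (fact k / pochhammer \<beta> k)"
        by (intro mult_left_mono moment_le i u) auto
      finally have "(g k)\<^sup>2 * unitarily_invariant.moment (M i) k a \<le> (g k)\<^sup>2 * (norm a ^ (2 * k) * (fact k / pochhammer \<beta> k))"
        by (intro mult_left_mono) auto
      also have "\<dots> = g k * ((norm a)\<^sup>2) ^ k"
        using g[of k] by (simp add: g_def power_mult power2_eq_square)
      finally show "(cmod (of_real (g k)))\<^sup>2 * unitarily_invariant.moment (M i) k a \<le> g k * ((norm a)\<^sup>2) ^ k"
        using g[of k] by simp
    qed
    also have "\<dots> \<le> (\<Sum>k. g k * ((norm a)\<^sup>2) ^ k)"
    proof (rule sum_le_suminf)
      show "summable (\<lambda>k. g k * ((norm a)\<^sup>2) ^ k)"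
        unfolding g_def by (rule sums_summable[OF binomial_kernel_real[OF a2]])
    qed (use less_imp_le[OF g] in auto)
    also have "\<dots> = (1 - (norm a)\<^sup>2) powr (- \<beta>)"
      unfolding g_def by (rule sums_unique[OF binomial_kernel_real[OF a2], symmetric])
    finally show "(\<Sum>k<n. (cmod (of_real (g k)))\<^sup>2 * unitarily_invariant.moment (M i) k a) \<le> (1 - (norm a)\<^sup>2) powr (- \<beta>)" .
  qed (use a in \<open>auto simp: ball_kernel_def\<close>)
  from H_intro[OF ball_kernel_holomorphic[OF a] _ this]
  show "ball_kernel \<beta> a \<in> H" "(nrm (ball_kernel \<beta> a))\<^sup>2 \<le> (1 - (norm a)\<^sup>2) powr (- \<beta>)" by auto
qed

text \<open>Testing \<open>T - K\<close> on the normalized kernels at \<open>\<phi>(w)\<close>, with the value at \<open>w\<close>: the compact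
  part disappears in the limit, since \<open>K f\<^sub>w\<close> has norm limits, whose values at \<open>w\<close> are
  \<open>o((1 - \<bar>w\<bar>\<^sup>2)\<^sup>-\<^sup>\<beta>\<^sup>/\<^sup>2)\<close>.\<close>

lemma op_norm_lower_bound:
  fixes \<phi> \<psi> :: "complex^'n \<Rightarrow> complex^'n"
  assumes \<phi>: "analytic_self_map \<phi>" and \<psi>: "analytic_self_map \<psi>" and \<zeta>: "norm \<zeta> = 1"
    and b\<phi>: "bounded_op H nrm (comp_op \<phi>)" and b\<psi>: "bounded_op H nrm (comp_op \<psi>)"
    and K: "compact_op H nrm K"
    and d: "d > 0" and e: "e > 0"
    and l: "\<And>n. cmod (l n) < 1" "l \<longlonglongrightarrow> 1"
    and ratio: "(\<lambda>n. (1 - (norm (\<phi> (l n *s \<zeta>)))\<^sup>2) / (1 - (cmod (l n))\<^sup>2)) \<longlonglongrightarrow> d"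
    and sep: "\<forall>\<^sub>F n in sequentially. 1 - (cmod (l n))\<^sup>2 \<le> e * cmod (1 - herm (\<psi> (l n *s \<zeta>)) (\<phi> (l n *s \<zeta>)))"
  shows "d powr (- \<beta> / 2) - e powr \<beta> * d powr (\<beta> / 2) \<le> op_norm H nrm (op_diff (op_diff (comp_op \<phi>) (comp_op \<psi>)) K)"
proof -
  let ?T = "op_diff (op_diff (comp_op \<phi>) (comp_op \<psi>)) K"
  define L where "L = op_norm H nrm ?T"
  have KH: "f \<in> H \<Longrightarrow> K f \<in> H" for f using K by (auto simp: compact_op_def bounded_op_def)
  have TH: "?T f \<in> H" if f: "f \<in> H" for f
  proof -
    have "comp_op \<phi> f \<in> H" "comp_op \<psi> f \<in> H" using b\<phi> b\<psi> f by (auto simp: bounded_op_def)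
    from H_diff(1)[OF H_diff(1)[OF this] KH[OF f]] show ?thesis by (simp add: op_diff_def)
  qed
  have bounded_opD: "\<exists>C. \<forall>f\<in>H. nrm (T f) \<le> C * nrm f" if "bounded_op H nrm T" for T
    using that by (simp add: bounded_op_def)
  have bK: "bounded_op H nrm K" using K by (simp add: compact_op_def)
  obtain C1 C2 C3 where C: "\<And>f. f \<in> H \<Longrightarrow> nrm (comp_op \<phi> f) \<le> C1 * nrm f"
      "\<And>f. f \<in> H \<Longrightarrow> nrm (comp_op \<psi> f) \<le> C2 * nrm f" "\<And>f. f \<in> H \<Longrightarrow> nrm (K f) \<le> C3 * nrm f"
    using bounded_opD[OF b\<phi>] bounded_opD[OF b\<psi>] bounded_opD[OF bK] by metis
  have "nrm (?T f) \<le> 2 * (2 * (\<bar>C1\<bar> + \<bar>C2\<bar>) + \<bar>C3\<bar>)" if f: "f \<in> H" "nrm f \<le> 1" for f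
  proof -
    have c: "C * nrm f \<le> \<bar>C\<bar>" for C
      using nrm_nonneg[OF f(1)] f(2) by (metis abs_ge_self abs_ge_zero mult_left_le mult_right_mono order_trans)
    have H': "comp_op \<phi> f \<in> H" "comp_op \<psi> f \<in> H" using b\<phi> b\<psi> f by (auto simp: bounded_op_def)
    have "nrm (?T f) \<le> 2 * (nrm (\<lambda>z. comp_op \<phi> f z - comp_op \<psi> f z) + nrm (K f))"
      using H_diff(2)[OF H_diff(1)[OF H'] KH[OF f(1)]] by (simp add: op_diff_def)
    also have "\<dots> \<le> 2 * (2 * (nrm (comp_op \<phi> f) + nrm (comp_op \<psi> f)) + nrm (K f))"
      using H_diff(2)[OF H'] by simp
    also have "\<dots> \<le> 2 * (2 * (\<bar>C1\<bar> + \<bar>C2\<bar>) + \<bar>C3\<bar>)"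
      using order_trans[OF C(1)[OF f(1)] c] order_trans[OF C(2)[OF f(1)] c] order_trans[OF C(3)[OF f(1)] c] by simp
    finally show ?thesis .
  qed
  \<comment> \<open>\<open>op_norm\<close> is a real supremum and dominates its members only over a
    set bounded above.\<close>
  then have bdd: "bdd_above ((\<lambda>f. nrm (?T f)) ` {f \<in> H. nrm f \<le> 1})"
    by (intro bdd_aboveI) auto
  have TL: "nrm (?T f) \<le> L" if "f \<in> H" "nrm f \<le> 1" for f
    unfolding L_def op_norm_def by (rule cSUP_upper[OF _ bdd]) (use that in auto)
  define w where "w = (\<lambda>n. l n *s \<zeta>)"
  define a where "a = (\<lambda>n. \<phi> (w n))"
  define b where "b = (\<lambda>n. \<psi> (w n))"
  define s where "s = (\<lambda>n. 1 - (cmod (l n))\<^sup>2)"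
  define q where "q = (\<lambda>n. 1 - (norm (a n))\<^sup>2)"
  define \<rho> where "\<rho> = (\<lambda>n. q n / s n)"
  have w1: "norm (w n) < 1" for n using l by (simp add: w_def norm_vector_smult \<zeta>)
  have a1: "norm (a n) < 1" and b1: "norm (b n) < 1" for n
    using analytic_self_map_norm[OF \<phi> w1] analytic_self_map_norm[OF \<psi> w1] by (auto simp: a_def b_def)
  have s0: "s n > 0" and q0: "q n > 0" for n
    using l(1)[of n] a1[of n] by (auto simp: s_def q_def abs_square_less_1)
  have \<rho>0: "\<rho> n > 0" for n using s0 q0 by (simp add: \<rho>_def)
  have \<rho>: "\<rho> \<longlonglongrightarrow> d" using ratio by (simp add: \<rho>_def[abs_def] q_def s_def a_def w_def)
  define f where "f = (\<lambda>n z. of_real (q n powr (\<beta> / 2)) * ball_kernel \<beta> (a n) z)"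
  have fH: "f n \<in> H" for n unfolding f_def by (intro H_scale kernel_in_H a1)
  have f1: "nrm (f n) \<le> 1" for n
  proof -
    have "(nrm (ball_kernel \<beta> (a n)))\<^sup>2 \<le> q n powr (- \<beta>)"
      unfolding q_def by (rule kernel_in_H(2)[OF a1])
    also have "\<dots> = (q n powr (- \<beta> / 2))\<^sup>2" unfolding power2_eq_square powr_add[symmetric] by simp
    finally have "nrm (ball_kernel \<beta> (a n)) \<le> q n powr (- \<beta> / 2)" by (rule power2_le_imp_le) simp
    then have "q n powr (\<beta> / 2) * nrm (ball_kernel \<beta> (a n)) \<le> q n powr (\<beta> / 2) * q n powr (- \<beta> / 2)"
      by (intro mult_left_mono) auto
    also have "\<dots> = 1" using q0[of n] by (simp add: powr_add[symmetric])
    finally show ?thesis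
      using H_scale(2)[OF kernel_in_H(1)[OF a1[of n]], of "of_real (q n powr (\<beta> / 2))"] by (simp add: f_def)
  qed
  \<comment> \<open>Compactness yields one fixed limit \<open>g\<close> along a subsequence; being
    fixed, it is subject to \<open>H_little_o\<close>.\<close>
  obtain g k where g: "g \<in> H" and k: "strict_mono (k :: nat \<Rightarrow> nat)"
    and lim: "(\<lambda>n. nrm (\<lambda>z. K (f (k n)) z - g z)) \<longlonglongrightarrow> 0"
    using K fH f1 unfolding compact_op_def by blast
  have gl: "(\<lambda>n. cmod (g (w (k n))) * s (k n) powr (\<beta> / 2)) \<longlonglongrightarrow> 0"
    using LIMSEQ_subseq_LIMSEQ[OF H_little_o[OF g \<zeta> l] k] by (simp add: o_def w_def s_def)
  have \<rho>k: "(\<lambda>n. \<rho> (k n)) \<longlonglongrightarrow> d" using LIMSEQ_subseq_LIMSEQ[OF \<rho> k] by (simp add: o_def)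
  have main: "\<rho> n powr (- \<beta> / 2) - e powr \<beta> * \<rho> n powr (\<beta> / 2)
      \<le> L + nrm (\<lambda>z. K (f n) z - g z) + cmod (g (w n)) * s n powr (\<beta> / 2)"
    if sepn: "s n \<le> e * cmod (1 - herm (b n) (a n))" for n
  proof -
    let ?S = "s n powr (\<beta> / 2)"
    have ev: "cmod (h (w n)) * ?S \<le> nrm h" if "h \<in> H" for h
      using H_point_evaluation[OF that \<zeta> l(1)[of n]] by (simp add: w_def s_def)
    have "cmod (?T (f n) (w n)) * ?S \<le> L"
      using ev[OF TH[OF fH]] TL[OF fH f1] by (rule order_trans)
    moreover have "cmod (K (f n) (w n) - g (w n)) * ?S \<le> nrm (\<lambda>z. K (f n) z - g z)"
      by (rule ev[OF H_diff(1)[OF KH[OF fH] g]])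
    moreover have "?T (f n) (w n) = f n (a n) - f n (b n) - K (f n) (w n)"
      using w1[of n] by (simp add: op_diff_def comp_op_def a_def b_def)
    then have "cmod (f n (a n)) - cmod (f n (b n)) \<le> cmod (?T (f n) (w n)) + cmod (K (f n) (w n) - g (w n)) + cmod (g (w n))"
      using norm_triangle_ineq2[of "f n (a n)" "f n (b n)"]
        norm_triangle_ineq[of "?T (f n) (w n)" "K (f n) (w n)"]
        norm_triangle_ineq[of "K (f n) (w n) - g (w n)" "g (w n)"] by simp
    then have "(cmod (f n (a n)) - cmod (f n (b n))) * ?S
        \<le> (cmod (?T (f n) (w n)) + cmod (K (f n) (w n) - g (w n)) + cmod (g (w n))) * ?S"
      by (intro mult_right_mono) auto
    \<comment> \<open>The kernel at its own base point has the value q^(-\<beta>); normalization and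
      evaluation weight leave (q / s)^(-\<beta>/2).\<close>
    moreover have "cmod (f n (a n)) * ?S = \<rho> n powr (- \<beta> / 2)"
    proof -
      have "1 - herm (a n) (a n) = of_real (q n)" by (simp add: herm_self q_def)
      then have "cmod (ball_kernel \<beta> (a n) (a n)) = q n powr (- \<beta>)"
        using q0[of n] a1[of n] by (simp add: ball_kernel_def norm_powr_of_real del: of_real_power)
      then have "cmod (f n (a n)) * ?S = q n powr (\<beta> / 2) * q n powr (- \<beta>) * ?S"
        by (simp add: f_def norm_mult)
      also have "\<dots> = q n powr (- \<beta> / 2) * s n powr (\<beta> / 2)"
        by (simp add: powr_add[symmetric])
      also have "\<dots> = \<rho> n powr (- \<beta> / 2)"
        using q0[of n] s0[of n] by (simp add: \<rho>_def powr_divide powr_minus field_simps)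
      finally show ?thesis .
    qed
    \<comment> \<open>The separation hypothesis gives |1 - herm b a| at least s / e, so the kernel
      at \<open>b n\<close> is at most (e / s)^\<beta> in modulus.\<close>
    moreover have "cmod (f n (b n)) * ?S \<le> e powr \<beta> * \<rho> n powr (\<beta> / 2)"
    proof -
      let ?D = "cmod (1 - herm (b n) (a n))"
      have D: "?D > 0" using sepn s0[of n] e by (metis less_le_trans mult_zero_right not_less zero_less_norm_iff norm_zero order_less_irrefl)
      have "s n powr \<beta> \<le> (e * ?D) powr \<beta>"
        using s0[of n] sepn \<beta> by (intro powr_mono2) auto
      also have "\<dots> = e powr \<beta> * ?D powr \<beta>" using e D by (simp add: powr_mult)
      finally have "?D powr (- \<beta>) \<le> e powr \<beta> * s n powr (- \<beta>)"
        using D s0[of n] by (simp add: powr_minus field_simps)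
      then have "q n powr (\<beta> / 2) * ?D powr (- \<beta>) * ?S \<le> q n powr (\<beta> / 2) * (e powr \<beta> * s n powr (- \<beta>)) * ?S"
        by (intro mult_right_mono mult_left_mono) auto
      also have "\<dots> = e powr \<beta> * (q n powr (\<beta> / 2) * (s n powr (- \<beta>) * s n powr (\<beta> / 2)))"
        by simp
      also have "s n powr (- \<beta>) * s n powr (\<beta> / 2) = s n powr (- \<beta> / 2)" by (simp add: powr_add[symmetric])
      also have "q n powr (\<beta> / 2) * s n powr (- \<beta> / 2) = \<rho> n powr (\<beta> / 2)"
        using q0[of n] s0[of n] by (simp add: \<rho>_def powr_divide powr_minus field_simps)
      finally have "q n powr (\<beta> / 2) * ?D powr (- \<beta>) * ?S \<le> e powr \<beta> * \<rho> n powr (\<beta> / 2)" .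
      moreover have "cmod (f n (b n)) = q n powr (\<beta> / 2) * ?D powr (- \<beta>)"
        using b1[of n] D by (simp add: f_def norm_mult ball_kernel_def norm_powr_of_real)
      ultimately show ?thesis by simp
    qed
    ultimately show ?thesis by (simp add: algebra_simps)
  qed
  have sep': "\<forall>\<^sub>F n in sequentially. s (k n) \<le> e * cmod (1 - herm (b (k n)) (a (k n)))"
    using filterlim_subseq[OF k] sep unfolding filterlim_iff s_def a_def b_def w_def by blast
  have "(\<lambda>n. \<rho> (k n) powr (- \<beta> / 2) - e powr \<beta> * \<rho> (k n) powr (\<beta> / 2)) \<longlonglongrightarrow> d powr (- \<beta> / 2) - e powr \<beta> * d powr (\<beta> / 2)"
    using d by (intro tendsto_intros \<rho>k) auto
  moreover have "(\<lambda>n. L + nrm (\<lambda>z. K (f (k n)) z - g z) + cmod (g (w (k n))) * s (k n) powr (\<beta> / 2)) \<longlonglongrightarrow> L + 0 + 0"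
    by (intro tendsto_intros lim gl)
  moreover have "\<forall>\<^sub>F n in sequentially. \<rho> (k n) powr (- \<beta> / 2) - e powr \<beta> * \<rho> (k n) powr (\<beta> / 2)
      \<le> L + nrm (\<lambda>z. K (f (k n)) z - g z) + cmod (g (w (k n))) * s (k n) powr (\<beta> / 2)"
    using sep' by eventually_elim (rule main)
  ultimately have "d powr (- \<beta> / 2) - e powr \<beta> * d powr (\<beta> / 2) \<le> L + 0 + 0"
    by (intro tendsto_le[OF sequentially_bot])
  then show ?thesis by (simp add: L_def)
qed

text \<open>Makes the set of compact operators nonempty, so that the infimum in
  \<open>ess_norm\<close> inherits the lower bound. The zero function is in \<open>H\<close> as a
  multiple of a kernel.\<close>

lemma zero_compact: "compact_op H nrm (\<lambda>f z. 0)"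
proof -
  have z: "(\<lambda>z. 0) \<in> H"
    using H_scale(1)[OF kernel_in_H(1)[of 0], of 0] by simp
  have "nrm (\<lambda>z. 0) \<le> 0"
    using H_scale(2)[OF kernel_in_H(1)[of 0], of 0] by simp
  then have n0: "nrm (\<lambda>z. 0) = 0" using nrm_nonneg[OF z] by simp
  have "bounded_op H nrm (\<lambda>f z. 0)"
    unfolding bounded_op_def using z n0 by (auto intro!: exI[of _ 0])
  moreover have "\<exists>g\<in>H. \<exists>k. strict_mono (k :: nat \<Rightarrow> nat) \<and> (\<lambda>n. nrm (\<lambda>z. 0 - g z)) \<longlonglongrightarrow> 0"
    using z n0 by (intro bexI[of _ "\<lambda>z. 0"] exI[of _ id]) (auto simp: strict_mono_def)
  ultimately show ?thesis unfolding compact_op_def by blast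
qed

theorem ess_norm_lower_bound:
  fixes \<phi> \<psi> :: "complex^'n \<Rightarrow> complex^'n"
  assumes \<phi>: "analytic_self_map \<phi>" and \<psi>: "analytic_self_map \<psi>"
    and b\<phi>: "bounded_op H nrm (comp_op \<phi>)" and b\<psi>: "bounded_op H nrm (comp_op \<psi>)"
    and \<zeta>: "norm \<zeta> = 1"
    and differ: "\<not> ((\<exists>w. has_radial_limit \<phi> \<zeta> w \<and> has_radial_limit \<psi> \<zeta> w) \<and>
          dilation_coeff \<psi> \<zeta> = dilation_coeff \<phi> \<zeta>)"
  shows "(ess_norm H nrm (op_diff (comp_op \<phi>) (comp_op \<psi>)))\<^sup>2 \<ge> real_of_ereal (dilation_coeff \<phi> \<zeta>) powr (- \<beta>)"
proof (cases "\<exists>d. dilation_coeff \<phi> \<zeta> = ereal d")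
  \<comment> \<open>Here \<open>real_of_ereal\<close> takes its default value 0 and 0 to any
    \<open>powr\<close> is 0, so only nonnegativity of a square is at stake.\<close>
  case False
  then have "real_of_ereal (dilation_coeff \<phi> \<zeta>) = 0" by (cases "dilation_coeff \<phi> \<zeta>") auto
  then show ?thesis by simp
next
  case True
  then obtain d where d: "dilation_coeff \<phi> \<zeta> = ereal d" by blast
  have d0: "d > 0" using angular_data[OF \<phi> \<zeta> d] by metis
  have "d powr (- \<beta> / 2) \<le> op_norm H nrm (op_diff (op_diff (comp_op \<phi>) (comp_op \<psi>)) K)" if K: "compact_op H nrm K" for K
  proof -
    let ?L = "op_norm H nrm (op_diff (op_diff (comp_op \<phi>) (comp_op \<psi>)) K)"
    \<comment> \<open>Each \<open>e\<close> has its own boundary sequence; only the resulting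
      numerical inequality is passed to the limit.\<close>
    have le: "d powr (- \<beta> / 2) - e powr \<beta> * d powr (\<beta> / 2) \<le> ?L" if e: "e > 0" for e
      using boundary_sequence[OF \<phi> \<psi> \<zeta> d differ e] op_norm_lower_bound[OF \<phi> \<psi> \<zeta> b\<phi> b\<psi> K d0 e] by blast
    have "(\<lambda>n. inverse (real (Suc n)) powr \<beta>) \<longlonglongrightarrow> 0 powr \<beta>"
      using \<beta> by (intro tendsto_powr' tendsto_const LIMSEQ_inverse_real_of_nat) (auto intro!: always_eventually)
    then have "(\<lambda>n. d powr (- \<beta> / 2) - inverse (real (Suc n)) powr \<beta> * d powr (\<beta> / 2)) \<longlonglongrightarrow> d powr (- \<beta> / 2) - 0 * d powr (\<beta> / 2)"
      by (intro tendsto_intros) simp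
    then have "d powr (- \<beta> / 2) - 0 * d powr (\<beta> / 2) \<le> ?L"
      by (rule LIMSEQ_le_const2) (use le in auto)
    then show ?thesis by simp
  qed
  then have "d powr (- \<beta> / 2) \<le> ess_norm H nrm (op_diff (comp_op \<phi>) (comp_op \<psi>))"
    unfolding ess_norm_def using zero_compact by (intro cINF_greatest) auto
  then have "(d powr (- \<beta> / 2))\<^sup>2 \<le> (ess_norm H nrm (op_diff (comp_op \<phi>) (comp_op \<psi>)))\<^sup>2"
    by (intro power_mono) auto
  moreover have "(d powr (- \<beta> / 2))\<^sup>2 = d powr (- \<beta>)" unfolding power2_eq_square powr_add[symmetric] by simp
  ultimately show ?thesis by (simp add: d)
qed

end

section \<open>Hardy and Bergman spaces\<close>

lemma unitarily_invariant_distr_scale: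
  fixes \<mu> :: "(complex^'n) measure"
  assumes \<mu>: "unitarily_invariant \<mu>" and r: "0 < r" "r \<le> 1"
  shows "unitarily_invariant (distr \<mu> borel (\<lambda>z. r *\<^sub>R z))"
    and "norm u = 1 \<Longrightarrow> unitarily_invariant.moment (distr \<mu> borel (\<lambda>z. r *\<^sub>R z)) k u
      = r ^ (2 * k) * unitarily_invariant.moment \<mu> k u"
proof -
  let ?r = "\<lambda>z::complex^'n. r *\<^sub>R z"
  let ?D = "distr \<mu> borel ?r"
  interpret unitarily_invariant \<mu> by (rule \<mu>)
  have meas: "?r \<in> \<mu> \<rightarrow>\<^sub>M borel" by (simp cong: measurable_cong_sets)
  show inv: "unitarily_invariant ?D"
  proof (intro unitarily_invariant.intro unitarily_invariant_axioms.intro finite_measureI)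
    show "emeasure ?D (space ?D) \<noteq> \<infinity>"
      by (subst emeasure_distr[OF meas]) auto
    show "AE z in ?D. norm z \<le> 1"
    proof (subst AE_distr_iff[OF meas])
      show "AE z in \<mu>. norm (r *\<^sub>R z) \<le> 1"
        using AE_cball by eventually_elim (use r in \<open>simp add: mult_le_one\<close>)
    qed simp
    fix T :: "complex^'n \<Rightarrow> complex^'n" assume T: "unitary_map T"
    have [measurable]: "T \<in> borel_measurable borel" by (rule unitary_map_measurable[OF T])
    have "T (r *\<^sub>R z) = r *\<^sub>R T z" for z by (rule linear_scale[OF unitary_map_linear[OF T]])
    then have "distr ?D borel T = distr \<mu> borel (?r \<circ> T)"
      by (subst distr_distr) (auto simp: o_def cong: measurable_cong_sets)
    also have "\<dots> = distr (distr \<mu> borel T) borel ?r"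
      by (subst distr_distr) (auto cong: measurable_cong_sets)
    finally show "distr ?D borel T = ?D"
      by (simp add: invariant[OF T])
  qed simp
  show "unitarily_invariant.moment ?D k u = r ^ (2 * k) * unitarily_invariant.moment \<mu> k u"
    if u: "norm u = 1"
    unfolding unitarily_invariant.moment_def[OF inv] moment_def
    using r by (subst integral_distr[OF meas]) (auto simp: herm_linear(7) norm_mult power_mult_distrib)
qed

text \<open>\<open>hardy_mean\<close> is a Bochner integral, with value 0 on non-integrable
  functions, so integrability is required before it can be identified with a nonnegative integral.
  It follows from boundedness on a smaller closed ball.\<close>

lemma holomorphic_ball_integrable_sphere:
  fixes f :: "complex^'n \<Rightarrow> complex"
  assumes f: "f \<in> holomorphic_ball" and r: "0 < r" "r < 1"
  shows "integrable sphere_measure (\<lambda>z. (cmod (f (r *\<^sub>R z)))\<^sup>2)"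
proof -
  have [measurable]: "f \<in> borel_measurable borel" by (rule holomorphic_ball_measurable[OF f])
  have "continuous_on (cball 0 r) f"
    unfolding continuous_on_eq_continuous_within
  proof
    fix z :: "complex^'n" assume z: "z \<in> cball 0 r"
    then have "z \<in> ball 0 1" using r by simp
    then obtain D where "(f has_derivative D) (at z within ball 0 1)"
      using f unfolding holomorphic_ball_def holomorphic_vec_on_def by blast
    then have "continuous (at z within ball 0 1) f" by (rule has_derivative_continuous)
    then show "continuous (at z within cball 0 r) f"
      by (rule continuous_within_subset) (use r in auto)
  qed
  then have "compact (f ` cball 0 r)" by (intro compact_continuous_image) auto
  then obtain B where B: "\<And>x. x \<in> f ` cball 0 r \<Longrightarrow> norm x \<le> B"
    using compact_imp_bounded bounded_iff by metis
  show ?thesis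
  proof (rule sphere.integrable_bounded[where B = "B\<^sup>2"])
    fix z :: "complex^'n" assume "norm z \<le> 1"
    then have "r * norm z \<le> r" using r by (simp add: mult_left_le)
    then have "cmod (f (r *\<^sub>R z)) \<le> B" using r by (intro B imageI) simp
    then show "\<bar>(cmod (f (r *\<^sub>R z)))\<^sup>2\<bar> \<le> B\<^sup>2" by (simp add: power_mono)
  qed measurable
qed

lemma nn_integral_hardy_mean:
  fixes f :: "complex^'n \<Rightarrow> complex"
  assumes f: "f \<in> holomorphic_ball" and r: "0 < r" "r < 1"
  shows "(\<integral>\<^sup>+z. ennreal ((cmod (f z))\<^sup>2) \<partial>distr sphere_measure borel (\<lambda>z. r *\<^sub>R z)) = ennreal (hardy_mean f r)"
proof -
  have [measurable]: "f \<in> borel_measurable borel" by (rule holomorphic_ball_measurable[OF f])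
  have meas: "(\<lambda>z::complex^'n. r *\<^sub>R z) \<in> sphere_measure \<rightarrow>\<^sub>M borel" by (simp cong: measurable_cong_sets)
  have "(\<integral>\<^sup>+z. ennreal ((cmod (f z))\<^sup>2) \<partial>distr sphere_measure borel (\<lambda>z. r *\<^sub>R z))
      = (\<integral>\<^sup>+z. ennreal ((cmod (f (r *\<^sub>R z)))\<^sup>2) \<partial>sphere_measure)"
    by (rule nn_integral_distr[OF meas]) measurable
  also have "\<dots> = ennreal (hardy_mean f r)"
    unfolding hardy_mean_def by (intro nn_integral_eq_integral holomorphic_ball_integrable_sphere f r) auto
  finally show ?thesis .
qed

lemma hardy_mean_nonneg: "hardy_mean f r \<ge> 0"
  unfolding hardy_mean_def by (rule Bochner_Integration.integral_nonneg) simp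

text \<open>On the sphere of radius r the moments are r^(2k) times those of the unit sphere: below
  them for r < 1, and tending to them as r tends to 1.\<close>

lemma hardy_invariant_norm:
  "invariant_norm {0<..<1} (\<lambda>r. distr sphere_measure borel (\<lambda>z::complex^'n. r *\<^sub>R z)) hardy_space hardy_norm (real CARD('n))"
proof (rule invariant_norm.intro)
  let ?M = "\<lambda>r. distr sphere_measure borel (\<lambda>z::complex^'n. r *\<^sub>R z)"
  let ?m = "\<lambda>k. fact k / pochhammer (real CARD('n)) k"
  show "real CARD('n) > 0" by simp
  have mk: "?m k > 0" for k by (intro divide_pos_pos pochhammer_pos) auto
  have mom: "unitarily_invariant.moment (?M r) k u = r ^ (2 * k) * ?m k" if "r \<in> {0<..<1}" "norm u = 1" for r k u
    using unitarily_invariant_distr_scale(2)[OF unitarily_invariant_sphere_measure, of r u k] sphere_moment[of u k] that by simp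
  show "unitarily_invariant (?M r)" if "r \<in> {0<..<1}" for r
    using that by (intro unitarily_invariant_distr_scale unitarily_invariant_sphere_measure) auto
  show "AE z in ?M r. norm z < 1" if r: "r \<in> {0<..<1}" for r
  proof (subst AE_distr_iff)
    show "AE z in sphere_measure. norm (r *\<^sub>R (z::complex^'n)) < 1"
      using AE_sphere_measure by eventually_elim (use r in simp)
  qed (simp_all cong: measurable_cong_sets)
  show "unitarily_invariant.moment (?M r) k u \<le> ?m k" if "r \<in> {0<..<1}" "norm u = 1" for r k u
    unfolding mom[OF that] using that mk[of k] by (intro mult_left_le_one_le) (auto intro: power_le_one)
  show "\<exists>r. (\<forall>n. r n \<in> {0<..<1}) \<and> (\<forall>k u. norm u = 1 \<longrightarrow> (\<lambda>n. unitarily_invariant.moment (?M (r n)) k u) \<longlonglongrightarrow> ?m k)"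
  proof (intro exI conjI allI impI)
    \<comment> \<open>The double successor keeps the initial radius at 1/2, inside the open
      interval.\<close>
    let ?r = "\<lambda>n. 1 - inverse (real (Suc (Suc n)))"
    show in01: "?r n \<in> {0<..<1}" for n by (simp add: inverse_less_1_iff)
    fix k and u :: "complex^'n" assume u: "norm u = 1"
    have "(\<lambda>n. inverse (real (Suc (Suc n)))) \<longlonglongrightarrow> 0"
      by (rule LIMSEQ_Suc[OF LIMSEQ_inverse_real_of_nat])
    then have "(\<lambda>n. ?r n ^ (2 * k) * ?m k) \<longlonglongrightarrow> (1 - 0) ^ (2 * k) * ?m k" by (intro tendsto_intros)
    then show "(\<lambda>n. unitarily_invariant.moment (?M (?r n)) k u) \<longlonglongrightarrow> ?m k"
      unfolding mom[OF in01 u] by simp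
  qed
  show "hardy_space \<subseteq> (holomorphic_ball :: (complex^'n \<Rightarrow> complex) set)" by (auto simp: hardy_space_def)
  have half: "(1/2::real) \<in> {0<..<1}" by simp
  have sq: "(hardy_norm f)\<^sup>2 = (SUP r\<in>{0<..<1}. hardy_mean f r)" "0 \<le> hardy_norm f" if f: "f \<in> hardy_space" for f :: "complex^'n \<Rightarrow> complex"
  proof -
    have "0 \<le> hardy_mean f (1/2)" by (rule hardy_mean_nonneg)
    also have "\<dots> \<le> (SUP r\<in>{0<..<1}. hardy_mean f r)"
      using f half by (intro cSUP_upper) (auto simp: hardy_space_def)
    finally show "(hardy_norm f)\<^sup>2 = (SUP r\<in>{0<..<1}. hardy_mean f r)" "0 \<le> hardy_norm f"
      by (simp_all add: hardy_norm_def)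
  qed
  show "0 \<le> hardy_norm f" if "f \<in> hardy_space" for f :: "complex^'n \<Rightarrow> complex" by (rule sq(2)[OF that])
  show "(\<integral>\<^sup>+z. ennreal ((cmod (f z))\<^sup>2) \<partial>?M r) \<le> ennreal ((hardy_norm f)\<^sup>2)"
    if f: "f \<in> hardy_space" and r: "r \<in> {0<..<1}" for f r
  proof -
    have "hardy_mean f r \<le> (SUP r\<in>{0<..<1}. hardy_mean f r)"
      using f r by (intro cSUP_upper) (auto simp: hardy_space_def)
    then show ?thesis
      using f r by (subst nn_integral_hardy_mean) (auto simp: sq(1) hardy_space_def intro: ennreal_leI)
  qed
  show "f \<in> hardy_space \<and> (hardy_norm f)\<^sup>2 \<le> C"
    if f: "f \<in> holomorphic_ball" and C: "0 \<le> C"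
      and le: "\<And>r. r \<in> {0<..<1} \<Longrightarrow> (\<integral>\<^sup>+z. ennreal ((cmod (f z))\<^sup>2) \<partial>?M r) \<le> ennreal C" for f C
  proof -
    have "hardy_mean f r \<le> C" if r: "r \<in> {0<..<1}" for r
      using le[OF r] r C by (subst (asm) nn_integral_hardy_mean[OF f]) (auto simp: ennreal_le_iff)
    then have "f \<in> hardy_space" "(SUP r\<in>{0<..<1}. hardy_mean f r) \<le> C"
      using f half by (auto simp: hardy_space_def intro!: bdd_aboveI[of _ C] cSUP_least)
    then show ?thesis by (simp add: sq(1))
  qed
qed

lemma bergman_weight_nonneg: "s > -1 \<Longrightarrow> bergman_weight s (z :: complex^'n) \<ge> 0"
  unfolding bergman_weight_def
  by (intro mult_nonneg_nonneg divide_nonneg_nonneg Gamma_real_nonneg less_imp_le[OF Gamma_real_pos]) auto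

lemma bergman_weight_measurable [measurable]: "bergman_weight s \<in> borel_measurable (borel :: (complex^'n) measure)"
  unfolding bergman_weight_def[abs_def] by measurable

definition bergman_measure :: "real \<Rightarrow> (complex^'n) measure"
  where "bergman_measure s = density ball_measure (\<lambda>z. ennreal (bergman_weight s z))"

lemma sets_bergman_measure [simp, measurable_cong]: "sets (bergman_measure s) = sets borel"
  by (simp add: bergman_measure_def)

lemma space_bergman_measure [simp]: "space (bergman_measure s) = UNIV"
  by (simp add: bergman_measure_def)

lemma nn_integral_bergman_measure:
  "f \<in> borel_measurable borel \<Longrightarrow>
    (\<integral>\<^sup>+z. f z \<partial>bergman_measure s) = (\<integral>\<^sup>+z. ennreal (bergman_weight s z) * f (z :: complex^'n) \<partial>ball_measure)"
  unfolding bergman_measure_def by (rule nn_integral_density) (auto cong: measurable_cong_sets)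

text \<open>The radial formula leads to a Beta integral with parameters k + N and s + 1. Its Gamma
  factors combine with the constant of the weight into a Pochhammer symbol.\<close>

lemma nn_integral_bergman_moment:
  fixes u :: "complex^'n"
  assumes s: "s > -1" and u: "norm u = 1"
  shows "(\<integral>\<^sup>+z. ennreal (cmod (herm z u) ^ (2 * k)) \<partial>bergman_measure s)
    = ennreal (fact k / pochhammer (real CARD('n) + s + 1) k)"
proof -
  let ?N = "real CARD('n)"
  let ?m = "k + CARD('n)"
  let ?B = "ball.moment k u"
  define c where "c = Gamma (?N + s + 1) / (Gamma (?N + 1) * Gamma (s + 1))"
  have N: "?N > 0" by simp
  have m: "real ?m > 0" by (simp add: add_nonneg_pos)
  have c0: "c \<ge> 0" unfolding c_def using s N
    by (intro divide_nonneg_nonneg mult_nonneg_nonneg less_imp_le[OF Gamma_real_pos]) auto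
  have B0: "?B \<ge> 0" by (rule ball.moment_nonneg)
  have "(\<integral>\<^sup>+z. ennreal (cmod (herm z u) ^ (2 * k)) \<partial>bergman_measure s)
      = (\<integral>\<^sup>+z. ennreal (cmod (herm z u) ^ (2 * k)) * ennreal (c * (1 - (norm z)\<^sup>2) powr s) \<partial>ball_measure)"
    by (subst nn_integral_bergman_measure) (auto simp: bergman_weight_def c_def mult.commute)
  also have "\<dots> = (\<integral>\<^sup>+x. ennreal (?B * real ?m * x ^ (?m - 1)) * indicator {0..1} x * ennreal (c * (1 - x) powr s) \<partial>lborel)"
    by (rule nn_integral_ball_radial[where g = "\<lambda>x. ennreal (c * (1 - x) powr s)"]) measurable
  also have "\<dots> = (\<integral>\<^sup>+x. ennreal (?B * real ?m * c) * ennreal (indicator {0..1} x * (x powr (real ?m - 1) * (1 - x) powr (s + 1 - 1))) \<partial>lborel)"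
  \<comment> \<open>The point 0 is excluded because \<open>0 ^ 0\<close> is 1 while
    \<open>0 powr 0\<close> is 0, and the exponent vanishes when k + N = 1.\<close>
  proof (rule nn_integral_cong_AE, rule eventually_mono[OF AE_lborel_singleton[of 0]])
    fix x :: real assume x: "x \<noteq> 0"
    show "ennreal (?B * real ?m * x ^ (?m - 1)) * indicator {0..1} x * ennreal (c * (1 - x) powr s)
        = ennreal (?B * real ?m * c) * ennreal (indicator {0..1} x * (x powr (real ?m - 1) * (1 - x) powr (s + 1 - 1)))"
    proof (cases "x \<in> {0..1}")
      case True
      have "real (?m - 1) = real ?m - 1" by (simp add: of_nat_diff Suc_leI)
      then have "x ^ (?m - 1) = x powr (real ?m - 1)"
        using True x powr_realpow[of x "?m - 1"] by simp
      then show ?thesis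
        using True B0 c0 by (simp add: ennreal_mult[symmetric] mult_ac del: of_nat_add)
    qed simp
  qed
  also have "\<dots> = ennreal (?B * real ?m * c) * (\<integral>\<^sup>+x. ennreal (indicator {0..1} x * (x powr (real ?m - 1) * (1 - x) powr (s + 1 - 1))) \<partial>lborel)"
    by (rule nn_integral_cmult) measurable
  also have "(\<integral>\<^sup>+x. ennreal (indicator {0..1} x * (x powr (real ?m - 1) * (1 - x) powr (s + 1 - 1))) \<partial>lborel) = ennreal (Beta (real ?m) (s + 1))"
    by (rule nn_integral_has_integral_lebesgue[OF _ has_integral_Beta_real]) (use m s in auto)
  also have "ennreal (?B * real ?m * c) * ennreal (Beta (real ?m) (s + 1)) = ennreal (?B * real ?m * c * Beta (real ?m) (s + 1))"
    using B0 c0 by (intro ennreal_mult'[symmetric] mult_nonneg_nonneg) auto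
  also have "?B * real ?m * c * Beta (real ?m) (s + 1) = fact k / pochhammer (?N + s + 1) k"
  proof -
    have p1: "pochhammer (?N + 1) k = Gamma (real ?m + 1) / Gamma (?N + 1)"
      by (subst pochhammer_Gamma) (auto simp: add_ac nonpos_Ints_def)
    have p2: "pochhammer (?N + s + 1) k = Gamma (real ?m + (s + 1)) / Gamma (?N + s + 1)"
      using s N by (subst pochhammer_Gamma) (auto simp: add_ac dest: nonpos_Ints_nonpos)
    have G: "Gamma (real ?m + 1) = real ?m * Gamma (real ?m)"
      using Gamma_plus1[of "real ?m"] m by (metis add.commute nonpos_Ints_nonpos not_less)
    have pos: "Gamma (real ?m) > 0" "Gamma (?N + 1) > 0" "Gamma (s + 1) > 0" "Gamma (?N + s + 1) > 0" "Gamma (real ?m + (s + 1)) > 0"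
      using m s N by (auto intro!: Gamma_real_pos simp del: of_nat_add)
    have alg: "F / ((n * g) / a) * n * (b / (a * e)) * (g * e / q) = F / (q / b)"
      if "n > 0" "g > 0" "a > 0" "b > 0" "e > 0" "q > 0" for F n g a b e q :: real
      using that by (simp add: field_simps)
    show ?thesis
      unfolding ball_moment[OF u] p1 p2 G c_def Beta_def
      by (rule alg[OF m pos(1,2,4,3,5)])
  qed
  finally show ?thesis .
qed

lemma unitarily_invariant_bergman_measure:
  assumes s: "s > -1"
  shows "unitarily_invariant (bergman_measure s :: (complex^'n) measure)"
proof (intro unitarily_invariant.intro unitarily_invariant_axioms.intro finite_measureI)
  obtain u :: "complex^'n" where u: "norm u = 1" using vector_choose_size[of 1] by auto
  \<comment> \<open>Total mass 1 is the moment for k = 0.\<close>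
  have "emeasure (bergman_measure s :: (complex^'n) measure) UNIV = 1"
    using nn_integral_bergman_moment[OF s u, of 0] by simp
  then show "emeasure (bergman_measure s :: (complex^'n) measure) (space (bergman_measure s)) \<noteq> \<infinity>" by simp
  show "AE z in (bergman_measure s :: (complex^'n) measure). norm z \<le> 1"
    unfolding bergman_measure_def
    by (subst AE_density) (use AE_ball_measure in \<open>auto elim: eventually_mono cong: measurable_cong_sets\<close>)
  fix T :: "complex^'n \<Rightarrow> complex^'n" assume T: "unitary_map T"
  have [measurable]: "T \<in> borel_measurable borel" by (rule unitary_map_measurable[OF T])
  show "distr (bergman_measure s) borel T = bergman_measure s"
  proof (rule measure_eqI)
    fix A :: "(complex^'n) set" assume "A \<in> sets (distr (bergman_measure s) borel T)"
    then have A[measurable]: "A \<in> sets borel" by simp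
    have "emeasure (distr (bergman_measure s) borel T) A = (\<integral>\<^sup>+z. indicator A (T z) \<partial>bergman_measure s)"
    proof -
      have "emeasure (distr (bergman_measure s) borel T) A = (\<integral>\<^sup>+z. indicator A z \<partial>distr (bergman_measure s) borel T)"
        by simp
      also have "\<dots> = (\<integral>\<^sup>+z. indicator A (T z) \<partial>bergman_measure s)"
        by (rule nn_integral_distr) (auto cong: measurable_cong_sets)
      finally show ?thesis .
    qed
    also have "\<dots> = (\<integral>\<^sup>+z. ennreal (bergman_weight s (T z)) * indicator A (T z) \<partial>ball_measure)"
      by (subst nn_integral_bergman_measure) (auto simp: bergman_weight_def unitary_map_norm[OF T])
    also have "\<dots> = (\<integral>\<^sup>+z. ennreal (bergman_weight s z) * indicator A z \<partial>ball_measure)"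
      by (rule ball.nn_integral_unitary[OF _ T, where h = "\<lambda>z. ennreal (bergman_weight s z) * indicator A z"]) measurable
    also have "\<dots> = (\<integral>\<^sup>+z. indicator A z \<partial>bergman_measure s)"
      by (subst nn_integral_bergman_measure) auto
    finally show "emeasure (distr (bergman_measure s) borel T) A = emeasure (bergman_measure s) A" by simp
  qed simp
qed simp

text \<open>A one-element family suffices: its moments already equal the required weights, so any
  sequence of indices realizes the limit.\<close>

lemma bergman_invariant_norm:
  assumes s: "s > -1"
  shows "invariant_norm {()} (\<lambda>_. bergman_measure s :: (complex^'n) measure) (bergman_space s) (bergman_norm s) (real CARD('n) + s + 1)"
proof (rule invariant_norm.intro)
  let ?b = "real CARD('n) + s + 1"
  let ?M = "bergman_measure s :: (complex^'n) measure"
  show b: "?b > 0" using s by (simp add: add_pos_pos add_nonneg_pos)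
  have mk: "fact k / pochhammer ?b k \<ge> 0" for k by (intro divide_nonneg_pos pochhammer_pos b) auto
  show inv: "unitarily_invariant ?M" by (rule unitarily_invariant_bergman_measure[OF s])
  show "AE z in ?M. norm z < 1"
    unfolding bergman_measure_def
    by (subst AE_density) (use AE_ball_measure in \<open>auto elim: eventually_mono cong: measurable_cong_sets\<close>)
  have mom: "unitarily_invariant.moment ?M k u = fact k / pochhammer ?b k" if u: "norm u = 1" for k u
    using nn_integral_bergman_moment[OF s u, of k] unfolding unitarily_invariant.nn_integral_moment[OF inv]
    using mk[of k] unitarily_invariant.moment_nonneg[OF inv] by simp
  show "unitarily_invariant.moment ?M k u \<le> fact k / pochhammer ?b k" if "norm u = 1" for k u
    using mom[OF that] by simp
  show "\<exists>r. (\<forall>n. r n \<in> {()}) \<and> (\<forall>k u. norm u = 1 \<longrightarrow> (\<lambda>n. unitarily_invariant.moment ?M k u) \<longlonglongrightarrow> fact k / pochhammer ?b k)"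
    by (auto simp: mom)
  show "bergman_space s \<subseteq> (holomorphic_ball :: (complex^'n \<Rightarrow> complex) set)" by (auto simp: bergman_space_def)
  have w: "0 \<le> (cmod (f z))\<^sup>2 * bergman_weight s z" for f and z :: "complex^'n"
    by (intro mult_nonneg_nonneg bergman_weight_nonneg[OF s]) auto
  have nrm: "0 \<le> bergman_norm s f" "(bergman_norm s f)\<^sup>2 = (LINT z|ball_measure. (cmod (f z))\<^sup>2 * bergman_weight s z)" for f :: "complex^'n \<Rightarrow> complex"
    using Bochner_Integration.integral_nonneg[OF w] by (simp_all add: bergman_norm_def)
  have nn: "(\<integral>\<^sup>+z. ennreal ((cmod (f z))\<^sup>2) \<partial>?M) = (\<integral>\<^sup>+z. ennreal ((cmod (f z))\<^sup>2 * bergman_weight s z) \<partial>ball_measure)"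
    if "f \<in> holomorphic_ball" for f
    using holomorphic_ball_measurable[OF that]
    by (subst nn_integral_bergman_measure) (auto simp: ennreal_mult bergman_weight_nonneg[OF s] mult.commute)
  show "0 \<le> bergman_norm s f" for f :: "complex^'n \<Rightarrow> complex" by (rule nrm(1))
  show "(\<integral>\<^sup>+z. ennreal ((cmod (f z))\<^sup>2) \<partial>?M) \<le> ennreal ((bergman_norm s f)\<^sup>2)" if "f \<in> bergman_space s" for f
    using that by (subst nn) (auto simp: bergman_space_def nrm(2) nn_integral_eq_integral w)
  show "f \<in> bergman_space s \<and> (bergman_norm s f)\<^sup>2 \<le> C"
    if f: "f \<in> holomorphic_ball" and C: "0 \<le> C"
      and le': "\<And>i. i \<in> {()} \<Longrightarrow> (\<integral>\<^sup>+z. ennreal ((cmod (f z))\<^sup>2) \<partial>?M) \<le> ennreal C" for f C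
  proof -
    have [measurable]: "f \<in> borel_measurable borel" by (rule holomorphic_ball_measurable[OF f])
    have le: "(\<integral>\<^sup>+z. ennreal ((cmod (f z))\<^sup>2 * bergman_weight s z) \<partial>ball_measure) \<le> ennreal C"
      using le' nn[OF f] by simp
    \<comment> \<open>Finiteness of the nonnegative integral comes before any statement on
      \<open>bergman_norm\<close>, whose Bochner integral carries information only for integrable
      functions.\<close>
    have int: "integrable ball_measure (\<lambda>z. (cmod (f z))\<^sup>2 * bergman_weight s z)"
    proof (rule integrableI_nonneg)
      show "(\<integral>\<^sup>+z. ennreal ((cmod (f z))\<^sup>2 * bergman_weight s z) \<partial>ball_measure) < \<infinity>"
        using le by (rule le_less_trans) simp
    qed (auto simp: w cong: measurable_cong_sets)
    have "ennreal (LINT z|ball_measure. (cmod (f z))\<^sup>2 * bergman_weight s z) \<le> ennreal C"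
      using le by (subst (asm) nn_integral_eq_integral[OF int]) (auto simp: w)
    then show ?thesis using f int C by (simp add: bergman_space_def nrm(2) ennreal_le_iff)
  qed
qed

theorem theorem2p1:
  fixes \<phi> \<psi> :: "complex^'n \<Rightarrow> complex^'n"
    and \<zeta> :: "complex^'n"
    and H :: "(complex^'n \<Rightarrow> complex) set"
    and nrm :: "(complex^'n \<Rightarrow> complex) \<Rightarrow> real"
    and \<beta> :: real
  assumes space: "(H = hardy_space \<and> nrm = hardy_norm \<and> \<beta> = real CARD('n)) \<or>
      (\<exists>s>-1. H = bergman_space s \<and> nrm = bergman_norm s \<and> \<beta> = real CARD('n) + s + 1)"
    and "analytic_self_map \<phi>" and "analytic_self_map \<psi>"
    and "bounded_op H nrm (comp_op \<phi>)" and "bounded_op H nrm (comp_op \<psi>)"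
    and "\<zeta> \<in> sphere 0 1" and "finite_angular_derivative \<phi> \<zeta>"
    and "\<not> ((\<exists>w. has_radial_limit \<phi> \<zeta> w \<and> has_radial_limit \<psi> \<zeta> w) \<and>
          dilation_coeff \<psi> \<zeta> = dilation_coeff \<phi> \<zeta>)"
  shows "(ess_norm H nrm (op_diff (comp_op \<phi>) (comp_op \<psi>)))\<^sup>2
      \<ge> real_of_ereal (dilation_coeff \<phi> \<zeta>) powr (- \<beta>)"
  using space
proof (elim disjE exE conjE)
  assume H: "H = hardy_space" "nrm = hardy_norm" "\<beta> = real CARD('n)"
  show ?thesis
    using assms unfolding H by (intro invariant_norm.ess_norm_lower_bound[OF hardy_invariant_norm]) auto
next
  fix s :: real assume s: "s > -1" and H: "H = bergman_space s" "nrm = bergman_norm s" "\<beta> = real CARD('n) + s + 1"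
  show ?thesis
    using assms unfolding H by (intro invariant_norm.ess_norm_lower_bound[OF bergman_invariant_norm[OF s]]) auto
qed

end
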